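(* Let $K_{\mathrm{ER}}^{(n)}(t)$ denote the number of connected components at time $t\ge 0$ of the continuous-time Erdős–Rényi random graph process $\mathrm{ER}^{(n)}$ on the vertex set $\{1,\dots,n\}$. For every interval $[0,c]$ with $0\le c<1$, we have \[ \left( \frac{1}{n} K_{\mathrm{ER}}^{(n)}\Big(\frac{t}{n}\Big) \right)_{t\in[0,c]} \Rightarrow \left(1-\frac{t}{2}\right)_{t\in[0,c]} \quad \text{in } D([0,c],\mathbb{R}) \text{ as } n\to\infty . \] Furthermore, \[ \left( \sqrt{n}\left( \frac{1}{n} K_{\mathrm{ER}}^{(n)}\Big(\frac{t}{n}\Big) - \Big(1-\frac{t}{2}\Big)\right)\right)_{t\in[0,c]} \Rightarrow \left( B\Big(\frac{t}{2}\Big)\right)_{t\in[0,c]} \quad \text{in } D([0,c],\mathbb{R}) \text{ as } n\to\infty , \] where $B$ is a (standard one-dimensional) Brownian motion.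
   Context: The process $(\mathrm{ER}^{(n)}(t))_{t\ge 0}$ is the continuous-time Markov chain on graphs with vertex set $\{1,\dots,n\}$ which starts at time $0$ from the graph with no edges and in which each of the $\binom{n}{2}$ possible edges appears (and then stays forever) at an exponential time of rate $1$, independently of all the other edges. $D([0,c],\mathbb{R})$ is the space of càdlàg real-valued functions on $[0,c]$ endowed with the Skorokhod $J_1$ topology, and $\Rightarrow$ denotes convergence in distribution. *)

theory Defs
  imports "HOL-Probability.Probability"
begin

section \<open>Erdos-Renyi graph process\<close>

text \<open>A graph is given by its vertex set \<open>V\<close> and its set \<open>E\<close> of edges, an edge being the
  two-element set of its endpoints.\<close>

definition complete_edges :: "nat \<Rightarrow> nat set set" where
  "complete_edges n = {e. e \<subseteq> {1..n} \<and> card e = 2}"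

definition connected_components :: "'v set \<Rightarrow> 'v set set \<Rightarrow> 'v set set" where
  "connected_components V E =
     V // {(u, v). u \<in> V \<and> v \<in> V \<and> (u, v) \<in> {(a, b). {a, b} \<in> E}\<^sup>*}"

text \<open>\<open>G t \<omega>\<close> is the edge set at time \<open>t\<close> on the vertex set \<open>{1..n}\<close>, and \<open>T e\<close> is the time
  at which the edge \<open>e\<close> appears.\<close>

definition ER_process :: "nat \<Rightarrow> 'a measure \<Rightarrow> (real \<Rightarrow> 'a \<Rightarrow> nat set set) \<Rightarrow> bool" where
  "ER_process n M G \<longleftrightarrow>
     prob_space M \<and>
     (\<exists>T :: nat set \<Rightarrow> 'a \<Rightarrow> real.
        prob_space.indep_vars M (\<lambda>_. borel) T (complete_edges n) \<and>
        (\<forall>e\<in>complete_edges n. distributed M lborel (T e) (exponential_density 1)) \<and>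
        (\<forall>\<omega>\<in>space M. \<forall>t\<ge>0. G t \<omega> = {e \<in> complete_edges n. T e \<omega> \<le> t}))"

definition K_ER :: "nat \<Rightarrow> (real \<Rightarrow> 'a \<Rightarrow> nat set set) \<Rightarrow> real \<Rightarrow> 'a \<Rightarrow> nat" where
  "K_ER n G t \<omega> = card (connected_components {1..n} (G t \<omega>))"


section \<open>Brownian motion\<close>

definition standard_brownian_motion :: "'b measure \<Rightarrow> (real \<Rightarrow> 'b \<Rightarrow> real) \<Rightarrow> bool" where
  "standard_brownian_motion N B \<longleftrightarrow>
     prob_space N \<and>
     (\<forall>t\<ge>0. B t \<in> borel_measurable N) \<and>
     (AE \<omega> in N. B 0 \<omega> = 0) \<and>
     (\<forall>s t. 0 \<le> s \<and> s < t \<longrightarrow>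
        distributed N lborel (\<lambda>\<omega>. B t \<omega> - B s \<omega>) (normal_density 0 (sqrt (t - s)))) \<and>
     (\<forall>(k::nat) \<tau>. 0 \<le> \<tau> 0 \<and> (\<forall>i<k. \<tau> i \<le> \<tau> (Suc i)) \<longrightarrow>
        prob_space.indep_vars N (\<lambda>_. borel) (\<lambda>i \<omega>. B (\<tau> (Suc i)) \<omega> - B (\<tau> i) \<omega>) {..<k}) \<and>
     (\<forall>\<omega>\<in>space N. continuous_on {0..} (\<lambda>t. B t \<omega>))"


section \<open>The Skorokhod space \<open>D([0,c],\<real>)\<close> with the \<open>J\<^sub>1\<close> topology\<close>

text \<open>Functions on \<open>[0,c]\<close> are represented by extensional functions on \<open>\<real>\<close>, so that two of them
  are equal iff they agree on \<open>[0,c]\<close>.\<close>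

definition cadlag :: "real \<Rightarrow> (real \<Rightarrow> real) set" where
  "cadlag c = {x \<in> extensional {0..c}.
     (\<forall>t\<in>{0..<c}. (x \<longlongrightarrow> x t) (at_right t)) \<and>
     (\<forall>t\<in>{0<..c}. \<exists>l. (x \<longlongrightarrow> l) (at_left t))}"

text \<open>Increasing bijections of \<open>[0,c]\<close>; these are automatically homeomorphisms.\<close>

definition time_changes :: "real \<Rightarrow> (real \<Rightarrow> real) set" where
  "time_changes c = {\<theta>. strict_mono_on {0..c} \<theta> \<and> \<theta> ` {0..c} = {0..c}}"

definition skorokhod_close :: "real \<Rightarrow> (real \<Rightarrow> real) \<Rightarrow> (real \<Rightarrow> real) \<Rightarrow> real \<Rightarrow> bool" where
  "skorokhod_close c x y \<epsilon> \<longleftrightarrow>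
     (\<exists>\<theta>\<in>time_changes c. \<forall>t\<in>{0..c}. \<bar>\<theta> t - t\<bar> \<le> \<epsilon> \<and> \<bar>x t - y (\<theta> t)\<bar> \<le> \<epsilon>)"

text \<open>The value \<open>0\<close> off the space is a dummy: \<^locale>\<open>Metric_space\<close> asks for nonnegativity at all
  arguments, and \<open>Inf {}\<close> is unspecified.\<close>

definition skorokhod_dist :: "real \<Rightarrow> (real \<Rightarrow> real) \<Rightarrow> (real \<Rightarrow> real) \<Rightarrow> real" where
  "skorokhod_dist c x y =
     (if x \<in> cadlag c \<and> y \<in> cadlag c then Inf {\<epsilon>. 0 < \<epsilon> \<and> skorokhod_close c x y \<epsilon>} else 0)"

definition skorokhod_topology :: "real \<Rightarrow> (real \<Rightarrow> real) topology" where
  "skorokhod_topology c = Metric_space.mtopology (cadlag c) (skorokhod_dist c)"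

lemma id_time_change: "(\<lambda>t. t) \<in> time_changes c"
  by (auto simp: time_changes_def strict_mono_on_def)

lemma skorokhod_close_refl: "0 \<le> \<epsilon> \<Longrightarrow> skorokhod_close c x x \<epsilon>"
  unfolding skorokhod_close_def by (rule bexI[OF _ id_time_change]) auto

lemma skorokhod_close_mono: "skorokhod_close c x y \<epsilon> \<Longrightarrow> \<epsilon> \<le> \<delta> \<Longrightarrow> skorokhod_close c x y \<delta>"
  unfolding skorokhod_close_def by (meson order_trans)

lemma skorokhod_close_sym:
  assumes "skorokhod_close c x y \<epsilon>"
  shows "skorokhod_close c y x \<epsilon>"
proof -
  obtain l where l: "strict_mono_on {0..c} l" "l ` {0..c} = {0..c}"
    and b: "\<And>t. t \<in> {0..c} \<Longrightarrow> \<bar>l t - t\<bar> \<le> \<epsilon> \<and> \<bar>x t - y (l t)\<bar> \<le> \<epsilon>"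
    using assms unfolding skorokhod_close_def time_changes_def by auto
  define m where "m = the_inv_into {0..c} l"
  have inj: "inj_on l {0..c}"
    using l(1) by (rule strict_mono_on_imp_inj_on)
  have lm: "l (m t) = t" "m t \<in> {0..c}" if "t \<in> {0..c}" for t
  proof -
    have t: "t \<in> l ` {0..c}" using that l(2) by simp
    show "l (m t) = t" unfolding m_def by (rule f_the_inv_into_f[OF inj t])
    show "m t \<in> {0..c}" unfolding m_def by (rule the_inv_into_into[OF inj t]) simp
  qed
  have ml: "m (l t) = t" if "t \<in> {0..c}" for t
    using that inj by (simp add: m_def the_inv_into_f_f)
  have "strict_mono_on {0..c} m"
  proof (rule strict_mono_onI)
    fix r s assume rs: "r \<in> {0..c}" "s \<in> {0..c}" "r < s"
    show "m r < m s"
    proof (rule ccontr)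
      assume "\<not> m r < m s"
      then have "m s = m r \<or> m s < m r" by auto
      then have "l (m s) \<le> l (m r)"
        using strict_mono_onD[OF l(1) lm(2)[OF rs(2)] lm(2)[OF rs(1)]] by auto
      then show False using lm(1)[OF rs(1)] lm(1)[OF rs(2)] rs(3) by simp
    qed
  qed
  moreover have "m ` {0..c} = {0..c}"
  proof
    show "m ` {0..c} \<subseteq> {0..c}" using lm by auto
    show "{0..c} \<subseteq> m ` {0..c}" using ml l(2) by (metis image_eqI subsetI)
  qed
  moreover have "\<bar>m t - t\<bar> \<le> \<epsilon> \<and> \<bar>y t - x (m t)\<bar> \<le> \<epsilon>" if "t \<in> {0..c}" for t
    using b[OF lm(2)[OF that]] lm(1)[OF that] by (simp add: abs_minus_commute)
  ultimately show ?thesis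
    unfolding skorokhod_close_def time_changes_def by (intro bexI[of _ m]) simp_all
qed

lemma skorokhod_close_trans:
  assumes "skorokhod_close c x y \<epsilon>" "skorokhod_close c y z \<delta>"
  shows "skorokhod_close c x z (\<epsilon> + \<delta>)"
proof -
  obtain l where l: "strict_mono_on {0..c} l" "l ` {0..c} = {0..c}"
    and bl: "\<And>t. t \<in> {0..c} \<Longrightarrow> \<bar>l t - t\<bar> \<le> \<epsilon> \<and> \<bar>x t - y (l t)\<bar> \<le> \<epsilon>"
    using assms(1) unfolding skorokhod_close_def time_changes_def by auto
  obtain m where m: "strict_mono_on {0..c} m" "m ` {0..c} = {0..c}"
    and bm: "\<And>t. t \<in> {0..c} \<Longrightarrow> \<bar>m t - t\<bar> \<le> \<delta> \<and> \<bar>y t - z (m t)\<bar> \<le> \<delta>"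
    using assms(2) unfolding skorokhod_close_def time_changes_def by auto
  have "strict_mono_on {0..c} (\<lambda>t. m (l t))"
  proof (rule strict_mono_onI)
    fix r s assume rs: "r \<in> {0..c}" "s \<in> {0..c}" "r < s"
    then have "l r < l s" using l(1) by (simp add: strict_mono_onD)
    moreover have "l r \<in> {0..c}" "l s \<in> {0..c}" using rs l(2) by blast+
    ultimately show "m (l r) < m (l s)" using m(1) by (simp add: strict_mono_onD)
  qed
  moreover have "(\<lambda>t. m (l t)) ` {0..c} = {0..c}"
    using l(2) m(2) by (metis image_image)
  moreover have "\<bar>m (l t) - t\<bar> \<le> \<epsilon> + \<delta> \<and> \<bar>x t - z (m (l t))\<bar> \<le> \<epsilon> + \<delta>" if "t \<in> {0..c}" for t
  proof -
    have "l t \<in> {0..c}" using that l(2) by blast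
    note bounds = bl[OF that] bm[OF this]
    have "\<bar>(m (l t) - l t) + (l t - t)\<bar> \<le> \<delta> + \<epsilon>"
      using bounds by (intro order_trans[OF abs_triangle_ineq] add_mono) simp_all
    moreover have "\<bar>(x t - y (l t)) + (y (l t) - z (m (l t)))\<bar> \<le> \<epsilon> + \<delta>"
      using bounds by (intro order_trans[OF abs_triangle_ineq] add_mono) simp_all
    ultimately show ?thesis by (simp add: add.commute)
  qed
  ultimately show ?thesis
    unfolding skorokhod_close_def time_changes_def by (intro bexI[of _ "\<lambda>t. m (l t)"]) simp_all
qed

lemma cadlag_bounded:
  assumes "x \<in> cadlag c" "0 \<le> c"
  shows "bounded (x ` {0..c})"
proof -
  have ev: "\<exists>d>0. \<exists>B. \<forall>s. s \<in> {0..c} \<longrightarrow> t - d < s \<longrightarrow> s < t + d \<longrightarrow> \<bar>x s\<bar> \<le> B"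
    if t: "0 \<le> t" "t \<le> c" for t
  proof -
    have R: "\<exists>d>0. \<exists>B. \<forall>s. s \<in> {0..c} \<longrightarrow> t < s \<longrightarrow> s < t + d \<longrightarrow> \<bar>x s\<bar> \<le> B"
    proof (cases "t < c")
      case True
      then have "(x \<longlongrightarrow> x t) (at_right t)" using assms t by (auto simp: cadlag_def)
      then have "eventually (\<lambda>s. dist (x s) (x t) < 1) (at_right t)"
        by (rule tendstoD) simp
      then obtain b where b: "b > t" "\<And>s. t < s \<Longrightarrow> s < b \<Longrightarrow> \<bar>x s - x t\<bar> < 1"
        by (auto simp: eventually_at_right_field dist_real_def)
      have "\<bar>x s\<bar> \<le> \<bar>x t\<bar> + 1" if "t < s" "s < b" for s
        using b(2)[OF that] by linarith
      then show ?thesis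
        using b(1) by (intro exI[of _ "b - t"] conjI exI[of _ "\<bar>x t\<bar> + 1"]) simp_all
    next
      case False
      then show ?thesis using t by (intro exI[of _ 1]) auto
    qed
    have L: "\<exists>d>0. \<exists>B. \<forall>s. s \<in> {0..c} \<longrightarrow> s < t \<longrightarrow> t - d < s \<longrightarrow> \<bar>x s\<bar> \<le> B"
    proof (cases "0 < t")
      case True
      then have "t \<in> {0<..c}" using t by simp
      then obtain l where "(x \<longlongrightarrow> l) (at_left t)" using assms unfolding cadlag_def by blast
      then have "eventually (\<lambda>s. dist (x s) l < 1) (at_left t)"
        by (rule tendstoD) simp
      then obtain b where b: "b < t" "\<And>s. b < s \<Longrightarrow> s < t \<Longrightarrow> \<bar>x s - l\<bar> < 1"
        by (auto simp: eventually_at_left_field dist_real_def)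
      have "\<bar>x s\<bar> \<le> \<bar>l\<bar> + 1" if "b < s" "s < t" for s
        using b(2)[OF that] by linarith
      then show ?thesis
        using b(1) by (intro exI[of _ "t - b"] conjI exI[of _ "\<bar>l\<bar> + 1"]) simp_all
    next
      case False
      then show ?thesis using t by (intro exI[of _ 1]) auto
    qed
    from R obtain d1 B1 where 1: "d1 > 0"
      "\<And>s. s \<in> {0..c} \<Longrightarrow> t < s \<Longrightarrow> s < t + d1 \<Longrightarrow> \<bar>x s\<bar> \<le> B1" by blast
    from L obtain d2 B2 where 2: "d2 > 0"
      "\<And>s. s \<in> {0..c} \<Longrightarrow> s < t \<Longrightarrow> t - d2 < s \<Longrightarrow> \<bar>x s\<bar> \<le> B2" by blast
    have "\<bar>x s\<bar> \<le> max (max B1 B2) \<bar>x t\<bar>"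
      if "s \<in> {0..c}" "t - min d1 d2 < s" "s < t + min d1 d2" for s
    proof (cases s t rule: linorder_cases)
      case less
      moreover have "t - d2 < s" using that(2) min.cobounded2[of d1 d2] by linarith
      ultimately have "\<bar>x s\<bar> \<le> B2" using 2(2) that(1) by blast
      then show ?thesis by (simp add: le_max_iff_disj)
    next
      case greater
      moreover have "s < t + d1" using that(3) min.cobounded1[of d1 d2] by linarith
      ultimately have "\<bar>x s\<bar> \<le> B1" using 1(2) that(1) by blast
      then show ?thesis by (simp add: le_max_iff_disj)
    qed simp
    moreover have "min d1 d2 > 0" using 1(1) 2(1) by simp
    ultimately show ?thesis by blast
  qed
  define P where "P a b \<longleftrightarrow> bounded (x ` ({a..b} \<inter> {0..c}))" for a b
  have trans: "P a d" if "P a b" "P b d" for a b d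
  proof -
    have "x ` ({a..d} \<inter> {0..c}) \<subseteq> x ` ({a..b} \<inter> {0..c}) \<union> x ` ({b..d} \<inter> {0..c})"
    proof
      fix z assume "z \<in> x ` ({a..d} \<inter> {0..c})"
      then obtain s where "z = x s" "s \<in> {0..c}" "a \<le> s" "s \<le> d" by auto
      then show "z \<in> x ` ({a..b} \<inter> {0..c}) \<union> x ` ({b..d} \<inter> {0..c})"
        by (cases "s \<le> b") simp_all
    qed
    moreover have "bounded (x ` ({a..b} \<inter> {0..c}) \<union> x ` ({b..d} \<inter> {0..c}))"
      using that by (simp only: P_def bounded_Un simp_thms)
    ultimately show ?thesis unfolding P_def by (rule bounded_subset[rotated])
  qed
  have local: "\<exists>d>0. \<forall>a b. a \<le> t \<and> t \<le> b \<and> b - a < d \<longrightarrow> P a b" if t: "0 \<le> t" "t \<le> c" for t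
  proof -
    obtain d B where d: "d > 0"
      and B: "\<And>s. s \<in> {0..c} \<Longrightarrow> t - d < s \<Longrightarrow> s < t + d \<Longrightarrow> \<bar>x s\<bar> \<le> B"
      using ev[OF t] by blast
    have "P a b" if "a \<le> t" "t \<le> b" "b - a < d" for a b
      unfolding P_def
    proof (rule boundedI)
      fix z assume "z \<in> x ` ({a..b} \<inter> {0..c})"
      then obtain s where s: "z = x s" "s \<in> {0..c}" "a \<le> s" "s \<le> b" by auto
      have "t - d < s" "s < t + d" using that s(3,4) by linarith+
      then show "norm z \<le> B" using B[OF s(2)] s(1) by simp
    qed
    then show ?thesis using d by blast
  qed
  have "P 0 c"
    by (rule Bolzano[of 0 c P]) (use assms(2) trans local in blast)+
  then show ?thesis by (simp add: P_def)
qed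

lemma skorokhod_close_exists:
  assumes "x \<in> cadlag c" "y \<in> cadlag c" "0 \<le> c"
  shows "\<exists>\<epsilon>>0. skorokhod_close c x y \<epsilon>"
proof -
  obtain a where a: "\<And>t. t \<in> {0..c} \<Longrightarrow> \<bar>x t\<bar> \<le> a"
    using cadlag_bounded[OF assms(1,3)] unfolding bounded_iff real_norm_def by blast
  obtain b where b: "\<And>t. t \<in> {0..c} \<Longrightarrow> \<bar>y t\<bar> \<le> b"
    using cadlag_bounded[OF assms(2,3)] unfolding bounded_iff real_norm_def by blast
  have "skorokhod_close c x y (\<bar>a\<bar> + \<bar>b\<bar> + 1)"
    unfolding skorokhod_close_def
  proof (intro bexI[OF _ id_time_change] ballI)
    fix t assume "t \<in> {0..c}"
    from a[OF this] b[OF this]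
    show "\<bar>t - t\<bar> \<le> \<bar>a\<bar> + \<bar>b\<bar> + 1 \<and> \<bar>x t - y t\<bar> \<le> \<bar>a\<bar> + \<bar>b\<bar> + 1" by linarith
  qed
  then show ?thesis by (intro exI[of _ "\<bar>a\<bar> + \<bar>b\<bar> + 1"]) auto
qed

lemma skorokhod_dist_le:
  assumes "x \<in> cadlag c" "y \<in> cadlag c" "0 < \<epsilon>" "skorokhod_close c x y \<epsilon>"
  shows "skorokhod_dist c x y \<le> \<epsilon>"
  using assms by (auto simp: skorokhod_dist_def intro!: cInf_lower bdd_belowI[of _ 0])

lemma skorokhod_dist_less:
  assumes "x \<in> cadlag c" "y \<in> cadlag c" "0 \<le> c" "skorokhod_dist c x y < \<delta>"
  shows "skorokhod_close c x y \<delta>"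
proof -
  let ?S = "{\<epsilon>. 0 < \<epsilon> \<and> skorokhod_close c x y \<epsilon>}"
  have "?S \<noteq> {}" using skorokhod_close_exists[OF assms(1-3)] by auto
  then obtain \<epsilon> where "\<epsilon> \<in> ?S" "\<epsilon> < \<delta>"
    using assms cInf_lessD[of ?S \<delta>] by (auto simp: skorokhod_dist_def)
  then show ?thesis using skorokhod_close_mono by auto
qed

lemma cadlag_eqI:
  assumes x: "x \<in> cadlag c" and y: "y \<in> cadlag c" and c: "0 \<le> c"
    and close: "\<And>\<epsilon>. 0 < \<epsilon> \<Longrightarrow> skorokhod_close c x y \<epsilon>"
  shows "x = y"
proof -
  have "\<exists>l. strict_mono_on {0..c} l \<and> l ` {0..c} = {0..c} \<and>
      (\<forall>t\<in>{0..c}. \<bar>l t - t\<bar> \<le> 1 / real (Suc k) \<and> \<bar>x t - y (l t)\<bar> \<le> 1 / real (Suc k))" for k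
    using close[of "1 / real (Suc k)"] unfolding skorokhod_close_def time_changes_def by auto
  then obtain l where l: "\<And>k. strict_mono_on {0..c} (l k)" "\<And>k. l k ` {0..c} = {0..c}"
    "\<And>k t. t \<in> {0..c} \<Longrightarrow> \<bar>l k t - t\<bar> \<le> 1 / real (Suc k)"
    "\<And>k t. t \<in> {0..c} \<Longrightarrow> \<bar>x t - y (l k t)\<bar> \<le> 1 / real (Suc k)"
    by metis
  have lim0: "(\<lambda>k. 1 / real (Suc k)) \<longlonglongrightarrow> 0"
    using LIMSEQ_inverse_real_of_nat by (simp add: inverse_eq_divide)
  have lt: "(\<lambda>k. l k t) \<longlonglongrightarrow> t" if "t \<in> {0..c}" for t
    by (rule LIM_zero_cancel, rule Lim_null_comparison[OF _ lim0]) (use l(3)[OF that] in auto)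
  have yl: "(\<lambda>k. y (l k t)) \<longlonglongrightarrow> x t" if "t \<in> {0..c}" for t
    by (rule LIM_zero_cancel, rule Lim_null_comparison[OF _ lim0])
       (use l(4)[OF that] in \<open>auto simp: abs_minus_commute\<close>)
  have endpoint: "x c = y c"
  proof -
    have "l k c = c" for k
    proof -
      obtain s where s: "s \<in> {0..c}" "l k s = c" using l(2)[of k] c by (metis atLeastAtMost_iff imageE order_refl)
      have "l k c \<le> c" using l(2)[of k] c by force
      moreover have "c \<le> l k c"
        using s l(1)[of k] c by (metis atLeastAtMost_iff order_le_less order_refl strict_mono_onD)
      ultimately show ?thesis by simp
    qed
    then have "(\<lambda>k::nat. y c) \<longlonglongrightarrow> x c" using yl[of c] c by simp
    then show ?thesis by (simp add: LIMSEQ_const_iff)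
  qed
  have approx: "\<exists>s\<in>{t<..<t + \<delta>}. \<bar>x s - y s\<bar> < \<epsilon>"
    if t: "0 \<le> t" "t < c" and \<delta>: "0 < \<delta>" "t + \<delta> \<le> c" and \<epsilon>: "0 < \<epsilon>" for t \<delta> \<epsilon>
  proof -
    text \<open>\<open>y\<close> has a right limit at \<open>t\<close>, so both functions are nearly constant just after \<open>t\<close>.\<close>
    have "(y \<longlongrightarrow> y t) (at_right t)" using y t by (auto simp: cadlag_def)
    then have "eventually (\<lambda>s. dist (y s) (y t) < \<epsilon> / 4) (at_right t)"
      by (rule tendstoD) (use \<epsilon> in simp)
    then obtain b where b: "b > t" "\<And>s. t < s \<Longrightarrow> s < b \<Longrightarrow> \<bar>y s - y t\<bar> < \<epsilon> / 4"
      by (auto simp: eventually_at_right_field dist_real_def)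
    have "t < min (t + \<delta>) b" using b(1) \<delta> by simp
    then obtain s where "t < s" "s < min (t + \<delta>) b" using dense by blast
    then have s: "t < s" "s < t + \<delta>" "s < b" "s \<in> {0..c}" using \<delta> t by simp_all
    have "eventually (\<lambda>k. t < l k s \<and> l k s < b) sequentially"
      using order_tendstoD[OF lt[OF s(4)]] s by (auto intro: eventually_conj)
    moreover have "eventually (\<lambda>k. dist (y (l k s)) (x s) < \<epsilon> / 4) sequentially"
      using yl[OF s(4)] by (rule tendstoD) (use \<epsilon> in simp)
    ultimately have "eventually (\<lambda>k. t < l k s \<and> l k s < b \<and> dist (y (l k s)) (x s) < \<epsilon> / 4) sequentially"
      by eventually_elim auto
    then obtain k where "t < l k s" "l k s < b" "dist (y (l k s)) (x s) < \<epsilon> / 4"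
      by (auto dest: eventually_happens)
    then have "\<bar>x s - y s\<bar> < \<epsilon>"
      using b(2)[of s] b(2)[of "l k s"] s unfolding dist_real_def by linarith
    then show ?thesis using s by auto
  qed
  have interior: "x t = y t" if t: "0 \<le> t" "t < c" for t
  proof (rule ccontr)
    assume "x t \<noteq> y t"
    define \<epsilon> where "\<epsilon> = \<bar>x t - y t\<bar> / 2"
    have \<epsilon>: "0 < \<epsilon>" using \<open>x t \<noteq> y t\<close> by (simp add: \<epsilon>_def)
    have "((\<lambda>s. \<bar>x s - y s\<bar>) \<longlongrightarrow> \<bar>x t - y t\<bar>) (at_right t)"
      using x y t by (intro tendsto_intros) (auto simp: cadlag_def)
    then have "eventually (\<lambda>s. \<epsilon> < \<bar>x s - y s\<bar>) (at_right t)"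
      using \<open>x t \<noteq> y t\<close> by (intro order_tendstoD(1)) (auto simp: \<epsilon>_def)
    then obtain b where b: "b > t" "\<And>s. t < s \<Longrightarrow> s < b \<Longrightarrow> \<epsilon> < \<bar>x s - y s\<bar>"
      by (auto simp: eventually_at_right_field)
    have "0 < min (b - t) (c - t)" "t + min (b - t) (c - t) \<le> c" using b(1) t by auto
    from approx[OF t this \<epsilon>] obtain s
      where "s \<in> {t<..<t + min (b - t) (c - t)}" "\<bar>x s - y s\<bar> < \<epsilon>" by blast
    moreover have "t + min (b - t) (c - t) \<le> b" by linarith
    ultimately show False using b(2)[of s] by auto
  qed
  show ?thesis
  proof (rule extensionalityI[of _ "{0..c}"])
    show "x \<in> extensional {0..c}" "y \<in> extensional {0..c}" using x y by (auto simp: cadlag_def)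
    fix t assume "t \<in> {0..c}"
    then show "x t = y t" using endpoint interior[of t] by (cases "t = c") auto
  qed
qed

theorem Metric_space_skorokhod:
  assumes c: "0 \<le> c"
  shows "Metric_space (cadlag c) (skorokhod_dist c)"
proof
  show nonneg: "0 \<le> skorokhod_dist c x y" for x y
  proof (cases "x \<in> cadlag c \<and> y \<in> cadlag c")
    case True
    then have "{\<epsilon>. 0 < \<epsilon> \<and> skorokhod_close c x y \<epsilon>} \<noteq> {}"
      using skorokhod_close_exists[of x c y] c by auto
    then have "0 \<le> Inf {\<epsilon>. 0 < \<epsilon> \<and> skorokhod_close c x y \<epsilon>}"
      by (rule cInf_greatest) auto
    then show ?thesis by (simp add: skorokhod_dist_def)
  qed (auto simp: skorokhod_dist_def)
  show "skorokhod_dist c x y = skorokhod_dist c y x" for x y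
    by (auto simp: skorokhod_dist_def intro!: arg_cong[where f=Inf] skorokhod_close_sym)
  show "skorokhod_dist c x y = 0 \<longleftrightarrow> x = y" if "x \<in> cadlag c" "y \<in> cadlag c" for x y
  proof
    assume "skorokhod_dist c x y = 0"
    then show "x = y"
      using cadlag_eqI[OF that c] skorokhod_dist_less[OF that c] by simp
  next
    assume "x = y"
    have "skorokhod_dist c x y \<le> 0 + \<epsilon>" if "0 < \<epsilon>" for \<epsilon>
      using skorokhod_dist_le[of x c y \<epsilon>] skorokhod_close_refl[of \<epsilon> c x] that \<open>x = y\<close>
        \<open>x \<in> cadlag c\<close> by auto
    then have "skorokhod_dist c x y \<le> 0" by (rule field_le_epsilon)
    then show "skorokhod_dist c x y = 0" using nonneg[of x y] by simp
  qed
  show "skorokhod_dist c x z \<le> skorokhod_dist c x y + skorokhod_dist c y z"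
    if "x \<in> cadlag c" "y \<in> cadlag c" "z \<in> cadlag c" for x y z
  proof (rule field_le_epsilon)
    fix \<epsilon> :: real assume "0 < \<epsilon>"
    let ?a = "skorokhod_dist c x y + \<epsilon> / 2" and ?b = "skorokhod_dist c y z + \<epsilon> / 2"
    have "skorokhod_close c x y ?a" "skorokhod_close c y z ?b"
      using that c \<open>0 < \<epsilon>\<close> by (auto intro!: skorokhod_dist_less)
    then have "skorokhod_close c x z (?a + ?b)" by (rule skorokhod_close_trans)
    then have "skorokhod_dist c x z \<le> ?a + ?b"
      using that nonneg[of x y] nonneg[of y z] \<open>0 < \<epsilon>\<close> by (intro skorokhod_dist_le) auto
    then show "skorokhod_dist c x z \<le> skorokhod_dist c x y + skorokhod_dist c y z + \<epsilon>"
      by (simp add: field_simps)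
  qed
qed


section \<open>Convergence in distribution\<close>

definition borel_algebra :: "'d topology \<Rightarrow> 'd measure" where
  "borel_algebra S = sigma (topspace S) {U. openin S U}"

text \<open>Convergence in distribution of the \<open>X n\<close>, each on its own probability space \<open>M n\<close>, to \<open>Y\<close> on
  \<open>N\<close>. That all of them are random elements of \<open>S\<close>, i.e. Borel measurable, is part of the notion
  (the integrals of non-measurable functions would be \<open>0\<close>).\<close>

definition converges_in_distribution ::
  "'d topology \<Rightarrow> (nat \<Rightarrow> 'a measure) \<Rightarrow> (nat \<Rightarrow> 'a \<Rightarrow> 'd) \<Rightarrow> 'b measure \<Rightarrow> ('b \<Rightarrow> 'd) \<Rightarrow> bool" where
  "converges_in_distribution S M X N Y \<longleftrightarrow>
     (\<forall>n. prob_space (M n) \<and> X n \<in> M n \<rightarrow>\<^sub>M borel_algebra S) \<and>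
     prob_space N \<and> Y \<in> N \<rightarrow>\<^sub>M borel_algebra S \<and>
     (\<forall>f :: 'd \<Rightarrow> real. continuous_map S euclideanreal f \<and> bounded (f ` topspace S) \<longrightarrow>
        (\<lambda>n. \<integral>\<omega>. f (X n \<omega>) \<partial>M n) \<longlonglongrightarrow> (\<integral>\<omega>. f (Y \<omega>) \<partial>N))"

end

theory Submission
  imports Defs "HOL-Real_Asymp.Real_Asymp"
begin

text \<open>The number of components equals \<open>n - |E| + excess\<close>. The excess (the number of independent
  cycles) is nondecreasing in time and at most the number of edges that lie on a cycle, whose
  expectation stays bounded for \<open>c < 1\<close>; so it disappears after division by \<open>sqrt n\<close>, and only
  the number of edges matters, a sum of independent indicators. Its centred and scaled version is
  compared with its values on a dyadic grid, uniformly in time, by chaining with fourth moments;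
  on a fixed grid the increments converge by a multivariate version of Levy's continuity theorem.
  For the weak limit it suffices to test with bounded Lipschitz functions, for which an
  approximation that is close in expectation in the sup norm is enough.\<close>

section \<open>Weak convergence in metric spaces\<close>

text \<open>Both limits are continuous, so every comparison of paths behind the limit theorems can
  be made in the sup norm. A genuine time change is constructed only for Borel measurability of the
  paths, which is part of the notion of convergence. Instead of tightness, there is an error bound
  in expectation that is uniform in \<open>n\<close> up to a term vanishing with \<open>n\<close>.
  Second moments would not do for chaining: an increment over length \<open>h\<close> has variance
  of order \<open>h\<close>, and \<open>2^l\<close> of them sum to order one at every level. Fourth
  moments give \<open>h^2 + h / n\<close>. The term \<open>h / n\<close> comes from single edges and
  is harmless only for meshes not below \<open>1 / n\<close>, so monotonicity has to take over on
  finer scales. The variance \<open>t / 2\<close> is that of the edge count divided by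
  \<open>n\<close>: about \<open>n^2 / 2\<close> clocks ring before \<open>t / n\<close> with
  probability about \<open>t / n\<close> each. The condition \<open>c < 1\<close> keeps the mean
  degree below one, so that the recursion for connection probabilities has a bounded solution. The
  law of large numbers is a sup bound in expectation for the fluctuations, divided by
  \<open>sqrt n\<close>.\<close>

lemma space_borel_algebra: "space (borel_algebra S) = topspace S"
  unfolding borel_algebra_def by (rule space_measure_of) (use openin_subset in blast)

lemma sets_borel_algebra_openin: "openin S U \<Longrightarrow> U \<in> sets (borel_algebra S)"
  unfolding borel_algebra_def
  by (subst sets_measure_of) (use openin_subset in \<open>blast intro: sigma_sets.Basic\<close>)+

lemma measurable_borel_algebraI:
  assumes "\<And>\<omega>. \<omega> \<in> space M \<Longrightarrow> X \<omega> \<in> topspace S"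
    and "\<And>U. openin S U \<Longrightarrow> X -` U \<inter> space M \<in> sets M"
  shows "X \<in> M \<rightarrow>\<^sub>M borel_algebra S"
  unfolding borel_algebra_def
  by (rule measurable_measure_of) (use assms openin_subset in blast)+

lemma continuous_map_borel_measurable:
  fixes f :: "'d \<Rightarrow> real"
  assumes "continuous_map S euclideanreal f"
  shows "f \<in> borel_measurable (borel_algebra S)"
proof (rule borel_measurableI)
  fix U :: "real set" assume "open U"
  then have "openin S {x \<in> topspace S. f x \<in> U}"
    using assms by (auto simp: continuous_map_def)
  moreover have "f -` U \<inter> space (borel_algebra S) = {x \<in> topspace S. f x \<in> U}"
    by (auto simp: space_borel_algebra)
  ultimately show "f -` U \<inter> space (borel_algebra S) \<in> sets (borel_algebra S)"
    by (simp add: sets_borel_algebra_openin)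
qed

text \<open>A limit lies in the open set \<open>U\<close> iff the approximants eventually stay in
  one of the sets \<open>V m\<close> of points that lie inside \<open>U\<close> with a fixed margin.
  This expresses the preimage of \<open>U\<close> by countable unions and intersections of preimages
  under the \<open>Z k\<close>.\<close>

lemma (in Metric_space) measurable_limit_mtopology:
  assumes Z: "\<And>k. Z k \<in> \<Omega> \<rightarrow>\<^sub>M borel_algebra mtopology"
    and X: "\<And>\<omega>. \<omega> \<in> space \<Omega> \<Longrightarrow> X \<omega> \<in> M"
    and lim: "\<And>\<omega>. \<omega> \<in> space \<Omega> \<Longrightarrow> (\<lambda>k. d (Z k \<omega>) (X \<omega>)) \<longlonglongrightarrow> 0"
  shows "X \<in> \<Omega> \<rightarrow>\<^sub>M borel_algebra mtopology"
proof (rule measurable_borel_algebraI)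
  show "X \<omega> \<in> topspace mtopology" if "\<omega> \<in> space \<Omega>" for \<omega> using X that by simp
  fix U assume U: "openin mtopology U"
  \<comment> \<open>The strict inequality leaves room to shrink \<open>r\<close>, which is what
    makes \<open>V m\<close> open.\<close>
  define V where "V m = {y \<in> M. \<exists>r > 1 / real (Suc m). mball y r \<subseteq> U}" for m
  have "openin mtopology (V m)" for m
    unfolding openin_mtopology
  proof (intro conjI allI impI)
    show "V m \<subseteq> M" by (auto simp: V_def)
    fix y assume "y \<in> V m"
    then obtain r where r: "y \<in> M" "r > 1 / real (Suc m)" "mball y r \<subseteq> U" by (auto simp: V_def)
    define \<rho> where "\<rho> = (r - 1 / real (Suc m)) / 2"
    have \<rho>: "\<rho> > 0" "r - \<rho> > 1 / real (Suc m)" using r(2) unfolding \<rho>_def by argo+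
    have "mball y \<rho> \<subseteq> V m"
    proof
      fix z assume z: "z \<in> mball y \<rho>"
      then have "mball z (r - \<rho>) \<subseteq> mball y r"
        by (intro mball_subset) (auto simp: commute)
      then show "z \<in> V m" using z r \<rho> by (auto simp: V_def)
    qed
    then show "\<exists>r>0. mball y r \<subseteq> V m" using \<rho> by blast
  qed
  then have meas: "Z k -` V m \<inter> space \<Omega> \<in> sets \<Omega>" for k m
    using Z by (auto intro: measurable_sets sets_borel_algebra_openin)
  have ZM: "Z k \<omega> \<in> M" if "\<omega> \<in> space \<Omega>" for k \<omega>
    using measurable_space[OF Z that, of k] by (simp add: space_borel_algebra)
  have "X -` U \<inter> space \<Omega> = (\<Union>m. \<Union>k0. \<Inter>k\<in>{k0..}. Z k -` V m \<inter> space \<Omega>)"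
  proof (intro set_eqI iffI)
    fix \<omega> assume "\<omega> \<in> X -` U \<inter> space \<Omega>"
    then have \<omega>: "X \<omega> \<in> U" "\<omega> \<in> space \<Omega>" by auto
    then obtain \<rho> where \<rho>: "\<rho> > 0" "mball (X \<omega>) \<rho> \<subseteq> U" using U by (auto simp: openin_mtopology)
    obtain m where m: "1 / real (Suc m) < \<rho> / 2"
      using \<rho>(1) by (metis half_gt_zero nat_approx_posE)
    have "eventually (\<lambda>k. d (Z k \<omega>) (X \<omega>) < \<rho> / 2) sequentially"
      by (rule order_tendstoD(2)[OF lim[OF \<omega>(2)]]) (use \<rho> in simp)
    then obtain k0 where k0: "\<And>k. k \<ge> k0 \<Longrightarrow> d (Z k \<omega>) (X \<omega>) < \<rho> / 2"
      by (auto simp: eventually_sequentially)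
    have "Z k \<omega> \<in> V m" if "k \<ge> k0" for k
    proof -
      have "mball (Z k \<omega>) (\<rho> / 2) \<subseteq> mball (X \<omega>) \<rho>"
        using k0[OF that] ZM X \<omega> by (intro mball_subset) auto
      then have "mball (Z k \<omega>) (\<rho> / 2) \<subseteq> U" using \<rho> by blast
      then show ?thesis using m ZM[OF \<omega>(2)] unfolding V_def by blast
    qed
    then show "\<omega> \<in> (\<Union>m. \<Union>k0. \<Inter>k\<in>{k0..}. Z k -` V m \<inter> space \<Omega>)" using \<omega> by auto
  next
    fix \<omega> assume "\<omega> \<in> (\<Union>m. \<Union>k0. \<Inter>k\<in>{k0..}. Z k -` V m \<inter> space \<Omega>)"
    then obtain m k0 where *: "\<And>k. k \<ge> k0 \<Longrightarrow> Z k \<omega> \<in> V m" "\<omega> \<in> space \<Omega>" by auto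
    have "eventually (\<lambda>k. d (Z k \<omega>) (X \<omega>) < 1 / real (Suc m)) sequentially"
      by (rule order_tendstoD(2)[OF lim[OF *(2)]]) simp
    then obtain k1 where k1: "\<And>k. k \<ge> k1 \<Longrightarrow> d (Z k \<omega>) (X \<omega>) < 1 / real (Suc m)"
      unfolding eventually_sequentially by blast
    define k where "k = max k0 k1"
    have k: "k \<ge> k0" "d (Z k \<omega>) (X \<omega>) < 1 / real (Suc m)" using k1[of k] by (auto simp: k_def)
    obtain r where "r > 1 / real (Suc m)" "mball (Z k \<omega>) r \<subseteq> U" using *(1)[OF k(1)] by (auto simp: V_def)
    then have "X \<omega> \<in> U" using k(2) ZM X *(2) by force
    then show "\<omega> \<in> X -` U \<inter> space \<Omega>" using * by auto
  qed
  also have "\<dots> \<in> sets \<Omega>"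
  proof -
    have "(\<Inter>k\<in>{k0..}. Z k -` V m \<inter> space \<Omega>) \<in> sets \<Omega>" for m k0
      using meas by (intro sets.countable_INT') auto
    then show ?thesis by (intro sets.countable_UN' image_subsetI) auto
  qed
  finally show "X -` U \<inter> space \<Omega> \<in> sets \<Omega>" .
qed

definition (in Metric_space) Lipschitz_real :: "('a \<Rightarrow> real) \<Rightarrow> real \<Rightarrow> bool" where
  "Lipschitz_real f L \<longleftrightarrow> (\<forall>x\<in>M. \<forall>y\<in>M. \<bar>f x - f y\<bar> \<le> L * d x y)"

lemma (in Metric_space) Lipschitz_real_continuous_map:
  assumes "Lipschitz_real f L"
  shows "continuous_map mtopology euclideanreal f"
proof -
  have "\<exists>\<delta>>0. \<forall>x'. x' \<in> M \<and> d x x' < \<delta> \<longrightarrow> dist (f x) (f x') < \<epsilon>" if "x \<in> M" "\<epsilon> > 0" for x \<epsilon>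
  proof -
    have "dist (f x) (f x') < \<epsilon>" if "x' \<in> M" "d x x' < \<epsilon> / (\<bar>L\<bar> + 1)" for x'
    proof -
      have "\<bar>f x - f x'\<bar> \<le> L * d x x'" using assms \<open>x \<in> M\<close> that by (auto simp: Lipschitz_real_def)
      also have "\<dots> \<le> (\<bar>L\<bar> + 1) * d x x'" by (intro mult_right_mono) auto
      also have "\<dots> < \<epsilon>" using that by (simp add: field_simps)
      finally show ?thesis by (simp add: dist_real_def)
    qed
    then show ?thesis using \<open>\<epsilon> > 0\<close> by (intro exI[of _ "\<epsilon> / (\<bar>L\<bar> + 1)"]) auto
  qed
  then have "continuous_map mtopology Met_TC.mtopology f"
    by (subst metric_continuous_map) (auto simp: Met_TC.Metric_space_axioms)
  then show ?thesis by simp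
qed

text \<open>A bounded continuous \<open>f\<close> is the limit of the Lipschitz functions
  \<open>x \<mapsto> INF y. f y + k d(x, y)\<close>, which increase with \<open>k\<close>.\<close>

lemma (in Metric_space) Lipschitz_real_minorants:
  fixes f :: "'a \<Rightarrow> real"
  assumes cont: "continuous_map mtopology euclideanreal f"
    and bdd: "\<And>x. x \<in> M \<Longrightarrow> \<bar>f x\<bar> \<le> B"
  obtains F :: "nat \<Rightarrow> 'a \<Rightarrow> real" where
    "\<And>k. Lipschitz_real (F k) (real k)"
    "\<And>k x. x \<in> M \<Longrightarrow> F k x \<le> f x"
    "\<And>k x. x \<in> M \<Longrightarrow> \<bar>F k x\<bar> \<le> B"
    "\<And>x. x \<in> M \<Longrightarrow> (\<lambda>k. F k x) \<longlonglongrightarrow> f x"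
proof -
  define F where "F k x = (INF y\<in>M. f y + real k * d x y)" for k x
  have low: "- B \<le> f y + real k * d x y" if "y \<in> M" for y k x
    using bdd[OF that] nonneg[of x y] by (smt (verit) mult_nonneg_nonneg of_nat_0_le_iff)
  have bb: "bdd_below ((\<lambda>y. f y + real k * d x y) ` M)" for k x
    using low by (intro bdd_belowI2[of _ "- B"]) auto
  have le: "F k x \<le> f y + real k * d x y" if "y \<in> M" for k x y
    unfolding F_def by (rule cINF_lower[OF bb that])
  have ge: "a \<le> F k x" if "x \<in> M" "\<And>y. y \<in> M \<Longrightarrow> a \<le> f y + real k * d x y" for a k x
    unfolding F_def by (rule cINF_greatest) (use that in auto)
  have lef: "F k x \<le> f x" if "x \<in> M" for k x using le[OF that, of k x] that by simp
  have geB: "- B \<le> F k x" if "x \<in> M" for k x using ge[OF that low] .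
  have lip: "F k x - F k y \<le> real k * d x y" if "x \<in> M" "y \<in> M" for k x y
  proof -
    have "F k x - real k * d x y \<le> F k y"
    proof (rule ge[OF that(2)])
      fix z assume z: "z \<in> M"
      have "real k * d x z \<le> real k * (d x y + d y z)"
        using triangle that z by (intro mult_left_mono) auto
      then show "F k x - real k * d x y \<le> f z + real k * d y z" using le[OF z, of k x]
        by (simp add: algebra_simps)
    qed
    then show ?thesis by simp
  qed
  have lim: "(\<lambda>k. F k x) \<longlonglongrightarrow> f x" if x: "x \<in> M" for x
  proof (rule LIMSEQ_I)
    fix \<epsilon> :: real assume \<epsilon>: "\<epsilon> > 0"
    have "continuous_map mtopology Met_TC.mtopology f" using cont by simp
    then obtain \<delta> where \<delta>: "\<delta> > 0" "\<And>y. y \<in> M \<Longrightarrow> d x y < \<delta> \<Longrightarrow> dist (f x) (f y) < \<epsilon> / 2"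
      by (subst (asm) metric_continuous_map)
         (use x \<epsilon> in \<open>auto simp: Met_TC.Metric_space_axioms dest!: spec[of _ "\<epsilon> / 2"]\<close>)
    \<comment> \<open>A point at distance at least \<open>\<delta>\<close> cannot undercut
      \<open>f x\<close> once the penalty \<open>k * \<delta>\<close> exceeds \<open>2 * B\<close>,
      the largest possible oscillation of \<open>f\<close>.\<close>
    obtain k0 :: nat where k0: "real k0 > 2 * B / \<delta>" using reals_Archimedean2 by blast
    have "norm (F k x - f x) < \<epsilon>" if "k \<ge> k0" for k
    proof -
      have "f x - \<epsilon> / 2 \<le> F k x"
      proof (rule ge[OF x])
        fix y assume y: "y \<in> M"
        show "f x - \<epsilon> / 2 \<le> f y + real k * d x y"
        proof (cases "d x y < \<delta>")
          case True
          then show ?thesis using \<delta>(2)[OF y True] nonneg[of x y]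
            by (smt (verit) dist_real_def field_sum_of_halves mult_nonneg_nonneg of_nat_0_le_iff)
        next
          case False
          have "2 * B \<le> real k0 * \<delta>" using k0 \<delta>(1) by (simp add: field_simps)
          also have "\<dots> \<le> real k * d x y" using False that \<delta>(1) by (intro mult_mono) auto
          finally show ?thesis using bdd[OF x] bdd[OF y] \<epsilon> by linarith
        qed
      qed
      then show ?thesis using lef[OF x, of k] \<epsilon> by simp
    qed
    then show "\<exists>k0. \<forall>k\<ge>k0. norm (F k x - f x) < \<epsilon>" by blast
  qed
  show thesis
  proof (rule that[of F])
    show "Lipschitz_real (F k) (real k)" for k
      unfolding Lipschitz_real_def
    proof (intro ballI)
      fix x y assume "x \<in> M" "y \<in> M"
      then show "\<bar>F k x - F k y\<bar> \<le> real k * d x y"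
        using lip[of x y k] lip[of y x k] commute[of x y] by (simp add: abs_le_iff)
    qed
    show "\<bar>F k x\<bar> \<le> B" if "x \<in> M" for k x
      using lef[OF that, of k] geB[OF that, of k] bdd[OF that] by linarith
  qed (use lef lim in auto)
qed

text \<open>Lipschitz minorants increasing to \<open>f\<close> bound the integrals of
  \<open>f\<close> from below in the limit; the same for \<open>- f\<close> bounds them from
  above.\<close>

lemma (in Metric_space) converges_in_distribution_Lipschitz:
  fixes X :: "nat \<Rightarrow> 'b \<Rightarrow> 'a" and Y :: "'c \<Rightarrow> 'a"
  assumes P: "\<And>n. prob_space (P n)" and Q: "prob_space Q"
    and X: "\<And>n. X n \<in> P n \<rightarrow>\<^sub>M borel_algebra mtopology"
    and Y: "Y \<in> Q \<rightarrow>\<^sub>M borel_algebra mtopology"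
    and conv: "\<And>f L B. 0 \<le> L \<Longrightarrow> Lipschitz_real f L \<Longrightarrow> (\<And>x. x \<in> M \<Longrightarrow> \<bar>f x\<bar> \<le> B) \<Longrightarrow>
        (\<lambda>n. \<integral>\<omega>. f (X n \<omega>) \<partial>P n) \<longlonglongrightarrow> (\<integral>\<omega>. f (Y \<omega>) \<partial>Q)"
  shows "converges_in_distribution mtopology P X Q Y"
proof -
  have XM: "X n \<omega> \<in> M" if "\<omega> \<in> space (P n)" for n \<omega>
    using measurable_space[OF X that] by (simp add: space_borel_algebra)
  have YM: "Y \<omega> \<in> M" if "\<omega> \<in> space Q" for \<omega>
    using measurable_space[OF Y that] by (simp add: space_borel_algebra)
  have lower: "eventually (\<lambda>n. (\<integral>\<omega>. f (Y \<omega>) \<partial>Q) - \<epsilon> < (\<integral>\<omega>. f (X n \<omega>) \<partial>P n)) sequentially"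
    if cont: "continuous_map mtopology euclideanreal f"
      and bdd: "\<And>x. x \<in> M \<Longrightarrow> \<bar>f x\<bar> \<le> B" and \<epsilon>: "\<epsilon> > 0" for f B \<epsilon>
  proof -
    obtain F :: "nat \<Rightarrow> 'a \<Rightarrow> real" where F:
      "\<And>k. Lipschitz_real (F k) (real k)"
      "\<And>k x. x \<in> M \<Longrightarrow> F k x \<le> f x"
      "\<And>k x. x \<in> M \<Longrightarrow> \<bar>F k x\<bar> \<le> B"
      "\<And>x. x \<in> M \<Longrightarrow> (\<lambda>k. F k x) \<longlonglongrightarrow> f x"
      using Lipschitz_real_minorants[OF cont bdd] by blast
    have mF: "F k \<in> borel_measurable (borel_algebra mtopology)" for k
      using F(1) by (intro continuous_map_borel_measurable Lipschitz_real_continuous_map)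
    have mf: "f \<in> borel_measurable (borel_algebra mtopology)"
      by (rule continuous_map_borel_measurable[OF cont])
    interpret Q: prob_space Q by (rule Q)
    have "(\<lambda>k. \<integral>\<omega>. F k (Y \<omega>) \<partial>Q) \<longlonglongrightarrow> (\<integral>\<omega>. f (Y \<omega>) \<partial>Q)"
    proof (rule integral_dominated_convergence[where w = "\<lambda>_. B"])
      show "(\<lambda>\<omega>. f (Y \<omega>)) \<in> borel_measurable Q" "\<And>k. (\<lambda>\<omega>. F k (Y \<omega>)) \<in> borel_measurable Q"
        using measurable_compose[OF Y mf] measurable_compose[OF Y mF] by auto
    qed (use F YM in auto)
    from order_tendstoD(1)[OF this, of "(\<integral>\<omega>. f (Y \<omega>) \<partial>Q) - \<epsilon>"] \<epsilon>
    have "eventually (\<lambda>k. (\<integral>\<omega>. f (Y \<omega>) \<partial>Q) - \<epsilon> < (\<integral>\<omega>. F k (Y \<omega>) \<partial>Q)) sequentially" by simp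
    then obtain k where k: "(\<integral>\<omega>. f (Y \<omega>) \<partial>Q) - \<epsilon> < (\<integral>\<omega>. F k (Y \<omega>) \<partial>Q)"
      by (auto dest: eventually_happens)
    have "(\<lambda>n. \<integral>\<omega>. F k (X n \<omega>) \<partial>P n) \<longlonglongrightarrow> (\<integral>\<omega>. F k (Y \<omega>) \<partial>Q)"
      by (rule conv[OF _ F(1) F(3)]) auto
    from order_tendstoD(1)[OF this k] show ?thesis
    proof eventually_elim
      case (elim n)
      interpret Pn: prob_space "P n" by (rule P)
      have "(\<integral>\<omega>. F k (X n \<omega>) \<partial>P n) \<le> (\<integral>\<omega>. f (X n \<omega>) \<partial>P n)"
      proof (rule integral_mono)
        show "integrable (P n) (\<lambda>\<omega>. F k (X n \<omega>))"
          using F(3) XM measurable_compose[OF X mF]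
          by (intro Pn.integrable_const_bound[where B = B]) auto
        show "integrable (P n) (\<lambda>\<omega>. f (X n \<omega>))"
          using bdd XM measurable_compose[OF X mf]
          by (intro Pn.integrable_const_bound[where B = B]) auto
      qed (use F XM in auto)
      with elim show ?case by linarith
    qed
  qed
  have "(\<lambda>n. \<integral>\<omega>. f (X n \<omega>) \<partial>P n) \<longlonglongrightarrow> (\<integral>\<omega>. f (Y \<omega>) \<partial>Q)"
    if cont: "continuous_map mtopology euclideanreal f" and bdd: "bounded (f ` M)" for f
  proof (rule order_tendstoI)
    obtain B where B: "\<And>x. x \<in> M \<Longrightarrow> \<bar>f x\<bar> \<le> B"
      using bdd unfolding bounded_iff by auto
    fix a
    show "eventually (\<lambda>n. a < (\<integral>\<omega>. f (X n \<omega>) \<partial>P n)) sequentially" if "a < (\<integral>\<omega>. f (Y \<omega>) \<partial>Q)"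
      using lower[OF cont B, of "(\<integral>\<omega>. f (Y \<omega>) \<partial>Q) - a"] that by simp
    show "eventually (\<lambda>n. a > (\<integral>\<omega>. f (X n \<omega>) \<partial>P n)) sequentially" if "a > (\<integral>\<omega>. f (Y \<omega>) \<partial>Q)"
    proof -
      have "continuous_map mtopology euclideanreal (\<lambda>x. - f x)"
        using cont by (rule continuous_map_minus)
      from lower[OF this, of B "a - (\<integral>\<omega>. f (Y \<omega>) \<partial>Q)"] show ?thesis using that B by simp
    qed
  qed
  then show ?thesis
    unfolding converges_in_distribution_def using P Q X Y by auto
qed

section \<open>Random elements of the Skorokhod space\<close>

text \<open>The identity time change is the witness. The slack \<open>e\<close> is there because the
  metric is an infimum over positive radii.\<close>

lemma skorokhod_dist_le_sup:
  assumes "x \<in> cadlag c" "y \<in> cadlag c" "0 \<le> \<epsilon>"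
    and "\<And>t. t \<in> {0..c} \<Longrightarrow> \<bar>x t - y t\<bar> \<le> \<epsilon>"
  shows "skorokhod_dist c x y \<le> \<epsilon>"
proof (rule field_le_epsilon)
  fix e :: real assume "0 < e"
  have "skorokhod_close c x y (\<epsilon> + e)"
    unfolding skorokhod_close_def
    by (rule bexI[OF _ id_time_change]) (use assms(3,4) \<open>0 < e\<close> in \<open>auto intro!: order_trans[OF assms(4)]\<close>)
  then show "skorokhod_dist c x y \<le> \<epsilon> + e"
    using assms \<open>0 < e\<close> by (intro skorokhod_dist_le) auto
qed

text \<open>Near a point \<open>t\<close> the one-sided limits allow the choice \<open>{t}\<close>,
  gluing two intervals adds their common endpoint, and bisection passes from local to global. The
  interval \<open>{u<..v}\<close> excludes its left end because, by right continuity, a partition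
  point belongs to the piece on its right.\<close>

lemma cadlag_partition:
  assumes "x \<in> cadlag c" "0 \<le> c" "0 < \<epsilon>"
  shows "\<exists>S. finite S \<and> (\<forall>u v. 0 \<le> u \<and> u \<le> v \<and> v \<le> c \<and> S \<inter> {u<..v} = {} \<longrightarrow> \<bar>x u - x v\<bar> \<le> \<epsilon>)"
proof -
  define P where "P a b \<longleftrightarrow> (\<exists>S. finite S \<and> (\<forall>u v. a \<le> u \<and> v \<le> b \<and> 0 \<le> u \<and> u \<le> v \<and> v \<le> c \<and>
    S \<inter> {u<..v} = {} \<longrightarrow> \<bar>x u - x v\<bar> \<le> \<epsilon>))" for a b
  have trans: "P a b'" if "P a b" "P b b'" for a b b'
  proof -
    obtain S1 where S1: "finite S1" "\<And>u v. a \<le> u \<Longrightarrow> v \<le> b \<Longrightarrow> 0 \<le> u \<Longrightarrow> u \<le> v \<Longrightarrow> v \<le> c \<Longrightarrow>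
      S1 \<inter> {u<..v} = {} \<Longrightarrow> \<bar>x u - x v\<bar> \<le> \<epsilon>"
      using \<open>P a b\<close> unfolding P_def by blast
    obtain S2 where S2: "finite S2" "\<And>u v. b \<le> u \<Longrightarrow> v \<le> b' \<Longrightarrow> 0 \<le> u \<Longrightarrow> u \<le> v \<Longrightarrow> v \<le> c \<Longrightarrow>
      S2 \<inter> {u<..v} = {} \<Longrightarrow> \<bar>x u - x v\<bar> \<le> \<epsilon>"
      using \<open>P b b'\<close> unfolding P_def by blast
    have "\<bar>x u - x v\<bar> \<le> \<epsilon>" if "a \<le> u" "v \<le> b'" "0 \<le> u" "u \<le> v" "v \<le> c"
      "insert b (S1 \<union> S2) \<inter> {u<..v} = {}" for u v
    proof -
      have "b \<notin> {u<..v}" using that(6) by blast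
      then consider "v \<le> b" | "b \<le> u" by fastforce
      then show ?thesis using S1(2)[of u v] S2(2)[of u v] that by cases blast+
    qed
    then show ?thesis unfolding P_def using S1(1) S2(1)
      by (intro exI[of _ "insert b (S1 \<union> S2)"]) auto
  qed
  have local: "\<exists>d>0. \<forall>a b. a \<le> t \<and> t \<le> b \<and> b - a < d \<longrightarrow> P a b" if t: "0 \<le> t" "t \<le> c" for t
  proof -
    have "\<exists>d>0. \<forall>s. t < s \<longrightarrow> s < t + d \<longrightarrow> s \<le> c \<longrightarrow> \<bar>x s - x t\<bar> < \<epsilon> / 2"
    proof (cases "t < c")
      case True
      then have "(x \<longlongrightarrow> x t) (at_right t)" using assms t by (auto simp: cadlag_def)
      then have "eventually (\<lambda>s. dist (x s) (x t) < \<epsilon> / 2) (at_right t)"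
        by (rule tendstoD) (use assms in simp)
      then obtain b where b: "b > t" "\<And>s. t < s \<Longrightarrow> s < b \<Longrightarrow> \<bar>x s - x t\<bar> < \<epsilon> / 2"
        by (auto simp: eventually_at_right_field dist_real_def)
      then show ?thesis by (intro exI[of _ "b - t"]) auto
    next
      case False
      then show ?thesis using t by (intro exI[of _ 1]) auto
    qed
    then obtain d1 where d1: "d1 > 0"
      "\<And>s. t < s \<Longrightarrow> s < t + d1 \<Longrightarrow> s \<le> c \<Longrightarrow> \<bar>x s - x t\<bar> < \<epsilon> / 2" by blast
    have "\<exists>d>0. \<exists>l. \<forall>s. s < t \<longrightarrow> t - d < s \<longrightarrow> 0 \<le> s \<longrightarrow> \<bar>x s - l\<bar> < \<epsilon> / 2"
    proof (cases "0 < t")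
      case True
      then have "t \<in> {0<..c}" using t by simp
      then obtain l where "(x \<longlongrightarrow> l) (at_left t)" using assms unfolding cadlag_def by blast
      then have "eventually (\<lambda>s. dist (x s) l < \<epsilon> / 2) (at_left t)"
        by (rule tendstoD) (use assms in simp)
      then obtain b where b: "b < t" "\<And>s. b < s \<Longrightarrow> s < t \<Longrightarrow> \<bar>x s - l\<bar> < \<epsilon> / 2"
        by (auto simp: eventually_at_left_field dist_real_def)
      then show ?thesis by (intro exI[of _ "t - b"] conjI exI[of _ l]) auto
    next
      case False
      then show ?thesis using t by (intro exI[of _ 1]) auto
    qed
    then obtain d2 l where d2: "d2 > 0"
      "\<And>s. s < t \<Longrightarrow> t - d2 < s \<Longrightarrow> 0 \<le> s \<Longrightarrow> \<bar>x s - l\<bar> < \<epsilon> / 2" by blast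
    have "P a b" if ab: "a \<le> t" "t \<le> b" "b - a < min d1 d2" for a b
    proof -
      have "\<bar>x u - x v\<bar> \<le> \<epsilon>" if uv: "a \<le> u" "v \<le> b" "0 \<le> u" "u \<le> v" "v \<le> c" "{t} \<inter> {u<..v} = {}" for u v
      proof -
        have "t \<notin> {u<..v}" using uv(6) by blast
        then consider "v < t" | "t \<le> u" by fastforce
        then show ?thesis
        proof cases
          case 1
          then have "\<bar>x u - l\<bar> < \<epsilon> / 2" "\<bar>x v - l\<bar> < \<epsilon> / 2"
            using uv ab d2(2)[of u] d2(2)[of v] by linarith+
          then show ?thesis by linarith
        next
          case 2
          have *: "\<bar>x s - x t\<bar> < \<epsilon> / 2" if "u \<le> s" "s \<le> v" for s
          proof (cases "s = t")
            case False
            show ?thesis by (rule d1(2)) (use 2 uv ab that False in linarith)+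
          qed (use assms(3) in simp)
          have "\<bar>x u - x t\<bar> < \<epsilon> / 2" "\<bar>x v - x t\<bar> < \<epsilon> / 2" using * uv by auto
          then show ?thesis by linarith
        qed
      qed
      then show ?thesis unfolding P_def by (intro exI[of _ "{t}"]) auto
    qed
    then show ?thesis using d1(1) d2(1) by (intro exI[of _ "min d1 d2"]) auto
  qed
  have "P 0 c"
    by (rule Bolzano[of 0 c P]) (use assms(2) trans local in blast)+
  then obtain S where "finite S" "\<And>u v. 0 \<le> u \<Longrightarrow> v \<le> c \<Longrightarrow> u \<le> v \<Longrightarrow>
      S \<inter> {u<..v} = {} \<Longrightarrow> \<bar>x u - x v\<bar> \<le> \<epsilon>" unfolding P_def by blast
  then show ?thesis by (intro exI[of _ S]) auto
qed

section \<open>Time changes moving finitely many points\<close>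

lemma finite_real_gap:
  fixes S :: "real set"
  assumes "finite S"
  shows "\<exists>r>0. \<forall>s\<in>S. \<forall>s'\<in>S. s \<noteq> s' \<longrightarrow> r \<le> \<bar>s - s'\<bar>"
proof -
  let ?G = "insert 1 ((\<lambda>(s, s'). \<bar>s - s'\<bar>) ` {(s, s') \<in> S \<times> S. s \<noteq> s'})"
  have "finite {(s, s') \<in> S \<times> S. s \<noteq> s'}"
    by (rule finite_subset[of _ "S \<times> S"]) (use assms in auto)
  then have fin: "finite ?G" by blast
  have "0 < Min ?G" by (subst Min_gr_iff[OF fin]) auto
  moreover have "Min ?G \<le> \<bar>s - s'\<bar>" if "s \<in> S" "s' \<in> S" "s \<noteq> s'" for s s'
    by (rule Min_le[OF fin]) (use that in auto)
  ultimately show ?thesis by blast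
qed

text \<open>\<open>\<theta>\<close> is the identity plus tents of radius \<open>r\<close> around the
  points of \<open>S\<close>, of height \<open>p s - s\<close>. The spacing makes each tent vanish
  at the other points of \<open>S\<close> and at both ends. The tents have slope at most
  \<open>\<delta> / r\<close>, so their sum has slope below one and \<open>\<theta>\<close> stays
  strictly increasing.\<close>

lemma time_change_perturbation:
  fixes p :: "real \<Rightarrow> real"
  assumes "finite S" "0 < r" "0 \<le> c"
    and "\<And>s. s \<in> S \<Longrightarrow> r \<le> s \<and> r \<le> c - s"
    and "\<And>s s'. s \<in> S \<Longrightarrow> s' \<in> S \<Longrightarrow> s \<noteq> s' \<Longrightarrow> r \<le> \<bar>s - s'\<bar>"
    and "\<And>s. s \<in> S \<Longrightarrow> \<bar>p s - s\<bar> \<le> \<delta>" "0 \<le> \<delta>" "real (card S) * \<delta> < r"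
  obtains \<theta> where "\<theta> \<in> time_changes c" "\<And>s. s \<in> S \<Longrightarrow> \<theta> s = p s" "\<theta> 0 = 0" "\<theta> c = c"
    "\<And>t. \<bar>\<theta> t - t\<bar> \<le> real (card S) * \<delta>"
proof -
  define b where "b s t = max 0 (1 - \<bar>t - s\<bar> / r)" for s t
  define \<theta> where "\<theta> t = t + (\<Sum>s\<in>S. (p s - s) * b s t)" for t
  have b01: "0 \<le> b s t" "b s t \<le> 1" for s t using \<open>0 < r\<close> by (auto simp: b_def)
  have b0: "b s t = 0" if "r \<le> \<bar>t - s\<bar>" for s t using that \<open>0 < r\<close> by (auto simp: b_def)
  have blip: "\<bar>b s t - b s u\<bar> \<le> \<bar>t - u\<bar> / r" for s t u
  proof -
    have "\<bar>b s t - b s u\<bar> \<le> \<bar>\<bar>t - s\<bar> / r - \<bar>u - s\<bar> / r\<bar>" unfolding b_def by linarith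
    also have "\<dots> = \<bar>\<bar>t - s\<bar> - \<bar>u - s\<bar>\<bar> / r" using \<open>0 < r\<close>
      by (simp add: diff_divide_distrib[symmetric] abs_divide)
    also have "\<dots> \<le> \<bar>t - u\<bar> / r" using \<open>0 < r\<close> by (intro divide_right_mono) auto
    finally show ?thesis .
  qed
  have sum_le: "\<bar>\<Sum>s\<in>S. (p s - s) * w s\<bar> \<le> real (card S) * \<delta> * W" if "\<And>s. \<bar>w s\<bar> \<le> W" for w W
  proof -
    have "\<bar>\<Sum>s\<in>S. (p s - s) * w s\<bar> \<le> (\<Sum>s\<in>S. \<delta> * W)"
      by (intro order_trans[OF sum_abs] sum_mono)
         (use assms that in \<open>auto simp: abs_mult intro!: mult_mono\<close>)
    then show ?thesis by simp
  qed
  have zero: "\<theta> t = t" if "\<And>s. s \<in> S \<Longrightarrow> r \<le> \<bar>t - s\<bar>" for t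
    using that by (simp add: \<theta>_def b0)
  have end0: "\<theta> 0 = 0" "\<theta> c = c" by (rule zero; use assms(4) in fastforce)+
  have mono: "\<theta> t < \<theta> u" if "t < u" for t u
  proof -
    have "\<bar>\<Sum>s\<in>S. (p s - s) * (b s t - b s u)\<bar> \<le> real (card S) * \<delta> * (\<bar>t - u\<bar> / r)"
      by (rule sum_le) (rule blip)
    also have "\<dots> = real (card S) * \<delta> / r * (u - t)" using that by simp
    also have "\<dots> < 1 * (u - t)" using that assms(2,8) by (intro mult_strict_right_mono) auto
    finally show ?thesis
      unfolding \<theta>_def by (simp add: right_diff_distrib sum_subtractf)
  qed
  have cont: "continuous_on A \<theta>" for A
    unfolding \<theta>_def b_def by (intro continuous_intros) (use \<open>0 < r\<close> in auto)
  have "\<theta> ` {0..c} = {0..c}"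
  proof
    show "\<theta> ` {0..c} \<subseteq> {0..c}"
    proof
      fix y assume "y \<in> \<theta> ` {0..c}"
      then obtain t where t: "y = \<theta> t" "0 \<le> t" "t \<le> c" by auto
      have "\<theta> 0 \<le> \<theta> t" "\<theta> t \<le> \<theta> c"
        using mono[of 0 t] mono[of t c] t by (cases "t = 0"; cases "t = c"; force)+
      then show "y \<in> {0..c}" using end0 t by simp
    qed
    show "{0..c} \<subseteq> \<theta> ` {0..c}"
    proof
      fix y assume "y \<in> {0..c}"
      then show "y \<in> \<theta> ` {0..c}"
        using IVT'[of \<theta> 0 y c] end0 cont[of "{0..c}"] assms(3) by (auto simp: image_iff)
    qed
  qed
  then have tc: "\<theta> \<in> time_changes c" using mono by (auto simp: time_changes_def strict_mono_on_def)
  have ps: "\<theta> s = p s" if "s \<in> S" for s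
  proof -
    have "(\<Sum>s'\<in>S. (p s' - s') * b s' s) = (\<Sum>s'\<in>S. if s' = s then p s - s else 0)"
      by (rule sum.cong) (use assms(5) that b0 in \<open>auto simp: b_def\<close>)
    then show ?thesis using that assms(1) by (simp add: \<theta>_def)
  qed
  have "\<bar>\<theta> t - t\<bar> \<le> real (card S) * \<delta>" for t
    using sum_le[of "\<lambda>s. b s t" 1] b01 by (simp add: \<theta>_def)
  with tc ps end0 show thesis by (rule that)
qed

text \<open>Index of the cell of the grid \<open>c * i / k\<close> that contains \<open>t\<close>; the last cell is \<open>{c}\<close>.\<close>

definition grid_index :: "real \<Rightarrow> nat \<Rightarrow> real \<Rightarrow> nat" where
  "grid_index c k t = nat \<lfloor>real k * t / c\<rfloor>"

lemma grid_index_le: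
  assumes "0 \<le> t" "t \<le> c"
  shows "grid_index c k t \<le> k"
proof -
  have "real k * t / c \<le> real k"
    using assms by (cases "c = 0") (auto simp: divide_le_eq intro: mult_left_mono)
  then show ?thesis unfolding grid_index_def by linarith
qed

text \<open>For \<open>c = 0\<close> the only time is \<open>0\<close> and division by zero gives
  index \<open>0\<close>, so the degenerate interval obeys the same bounds.\<close>

lemma grid_index_bounds:
  assumes "0 \<le> t" "t \<le> c" "0 < k"
  shows "c * real (grid_index c k t) / real k \<le> t" "t \<le> c * real (Suc (grid_index c k t)) / real k"
    "0 \<le> c * real (grid_index c k t) / real k"
proof -
  let ?i = "grid_index c k t"
  have nn: "0 \<le> real k * t / c" using assms by simp
  have i: "real ?i \<le> real k * t / c" "real k * t / c < real ?i + 1"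
    using nn by (auto simp: grid_index_def)
  show "0 \<le> c * real ?i / real k" using assms by simp
  show "c * real ?i / real k \<le> t"
  proof (cases "c = 0")
    case False
    then show ?thesis using i assms by (simp add: field_simps)
  qed (use assms in auto)
  show "t \<le> c * real (Suc ?i) / real k"
  proof (cases "c = 0")
    case False
    then show ?thesis using i assms by (simp add: field_simps)
  qed (use assms in auto)
qed

lemma step_function_cadlag:
  assumes "0 \<le> c"
  shows "(\<lambda>t\<in>{0..c}. F (grid_index c k t)) \<in> cadlag c"
proof -
  let ?x = "\<lambda>t\<in>{0..c}. F (grid_index c k t)"
  define a where "a = real k / c"
  have a: "0 \<le> a" using assms by (simp add: a_def)
  have idx: "grid_index c k t = nat \<lfloor>a * t\<rfloor>" for t by (simp add: grid_index_def a_def)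
  have "(?x \<longlongrightarrow> ?x t) (at_right t)" if t: "t \<in> {0..<c}" for t
  proof -
    \<comment> \<open>The floor jumps next when \<open>a * s\<close> has gained the bracketed
      amount. Dividing by \<open>a + 1\<close> instead of \<open>a\<close> gives a smaller but
      positive width even if \<open>a = 0\<close>.\<close>
    define b where "b = min c (t + (real_of_int \<lfloor>a * t\<rfloor> + 1 - a * t) / (a + 1))"
    have b: "t < b" using t a by (auto simp: b_def intro!: divide_pos_pos add_pos_pos)
    have "\<lfloor>a * s\<rfloor> = \<lfloor>a * t\<rfloor>" if "t < s" "s < b" for s
    proof -
      have "s - t < (real_of_int \<lfloor>a * t\<rfloor> + 1 - a * t) / (a + 1)" using that by (simp add: b_def)
      then have "(a + 1) * (s - t) < real_of_int \<lfloor>a * t\<rfloor> + 1 - a * t"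
        using a by (simp add: field_simps)
      moreover have "a * (s - t) \<le> (a + 1) * (s - t)" using that a by (intro mult_right_mono) auto
      moreover have "a * t \<le> a * s" using that a by (intro mult_left_mono) auto
      moreover have "a * (s - t) = a * s - a * t" by (simp add: algebra_simps)
      ultimately show ?thesis by linarith
    qed
    then have "?x s = ?x t" if "t < s" "s < b" for s
      using that t by (auto simp: idx b_def)
    then have "eventually (\<lambda>s. ?x s = ?x t) (at_right t)"
      unfolding eventually_at_right_field using b by blast
    then show ?thesis by (rule tendsto_eventually)
  qed
  moreover have "\<exists>l. (?x \<longlongrightarrow> l) (at_left t)" if t: "t \<in> {0<..c}" for t
  proof -
    \<comment> \<open>The value of the floor just before \<open>t\<close>: if \<open>a * t\<close>
      is an integer, it is one less than the value at \<open>t\<close>, hence the ceiling minus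
      one.\<close>
    define m where "m = (if a = 0 then 0 else \<lceil>a * t\<rceil> - 1)"
    define b where "b = (if a = 0 then 0 else max 0 (t - (a * t - m) / (a + 1)))"
    have b: "b < t"
    proof (cases "a = 0")
      case False
      have "0 < (a * t - m) / (a + 1)" using False a by (intro divide_pos_pos) (simp_all add: m_def, linarith)
      then show ?thesis using t False by (simp add: b_def)
    qed (use t in \<open>simp add: b_def\<close>)
    have "\<lfloor>a * s\<rfloor> = m" if s: "b < s" "s < t" for s
    proof (cases "a = 0")
      case False
      have "t - s < (a * t - m) / (a + 1)" using s False by (simp add: b_def)
      then have "(a + 1) * (t - s) < a * t - m"
        using a by (simp add: field_simps)
      moreover have "a * (t - s) \<le> (a + 1) * (t - s)" using s a by (intro mult_right_mono) auto
      moreover have "a * s < a * t" using s a False by (intro mult_strict_left_mono) auto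
      moreover have "a * (t - s) = a * t - a * s" by (simp add: algebra_simps)
      ultimately show ?thesis using False unfolding m_def if_not_P[OF False] by linarith
    qed (simp add: m_def)
    then have "?x s = F (nat m)" if "max 0 b < s" "s < t" for s
      using that t by (auto simp: idx)
    moreover have "max 0 b < t" using b t by simp
    ultimately have "eventually (\<lambda>s. ?x s = F (nat m)) (at_left t)"
      unfolding eventually_at_left_field by blast
    then show ?thesis using tendsto_eventually by blast
  qed
  ultimately show ?thesis by (auto simp: cadlag_def)
qed

text \<open>Sampling on a grid and rounding to multiples of \<open>2^-k\<close> leaves only
  countably many possible paths, each coded by a list of integers, so measurability reduces to that
  of finitely many coordinates. \<open>Suc k\<close> cells avoid an empty grid.\<close>

definition discretize :: "real \<Rightarrow> nat \<Rightarrow> (real \<Rightarrow> real) \<Rightarrow> real \<Rightarrow> real" where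
  "discretize c k x =
     (\<lambda>t\<in>{0..c}. of_int \<lfloor>2 ^ k * x (c * real (grid_index c (Suc k) t) / real (Suc k))\<rfloor> / 2 ^ k)"

lemma discretize_cadlag: "0 \<le> c \<Longrightarrow> discretize c k x \<in> cadlag c"
  unfolding discretize_def
  by (rule step_function_cadlag[where F = "\<lambda>i. of_int \<lfloor>2 ^ k * x (c * real i / real (Suc k))\<rfloor> / 2 ^ k"])

text \<open>A time change moving each point of an \<open>\<epsilon>\<close>-partition of \<open>x\<close> up to the grid makes \<open>t\<close> and the
  grid point below \<open>\<theta> t\<close> lie in the same interval of the partition.\<close>

lemma discretize_tendsto:
  assumes x: "x \<in> cadlag c" and c: "0 \<le> c"
  shows "(\<lambda>k. skorokhod_dist c (discretize c k x) x) \<longlonglongrightarrow> 0"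
proof (rule LIMSEQ_I)
  interpret S: Metric_space "cadlag c" "skorokhod_dist c" by (rule Metric_space_skorokhod[OF c])
  fix \<epsilon> :: real assume \<epsilon>: "\<epsilon> > 0"
  obtain S0 where S0: "finite S0"
    "\<And>u v. 0 \<le> u \<Longrightarrow> u \<le> v \<Longrightarrow> v \<le> c \<Longrightarrow> S0 \<inter> {u<..v} = {} \<Longrightarrow> \<bar>x u - x v\<bar> \<le> \<epsilon> / 4"
    using cadlag_partition[OF x c, of "\<epsilon> / 4"] \<epsilon> by auto
  \<comment> \<open>Only interior points are moved: \<open>0\<close> and \<open>c\<close> are grid
    points already and must stay fixed. Including them in the gap \<open>r\<close> keeps the tents
    away from both ends.\<close>
  define S where "S = S0 \<inter> {0<..<c}"
  have fS: "finite S" using S0 by (simp add: S_def)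
  obtain r where r: "r > 0" "\<And>s s'. s \<in> insert 0 (insert c S) \<Longrightarrow> s' \<in> insert 0 (insert c S) \<Longrightarrow> s \<noteq> s' \<Longrightarrow> r \<le> \<bar>s - s'\<bar>"
    using finite_real_gap[of "insert 0 (insert c S)"] fS by blast
  have l1: "(\<lambda>k. real (card S) * (c / real (Suc k))) \<longlonglongrightarrow> real (card S) * 0"
    by (intro tendsto_mult tendsto_const LIMSEQ_Suc lim_const_over_n)
  have l2: "(\<lambda>k. (1 / 2) ^ k) \<longlonglongrightarrow> (0::real)" by (rule LIMSEQ_realpow_zero) auto
  have "eventually (\<lambda>k. real (card S) * (c / real (Suc k)) < min r (\<epsilon> / 2)) sequentially"
    by (rule order_tendstoD(2)[OF l1]) (use r \<epsilon> in simp)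
  moreover have "eventually (\<lambda>k. (1 / 2) ^ k < \<epsilon> / 4) sequentially"
    by (rule order_tendstoD(2)[OF l2]) (use \<epsilon> in simp)
  ultimately have "eventually (\<lambda>k. norm (skorokhod_dist c (discretize c k x) x - 0) < \<epsilon>) sequentially"
  proof eventually_elim
    case (elim k)
    define K where "K = real (Suc k)"
    have K: "K > 0" by (simp add: K_def)
    \<comment> \<open>The first grid point not before \<open>s\<close>, at distance at most one
      cell.\<close>
    define p where "p s = c * of_int \<lceil>K * s / c\<rceil> / K" for s
    have pS: "\<bar>p s - s\<bar> \<le> c / K" if "s \<in> S" for s
    proof -
      have c: "c > 0" using that by (auto simp: S_def)
      have "p s - s = c / K * (of_int \<lceil>K * s / c\<rceil> - K * s / c)"
        using c K by (simp add: p_def field_simps)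
      moreover have "\<bar>of_int \<lceil>K * s / c\<rceil> - K * s / c\<bar> \<le> 1" by linarith
      ultimately show ?thesis
        using c K mult_left_mono[of "\<bar>of_int \<lceil>K * s / c\<rceil> - K * s / c\<bar>" 1 "c / K"]
        by (simp add: abs_mult)
    qed
    obtain \<theta> where \<theta>: "\<theta> \<in> time_changes c" "\<And>s. s \<in> S \<Longrightarrow> \<theta> s = p s" "\<theta> 0 = 0" "\<theta> c = c"
      "\<And>t. \<bar>\<theta> t - t\<bar> \<le> real (card S) * (c / K)"
    proof (rule time_change_perturbation[OF fS r(1) c, of p "c / K"])
      show "r \<le> s \<and> r \<le> c - s" if "s \<in> S" for s
        using r(2)[of s 0] r(2)[of c s] that by (auto simp: S_def)
      show "real (card S) * (c / K) < r" using elim by (simp add: K_def)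
    qed (use r pS c K in auto)
    have sm: "\<theta> s < \<theta> t" if "s \<in> {0..c}" "t \<in> {0..c}" "s < t" for s t
      using \<theta>(1) that by (auto simp: time_changes_def strict_mono_on_def)
    have "\<bar>x t - discretize c k x (\<theta> t)\<bar> \<le> \<epsilon> / 2" if t: "t \<in> {0..c}" for t
    proof -
      define w where "w = \<theta> t"
      have w: "w \<in> {0..c}" using \<theta>(1) t by (auto simp: time_changes_def w_def)
      define g where "g = c * real (grid_index c (Suc k) w) / K"
      have g: "0 \<le> g" "g \<le> w"
        using grid_index_bounds[of w c "Suc k"] w by (auto simp: g_def K_def)
      \<comment> \<open>A grid point such as \<open>p s\<close> lies below \<open>w\<close> iff it
        lies below the grid point \<open>g\<close> under \<open>w\<close>, and \<open>p s\<close>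
        lies below a grid point iff \<open>s\<close> does. So \<open>t\<close> and \<open>g\<close>
        have passed the same partition points.\<close>
      have key: "s \<le> t \<longleftrightarrow> s \<le> g" if s: "s \<in> S0" "0 < s" "s \<le> c" for s
      proof -
        have c: "c > 0" using s by linarith
        have "\<theta> s = p s"
        \<comment> \<open>The endpoint \<open>c\<close> may belong to \<open>S0\<close> but is not
          in \<open>S\<close>; it is fixed both by \<open>\<theta>\<close> and by rounding up to the
          grid.\<close>
        proof (cases "s = c")
          case True
          have "p c = c" using c K by (simp add: p_def K_def)
          then show ?thesis using True \<theta>(4) by simp
        qed (use s \<theta>(2) S_def in auto)
        moreover have "s \<le> t \<longleftrightarrow> \<theta> s \<le> \<theta> t"
          using sm[of s t] sm[of t s] s t by (cases s t rule: linorder_cases) auto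
        ultimately have "s \<le> t \<longleftrightarrow> p s \<le> w" by (simp add: w_def)
        also have "\<dots> \<longleftrightarrow> of_int \<lceil>K * s / c\<rceil> \<le> K * w / c"
          using c K by (simp add: p_def field_simps)
        also have "\<dots> \<longleftrightarrow> \<lceil>K * s / c\<rceil> \<le> \<lfloor>K * w / c\<rfloor>" by (simp add: le_floor_iff)
        also have "\<dots> \<longleftrightarrow> K * s / c \<le> of_int \<lfloor>K * w / c\<rfloor>" by (simp add: ceiling_le_iff)
        also have "of_int \<lfloor>K * w / c\<rfloor> = real (grid_index c (Suc k) w)"
          using w c K unfolding grid_index_def K_def[symmetric] by simp
        also have "K * s / c \<le> real (grid_index c (Suc k) w) \<longleftrightarrow> s \<le> g"
          using c K by (simp add: g_def field_simps)
        finally show ?thesis .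
      qed
      have "\<bar>x t - x g\<bar> \<le> \<epsilon> / 4"
      proof (cases "t \<le> g")
        case True
        have "S0 \<inter> {t<..g} = {}" using key t w g by fastforce
        then show ?thesis using S0(2)[of t g] True t w g by auto
      next
        case False
        have "S0 \<inter> {g<..t} = {}" using key t w g by fastforce
        then show ?thesis using S0(2)[of g t] False t w g by (auto simp: abs_minus_commute)
      qed
      moreover have "\<bar>discretize c k x w - x g\<bar> \<le> (1 / 2) ^ k"
      proof -
        have "discretize c k x w = of_int \<lfloor>2 ^ k * x g\<rfloor> / 2 ^ k"
          using w by (simp add: discretize_def g_def K_def)
        then have "2 ^ k * (discretize c k x w - x g) = of_int \<lfloor>2 ^ k * x g\<rfloor> - 2 ^ k * x g"
          by (simp add: right_diff_distrib)
        moreover have "\<bar>of_int \<lfloor>2 ^ k * x g\<rfloor> - 2 ^ k * x g\<bar> \<le> 1" by linarith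
        ultimately have "2 ^ k * \<bar>discretize c k x w - x g\<bar> \<le> 1"
          by (metis abs_mult abs_of_pos zero_less_numeral zero_less_power)
        then show ?thesis by (simp add: field_simps power_one_over)
      qed
      moreover have "(1 / 2) ^ k < \<epsilon> / 4" using elim by blast
      ultimately show ?thesis unfolding w_def by linarith
    qed
    moreover have "\<bar>\<theta> t - t\<bar> \<le> \<epsilon> / 2" for t
      using \<theta>(5)[of t] elim unfolding K_def by linarith
    ultimately have "skorokhod_close c x (discretize c k x) (\<epsilon> / 2)"
      unfolding skorokhod_close_def using \<theta>(1) by blast
    then have "skorokhod_dist c x (discretize c k x) \<le> \<epsilon> / 2"
      using x \<epsilon> discretize_cadlag[OF c] by (intro skorokhod_dist_le) auto
    then show ?case using \<epsilon> S.nonneg S.commute by (simp add: S.commute)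
  qed
  then show "\<exists>k0. \<forall>k\<ge>k0. norm (skorokhod_dist c (discretize c k x) x - 0) < \<epsilon>"
    by (simp add: eventually_sequentially)
qed

section \<open>Measurability of random paths from their coordinates\<close>

lemma measurable_map_count_space:
  fixes f :: "'i \<Rightarrow> 'a \<Rightarrow> 'b :: countable"
  assumes "\<And>i. i \<in> set xs \<Longrightarrow> f i \<in> M \<rightarrow>\<^sub>M count_space UNIV"
  shows "(\<lambda>\<omega>. map (\<lambda>i. f i \<omega>) xs) \<in> M \<rightarrow>\<^sub>M count_space UNIV"
proof -
  have "(\<lambda>\<omega>. map (\<lambda>i. f i \<omega>) xs) -` {l} \<inter> space M \<in> sets M" for l
    using assms
  proof (induction xs arbitrary: l)
    case (Cons i xs)
    show ?case
    proof (cases l)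
      case (Cons z zs)
      have "(\<lambda>\<omega>. map (\<lambda>i. f i \<omega>) (i # xs)) -` {l} \<inter> space M =
        (f i -` {z} \<inter> space M) \<inter> ((\<lambda>\<omega>. map (\<lambda>i. f i \<omega>) xs) -` {zs} \<inter> space M)"
        using Cons by auto
      moreover have "f i -` {z} \<inter> space M \<in> sets M"
        using Cons.prems by (intro measurable_sets[of _ _ "count_space UNIV"]) auto
      ultimately show ?thesis using Cons.IH Cons.prems by simp
    next
      case Nil
      have "(\<lambda>\<omega>. map (\<lambda>i. f i \<omega>) (i # xs)) -` {l} \<inter> space M = {}" using Nil by auto
      then show ?thesis by simp
    qed
  qed (auto simp: vimage_def)
  then show ?thesis by (subst measurable_count_space_eq2_countable) auto
qed

text \<open>The discretized path factors through a countable discrete space, on which every map is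
  measurable, and discretizations converge to the path in the Skorokhod metric.\<close>

theorem measurable_skorokhod:
  assumes c: "0 \<le> c"
    and X: "\<And>\<omega>. \<omega> \<in> space M \<Longrightarrow> X \<omega> \<in> cadlag c"
    and meas: "\<And>t. t \<in> {0..c} \<Longrightarrow> (\<lambda>\<omega>. X \<omega> t) \<in> borel_measurable M"
  shows "X \<in> M \<rightarrow>\<^sub>M borel_algebra (skorokhod_topology c)"
proof -
  interpret S: Metric_space "cadlag c" "skorokhod_dist c" by (rule Metric_space_skorokhod[OF c])
  have disc: "(\<lambda>\<omega>. discretize c k (X \<omega>)) \<in> M \<rightarrow>\<^sub>M borel_algebra S.mtopology" for k
  proof -
    define \<Psi> where "\<Psi> l = (\<lambda>t\<in>{0..c}. real_of_int (l ! grid_index c (Suc k) t) / 2 ^ k)" for l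
    define vals where "vals \<omega> = map (\<lambda>i. \<lfloor>2 ^ k * X \<omega> (c * real i / real (Suc k))\<rfloor>) [0..<Suc (Suc k)]" for \<omega>
    have "c * real i / real (Suc k) \<in> {0..c}" if "i \<le> Suc k" for i
    proof -
      have "c * real i \<le> c * real (Suc k)" using that c by (intro mult_left_mono) auto
      then show ?thesis using c by (simp add: divide_le_eq del: of_nat_Suc)
    qed
    then have "vals \<in> M \<rightarrow>\<^sub>M count_space UNIV"
      unfolding vals_def
      by (intro measurable_map_count_space measurable_compose[OF _ measurable_real_floor]
          borel_measurable_times meas measurable_const) auto
    moreover have "\<Psi> \<in> count_space UNIV \<rightarrow>\<^sub>M borel_algebra S.mtopology"
      using step_function_cadlag[OF c, of "\<lambda>i. real_of_int (l ! i) / 2 ^ k" "Suc k" for l]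
      by (auto simp: space_borel_algebra \<Psi>_def)
    ultimately have "(\<lambda>\<omega>. \<Psi> (vals \<omega>)) \<in> M \<rightarrow>\<^sub>M borel_algebra S.mtopology"
      by (rule measurable_compose)
    moreover have "\<Psi> (vals \<omega>) = discretize c k (X \<omega>)" for \<omega>
    proof -
      have "grid_index c (Suc k) t < Suc (Suc k)" if "t \<in> {0..c}" for t
        using grid_index_le[of t c "Suc k"] that by simp
      then show ?thesis unfolding \<Psi>_def vals_def discretize_def
        by (intro restrict_ext) (simp add: nth_append del: upt_Suc)
    qed
    ultimately show ?thesis by simp
  qed
  have "X \<in> M \<rightarrow>\<^sub>M borel_algebra S.mtopology"
    by (rule S.measurable_limit_mtopology[where Z = "\<lambda>k \<omega>. discretize c k (X \<omega>)", OF disc]) (use X discretize_tendsto c in auto)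
  then show ?thesis by (simp add: skorokhod_topology_def)
qed

section \<open>Convergence of random vectors\<close>

text \<open>An exchange of limits: \<open>m\<close> is fixed so that \<open>\<beta> m\<close> and
  \<open>e m\<close> are good, and \<open>n\<close> grows afterwards. The comparison may start at an
  index depending on \<open>m\<close>, as it must when a grid of \<open>2 ^ m\<close> cells requires
  \<open>2 ^ m \<le> n\<close>.\<close>

lemma tendsto_by_approximations:
  fixes a :: "nat \<Rightarrow> real"
  assumes b: "\<And>m. (\<lambda>n. b m n) \<longlonglongrightarrow> \<beta> m" and \<beta>: "\<beta> \<longlonglongrightarrow> \<alpha>"
    and e: "e \<longlonglongrightarrow> 0" and d: "d \<longlonglongrightarrow> 0"
    and close: "\<And>m::nat. eventually (\<lambda>n. \<bar>a n - b m n\<bar> \<le> e m + d n) sequentially"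
  shows "a \<longlonglongrightarrow> \<alpha>"
proof (rule LIMSEQ_I)
  fix \<epsilon> :: real assume \<epsilon>: "\<epsilon> > 0"
  have "eventually (\<lambda>m. \<bar>\<beta> m - \<alpha>\<bar> < \<epsilon> / 4 \<and> \<bar>e m\<bar> < \<epsilon> / 4) sequentially"
    using tendstoD[OF \<beta>, of "\<epsilon> / 4"] tendstoD[OF e, of "\<epsilon> / 4"] \<epsilon>
    by (auto simp: dist_real_def intro: eventually_conj)
  then obtain m where m: "\<bar>\<beta> m - \<alpha>\<bar> < \<epsilon> / 4" "\<bar>e m\<bar> < \<epsilon> / 4" by (auto dest: eventually_happens)
  have "eventually (\<lambda>n. \<bar>b m n - \<beta> m\<bar> < \<epsilon> / 4) sequentially"
    using tendstoD[OF b, of "\<epsilon> / 4" m] \<epsilon> by (simp add: dist_real_def)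
  moreover have "eventually (\<lambda>n. \<bar>d n\<bar> < \<epsilon> / 4) sequentially"
    using tendstoD[OF d, of "\<epsilon> / 4"] \<epsilon> by (simp add: dist_real_def)
  ultimately have "eventually (\<lambda>n. norm (a n - \<alpha>) < \<epsilon>) sequentially"
    using close[of m]
  proof eventually_elim
    case (elim n)
    then show ?case using m unfolding real_norm_def by argo
  qed
  then show "\<exists>n0. \<forall>n\<ge>n0. norm (a n - \<alpha>) < \<epsilon>" by (simp add: eventually_sequentially)
qed

section \<open>Trigonometric polynomials and truncation\<close>

lemma abs_sin_minus_le: "\<bar>sin x - x\<bar> \<le> x\<^sup>2" for x :: real
proof -
  have "cmod (iexp x - (\<Sum>k\<le>1. (\<i> * x) ^ k / fact k)) \<le> \<bar>x\<bar> ^ 2 / fact 2"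
    using iexp_approx1[of x 1] by (simp add: numeral_2_eq_2)
  moreover have "Im (iexp x - (\<Sum>k\<le>1. (\<i> * x) ^ k / fact k)) = sin x - x"
    by (simp add: Im_exp)
  ultimately have "\<bar>sin x - x\<bar> \<le> x\<^sup>2 / 2"
    using abs_Im_le_cmod[of "iexp x - (\<Sum>k\<le>1. (\<i> * x) ^ k / fact k)"] by (simp add: numeral_2_eq_2)
  then show ?thesis using zero_le_power2[of x] by linarith
qed

text \<open>The phase \<open>a\<close> covers sines and cosines at once. Expectations of such
  functions are determined by characteristic functions, and the span is closed under
  products.\<close>

inductive_set trig_polys :: "nat \<Rightarrow> ((nat \<Rightarrow> real) \<Rightarrow> real) set" for k where
  wave: "(\<lambda>x. cos (a + (\<Sum>i<k. l i * x i))) \<in> trig_polys k"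
| scale: "f \<in> trig_polys k \<Longrightarrow> (\<lambda>x. c * f x) \<in> trig_polys k"
| add: "f \<in> trig_polys k \<Longrightarrow> g \<in> trig_polys k \<Longrightarrow> (\<lambda>x. f x + g x) \<in> trig_polys k"

lemma trig_polys_const: "(\<lambda>x. c) \<in> trig_polys k"
  using trig_polys.scale[OF trig_polys.wave[where a = 0 and l = "\<lambda>_. 0" and k = k], of c] by simp

lemma trig_polys_sin:
  assumes "i < k"
  shows "(\<lambda>x. sin (a * x i)) \<in> trig_polys k"
proof -
  have "(\<Sum>j<k. (if j = i then a else 0) * x j) = a * x i" for x :: "nat \<Rightarrow> real"
  proof -
    have "(\<Sum>j<k. (if j = i then a else 0) * x j) = (\<Sum>j<k. if j = i then a * x i else 0)"
      by (rule sum.cong) auto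
    then show ?thesis using assms by simp
  qed
  then have "(\<lambda>x. cos (- pi / 2 + a * x i)) \<in> trig_polys k"
    using trig_polys.wave[where a = "- pi / 2" and k = k and l = "\<lambda>j. if j = i then a else 0"] by simp
  moreover have "cos (- pi / 2 + y) = sin y" for y :: real
    using cos_minus[of "y - pi / 2"] by (simp add: sin_cos_eq)
  ultimately show ?thesis by simp
qed

text \<open>The product-to-sum formula turns a product of two waves into a combination of two waves;
  the other cases follow by bilinearity. This provides the ring that Stone-Weierstrass asks
  for.\<close>

lemma trig_polys_mult:
  assumes "f \<in> trig_polys k" "g \<in> trig_polys k"
  shows "(\<lambda>x. f x * g x) \<in> trig_polys k"
  using assms(1)
proof induction
  case (wave a l)
  show ?case using assms(2)
  proof induction
    case (wave b m)
    have "(\<lambda>x. (1 / 2) * (cos ((a - b) + (\<Sum>i<k. (l i - m i) * x i)) + cos ((a + b) + (\<Sum>i<k. (l i + m i) * x i))))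
      \<in> trig_polys k"
      by (intro trig_polys.intros)
    moreover have "(1 / 2) * (cos ((a - b) + (\<Sum>i<k. (l i - m i) * x i)) + cos ((a + b) + (\<Sum>i<k. (l i + m i) * x i)))
      = cos (a + (\<Sum>i<k. l i * x i)) * cos (b + (\<Sum>i<k. m i * x i))" for x
      unfolding cos_times_cos by (simp add: algebra_simps sum.distrib sum_subtractf)
    ultimately show ?case by simp
  next
    case (scale g c)
    then show ?case using trig_polys.scale[OF scale.IH, of c] by (simp add: mult.left_commute)
  next
    case (add g h)
    then show ?case using trig_polys.add[OF add.IH] by (simp add: distrib_left)
  qed
next
  case (scale f c)
  then show ?case using trig_polys.scale[OF scale.IH, of c] by (simp add: mult.assoc)
next
  case (add f h)
  then show ?case using trig_polys.add[OF add.IH] by (simp add: distrib_right)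
qed

lemma trig_polys_measurable:
  assumes "f \<in> trig_polys k" and "\<And>i. i < k \<Longrightarrow> (\<lambda>\<omega>. X \<omega> i) \<in> borel_measurable M"
  shows "(\<lambda>\<omega>. f (X \<omega>)) \<in> borel_measurable M"
  using assms(1)
proof induction
  case (wave a l)
  have "(\<lambda>\<omega>. \<Sum>i<k. l i * X \<omega> i) \<in> borel_measurable M"
    using assms(2) by (intro borel_measurable_sum borel_measurable_times) auto
  then show ?case by simp
qed simp_all

lemma trig_polys_bounded:
  assumes "f \<in> trig_polys k"
  shows "\<exists>B. \<forall>x. \<bar>f x\<bar> \<le> B"
  using assms
proof induction
  case (wave a l)
  then show ?case by (intro exI[of _ 1]) auto
next
  case (scale f c)
  then obtain B where "\<And>x. \<bar>f x\<bar> \<le> B" by auto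
  then show ?case by (intro exI[of _ "\<bar>c\<bar> * B"]) (auto simp: abs_mult intro: mult_left_mono)
next
  case (add f g)
  then obtain B B' where "\<And>x. \<bar>f x\<bar> \<le> B" "\<And>x. \<bar>g x\<bar> \<le> B'" by auto
  then show ?case by (intro exI[of _ "B + B'"]) (auto intro: order_trans[OF abs_triangle_ineq] add_mono)
qed

text \<open>The expectation of a wave is the real part of \<open>iexp a\<close> times the
  characteristic function at \<open>l\<close>; linearity does the rest.\<close>

lemma trig_polys_integral_tendsto:
  assumes P: "\<And>n. prob_space (P n)" and Q: "prob_space Q"
    and D: "\<And>n i. i < k \<Longrightarrow> (\<lambda>\<omega>. D n \<omega> i) \<in> borel_measurable (P n)"
    and E: "\<And>i. i < k \<Longrightarrow> (\<lambda>\<omega>. E \<omega> i) \<in> borel_measurable Q"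
    and char: "\<And>l :: nat \<Rightarrow> real. (\<lambda>n. \<integral>\<omega>. iexp (\<Sum>i<k. l i * D n \<omega> i) \<partial>P n) \<longlonglongrightarrow>
      (\<integral>\<omega>. iexp (\<Sum>i<k. l i * E \<omega> i) \<partial>Q)"
    and f: "f \<in> trig_polys k"
  shows "(\<lambda>n. \<integral>\<omega>. f (D n \<omega>) \<partial>P n) \<longlonglongrightarrow> (\<integral>\<omega>. f (E \<omega>) \<partial>Q)"
proof -
  have int: "integrable M (\<lambda>\<omega>. f (X \<omega>))"
    if f: "f \<in> trig_polys k" "prob_space M" "\<And>i. i < k \<Longrightarrow> (\<lambda>\<omega>. X \<omega> i) \<in> borel_measurable M"
    for f M and X :: "'c \<Rightarrow> nat \<Rightarrow> real"
  proof -
    interpret prob_space M by fact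
    obtain B where "\<And>x. \<bar>f x\<bar> \<le> B" using trig_polys_bounded[OF f(1)] by blast
    then show ?thesis
      using trig_polys_measurable[OF f(1,3)] by (intro integrable_const_bound[where B = B]) auto
  qed
  from f show ?thesis
  proof induction
    case (wave a l)
    have Re_eq: "(\<integral>\<omega>. cos (a + (\<Sum>i<k. l i * X \<omega> i)) \<partial>M) = Re (iexp a * (\<integral>\<omega>. iexp (\<Sum>i<k. l i * X \<omega> i) \<partial>M))"
      if M: "prob_space M" and X: "\<And>i. i < k \<Longrightarrow> (\<lambda>\<omega>. X \<omega> i) \<in> borel_measurable M"
      for M and X :: "'c \<Rightarrow> nat \<Rightarrow> real"
    proof -
      interpret prob_space M by fact
      have "(\<lambda>\<omega>. \<Sum>i<k. l i * X \<omega> i) \<in> borel_measurable M"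
        using X by (intro borel_measurable_sum borel_measurable_times) auto
      moreover have "iexp \<in> borel_measurable borel"
        by (intro borel_measurable_continuous_onI continuous_intros)
      ultimately have "(\<lambda>\<omega>. iexp (\<Sum>i<k. l i * X \<omega> i)) \<in> borel_measurable M"
        by (rule measurable_compose)
      then have 1: "integrable M (\<lambda>\<omega>. iexp (\<Sum>i<k. l i * X \<omega> i))"
        by (intro integrable_const_bound[where B = 1]) (auto simp del: of_real_sum of_real_mult)
      have "Re (iexp a * (\<integral>\<omega>. iexp (\<Sum>i<k. l i * X \<omega> i) \<partial>M)) =
          (\<integral>\<omega>. Re (iexp a * iexp (\<Sum>i<k. l i * X \<omega> i)) \<partial>M)"
        using 1 by (subst integral_mult_right_zero[symmetric], subst integral_Re[symmetric]) auto
      also have "\<dots> = (\<integral>\<omega>. cos (a + (\<Sum>i<k. l i * X \<omega> i)) \<partial>M)"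
      proof -
        have "Re (iexp a * iexp y) = cos (a + y)" for y
          by (simp add: exp_add[symmetric] distrib_left[symmetric] Re_exp)
        then show ?thesis by (simp only:)
      qed
      finally show ?thesis by simp
    qed
    have eqP: "(\<integral>\<omega>. cos (a + (\<Sum>i<k. l i * D n \<omega> i)) \<partial>P n) =
        Re (iexp a * (\<integral>\<omega>. iexp (\<Sum>i<k. l i * D n \<omega> i) \<partial>P n))" for n
      by (rule Re_eq[OF P D])
    have eqQ: "(\<integral>\<omega>. cos (a + (\<Sum>i<k. l i * E \<omega> i)) \<partial>Q) =
        Re (iexp a * (\<integral>\<omega>. iexp (\<Sum>i<k. l i * E \<omega> i) \<partial>Q))"
      by (rule Re_eq[OF Q E])
    show ?case
      unfolding eqP eqQ by (intro tendsto_Re tendsto_mult tendsto_const char)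
  next
    case (scale f c)
    then show ?case by (auto intro: tendsto_intros)
  next
    case (add f g)
    have "(\<integral>\<omega>. f (D n \<omega>) + g (D n \<omega>) \<partial>P n) = (\<integral>\<omega>. f (D n \<omega>) \<partial>P n) + (\<integral>\<omega>. g (D n \<omega>) \<partial>P n)" for n
      by (intro Bochner_Integration.integral_add int add.hyps P D)
    moreover have "(\<integral>\<omega>. f (E \<omega>) + g (E \<omega>) \<partial>Q) = (\<integral>\<omega>. f (E \<omega>) \<partial>Q) + (\<integral>\<omega>. g (E \<omega>) \<partial>Q)"
      by (intro Bochner_Integration.integral_add int add.hyps Q E)
    ultimately show ?case using add.IH by (auto intro: tendsto_intros)
  qed
qed

text \<open>The truncation \<open>x \<mapsto> A sin (x / A)\<close> maps the problem to a compact cube, where Stone-Weierstrass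
  applies, and turns polynomials into trigonometric polynomials.\<close>

definition sin_cube :: "nat \<Rightarrow> real \<Rightarrow> (nat \<Rightarrow> real) \<Rightarrow> nat \<Rightarrow> real" where
  "sin_cube k A x = (\<lambda>i. if i < k then sin (x i / A) else 0)"

lemma trig_polys_dense:
  fixes h :: "(nat \<Rightarrow> real) \<Rightarrow> real"
  assumes h: "continuous_on UNIV h" and \<epsilon>: "\<epsilon> > 0"
  shows "\<exists>p\<in>trig_polys k. \<forall>x. \<bar>h (sin_cube k A x) - p x\<bar> < \<epsilon>"
proof -
  \<comment> \<open>Compact as a product of compact sets. Freezing the coordinates from
    \<open>k\<close> on at \<open>0\<close> lets the first \<open>k\<close> coordinates separate
    points.\<close>
  define S :: "(nat \<Rightarrow> real) set" where "S = PiE UNIV (\<lambda>i. if i < k then {-1..1} else {0})"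
  \<comment> \<open>The ring is taken on the cube, but membership is tested after pulling back along
    \<open>sin_cube\<close>; a coordinate pulls back to a sine wave.\<close>
  define R where "R = {f. continuous_on UNIV f \<and> (\<lambda>x. f (sin_cube k A x)) \<in> trig_polys k}"
  have sin_S: "sin_cube k A x \<in> S" for x by (auto simp: S_def sin_cube_def)
  have cpt: "compact S"
  proof -
    have "compactin (product_topology (\<lambda>_. euclidean) UNIV) S"
      unfolding S_def by (subst compactin_PiE) auto
    then show ?thesis by (simp add: euclidean_product_topology)
  qed
  have coord: "(\<lambda>z. z i) \<in> R" if "i < k" for i
    using trig_polys_sin[OF that, of "1 / A"] that by (auto simp: R_def sin_cube_def)
  interpret function_ring_on R S
  proof
    show "compact S" by (rule cpt)
    show "continuous_on S f" if "f \<in> R" for f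
      using that continuous_on_subset by (auto simp: R_def)
    show "(\<lambda>x. f x + g x) \<in> R" if "f \<in> R" "g \<in> R" for f g
      using that by (auto simp: R_def intro: continuous_intros trig_polys.add)
    show "(\<lambda>x. f x * g x) \<in> R" if "f \<in> R" "g \<in> R" for f g
      using that by (auto simp: R_def intro: continuous_intros trig_polys_mult)
    show "(\<lambda>_. c) \<in> R" for c
      by (auto simp: R_def intro: trig_polys_const)
    show "\<exists>f\<in>R. f x \<noteq> f y" if xy: "x \<in> S" "y \<in> S" "x \<noteq> y" for x y
    proof -
      obtain i where i: "x i \<noteq> y i" using xy by blast
      have "x i \<in> (if i < k then {-1..1} else {0})" "y i \<in> (if i < k then {-1..1} else {0})"
        using xy by (auto simp only: S_def PiE_iff UNIV_I)
      then have "i < k" using i by (cases "i < k") auto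
      then show ?thesis using i by (intro bexI[OF _ coord]) auto
    qed
  qed
  obtain g where g: "g \<in> R" "\<And>z. z \<in> S \<Longrightarrow> \<bar>h z - g z\<bar> < \<epsilon>"
    using Stone_Weierstrass_basic[OF continuous_on_subset[OF h] \<epsilon>] by auto
  show ?thesis
    by (rule bexI[of _ "\<lambda>x. g (sin_cube k A x)"]) (use g sin_S in \<open>auto simp: R_def\<close>)
qed

text \<open>Trigonometric polynomials approximate \<open>g\<close> uniformly only after truncation.
  The truncation error is uniform in \<open>n\<close> by the fourth moments, while for the limit
  \<open>E\<close> dominated convergence removes the truncation. The hypothesis \<open>lip\<close>
  also says that \<open>g\<close> depends on the first \<open>k\<close> coordinates only.\<close>

theorem multivariate_Levy_continuity:
  fixes D :: "nat \<Rightarrow> 'a \<Rightarrow> nat \<Rightarrow> real" and E :: "'b \<Rightarrow> nat \<Rightarrow> real" and g :: "(nat \<Rightarrow> real) \<Rightarrow> real"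
  assumes P: "\<And>n. prob_space (P n)" and Q: "prob_space Q"
    and D: "\<And>n i. i < k \<Longrightarrow> (\<lambda>\<omega>. D n \<omega> i) \<in> borel_measurable (P n)"
    and E: "\<And>i. i < k \<Longrightarrow> (\<lambda>\<omega>. E \<omega> i) \<in> borel_measurable Q"
    and mom: "eventually (\<lambda>n. \<forall>i<k. integrable (P n) (\<lambda>\<omega>. D n \<omega> i ^ 4) \<and> (\<integral>\<omega>. D n \<omega> i ^ 4 \<partial>P n) \<le> C) sequentially"
    and char: "\<And>l :: nat \<Rightarrow> real. (\<lambda>n. \<integral>\<omega>. iexp (\<Sum>i<k. l i * D n \<omega> i) \<partial>P n) \<longlonglongrightarrow>
      (\<integral>\<omega>. iexp (\<Sum>i<k. l i * E \<omega> i) \<partial>Q)"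
    and bdd: "\<And>x. \<bar>g x\<bar> \<le> B" and L: "0 \<le> L"
    and lip: "\<And>x y. \<bar>g x - g y\<bar> \<le> L * (\<Sum>i<k. \<bar>x i - y i\<bar>)"
  shows "(\<lambda>n. \<integral>\<omega>. g (D n \<omega>) \<partial>P n) \<longlonglongrightarrow> (\<integral>\<omega>. g (E \<omega>) \<partial>Q)"
proof -
  have cont: "continuous_on UNIV g"
    unfolding continuous_on_def
  proof
    fix y :: "nat \<Rightarrow> real"
    have "((\<lambda>x. x i) \<longlongrightarrow> y i) (at y within UNIV)" for i
    proof -
      have "continuous_on UNIV (\<lambda>x :: nat \<Rightarrow> real. x i)" by simp
      then show ?thesis unfolding continuous_on_def by (drule_tac x = y in bspec) simp_all
    qed
    then have "((\<lambda>x. L * (\<Sum>i<k. \<bar>x i - y i\<bar>)) \<longlongrightarrow> L * (\<Sum>i<k. \<bar>y i - y i\<bar>)) (at y within UNIV)"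
      by (intro tendsto_intros)
    then have "((\<lambda>x. L * (\<Sum>i<k. \<bar>x i - y i\<bar>)) \<longlongrightarrow> 0) (at y within UNIV)" by simp
    then have "((\<lambda>x. g x - g y) \<longlongrightarrow> 0) (at y within UNIV)"
      by (rule Lim_null_comparison[rotated]) (use lip in auto)
    then show "(g \<longlongrightarrow> g y) (at y within UNIV)" by (rule LIM_zero_cancel)
  qed
  have gmeas: "(\<lambda>\<omega>. g (X \<omega>)) \<in> borel_measurable M"
    if X: "\<And>i. i < k \<Longrightarrow> (\<lambda>\<omega>. X \<omega> i) \<in> borel_measurable M" for M and X :: "'c \<Rightarrow> nat \<Rightarrow> real"
  proof -
    \<comment> \<open>Nothing is assumed about the coordinates from \<open>k\<close> on; replacing
      them by \<open>0\<close> does not change \<open>g\<close>, by \<open>lip\<close>.\<close>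
    have "(\<lambda>\<omega> i. if i < k then X \<omega> i else 0) \<in> borel_measurable M"
    proof (rule measurable_coordinatewise_then_product)
      show "(\<lambda>\<omega>. if i < k then X \<omega> i else 0) \<in> borel_measurable M" for i
        using X by (cases "i < k") simp_all
    qed
    then have "(\<lambda>\<omega>. g (\<lambda>i. if i < k then X \<omega> i else 0)) \<in> borel_measurable M"
      by (rule measurable_compose[OF _ borel_measurable_continuous_onI[OF cont]])
    moreover have "g (\<lambda>i. if i < k then X \<omega> i else 0) = g (X \<omega>)" for \<omega>
      using lip[of "\<lambda>i. if i < k then X \<omega> i else 0" "X \<omega>"] by simp
    ultimately show ?thesis by simp
  qed
  have int_bdd: "integrable M f" if "prob_space M" "f \<in> borel_measurable M" "\<And>\<omega>. \<bar>f \<omega>\<bar> \<le> W"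
    for M W and f :: "'c \<Rightarrow> real"
  proof -
    interpret prob_space M by fact
    show ?thesis using that by (intro integrable_const_bound[where B = W]) auto
  qed
  have diff_le: "\<bar>(\<integral>\<omega>. f \<omega> \<partial>M) - (\<integral>\<omega>. f' \<omega> \<partial>M)\<bar> \<le> w"
    if M: "prob_space M" and f: "integrable M f" "integrable M f'"
      and w: "\<And>\<omega>. \<bar>f \<omega> - f' \<omega>\<bar> \<le> w" for M w and f f' :: "'c \<Rightarrow> real"
  proof -
    interpret prob_space M by fact
    have "\<bar>(\<integral>\<omega>. f \<omega> \<partial>M) - (\<integral>\<omega>. f' \<omega> \<partial>M)\<bar> = \<bar>\<integral>\<omega>. f \<omega> - f' \<omega> \<partial>M\<bar>"
      using f by simp
    also have "\<dots> \<le> (\<integral>\<omega>. \<bar>f \<omega> - f' \<omega>\<bar> \<partial>M)" by (rule integral_abs_bound)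
    also have "\<dots> \<le> (\<integral>\<omega>. w \<partial>M)" using f w by (intro integral_mono) auto
    also have "\<dots> = w" by (simp add: prob_space)
    finally show ?thesis .
  qed
  define T where "T A x = (\<lambda>i. A * sin_cube k A x i)" for A x
  have Tmeas: "(\<lambda>\<omega>. T A (X \<omega>) i) \<in> borel_measurable M"
    if "\<And>i. i < k \<Longrightarrow> (\<lambda>\<omega>. X \<omega> i) \<in> borel_measurable M" for M A i and X :: "'c \<Rightarrow> nat \<Rightarrow> real"
    using that by (cases "i < k") (auto simp: T_def sin_cube_def)
  have trunc: "(\<lambda>n. \<integral>\<omega>. g (T A (D n \<omega>)) \<partial>P n) \<longlonglongrightarrow> (\<integral>\<omega>. g (T A (E \<omega>)) \<partial>Q)" for A
  proof -
    have hc: "continuous_on UNIV (\<lambda>z. g (\<lambda>i. A * z i))"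
      by (rule continuous_on_compose2[OF cont])
         (auto intro!: continuous_on_coordinatewise_then_product continuous_intros)
    have "\<exists>p\<in>trig_polys k. \<forall>x. \<bar>g (T A x) - p x\<bar> < 1 / real (Suc m)" for m
      using trig_polys_dense[OF hc, of "1 / real (Suc m)" k A] by (simp add: T_def)
    then obtain p where p: "\<And>m. p m \<in> trig_polys k"
      "\<And>m x. \<bar>g (T A x) - p m x\<bar> < 1 / real (Suc m)" by metis
    have pint: "integrable M (\<lambda>\<omega>. p m (X \<omega>))"
      if "prob_space M" "\<And>i. i < k \<Longrightarrow> (\<lambda>\<omega>. X \<omega> i) \<in> borel_measurable M"
      for m M and X :: "'c \<Rightarrow> nat \<Rightarrow> real"
    proof -
      obtain W where "\<And>x. \<bar>p m x\<bar> \<le> W" using trig_polys_bounded[OF p(1)] by blast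
      then show ?thesis using that trig_polys_measurable[OF p(1) that(2)] by (intro int_bdd) auto
    qed
    have l0: "(\<lambda>m. 1 / real (Suc m)) \<longlonglongrightarrow> 0"
      using LIMSEQ_inverse_real_of_nat by (simp add: inverse_eq_divide)
    show ?thesis
    proof (rule tendsto_by_approximations[where e = "\<lambda>m. 1 / real (Suc m)" and d = "\<lambda>_. 0"])
      show "(\<lambda>n. \<integral>\<omega>. p m (D n \<omega>) \<partial>P n) \<longlonglongrightarrow> (\<integral>\<omega>. p m (E \<omega>) \<partial>Q)" for m
        by (rule trig_polys_integral_tendsto[OF P Q D E char p(1)])
      show "(\<lambda>m. \<integral>\<omega>. p m (E \<omega>) \<partial>Q) \<longlonglongrightarrow> (\<integral>\<omega>. g (T A (E \<omega>)) \<partial>Q)"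
      proof (rule LIM_zero_cancel, rule Lim_null_comparison[OF _ l0], rule always_eventually, rule allI)
        fix m
        have "\<bar>(\<integral>\<omega>. p m (E \<omega>) \<partial>Q) - (\<integral>\<omega>. g (T A (E \<omega>)) \<partial>Q)\<bar> \<le> 1 / real (Suc m)"
          by (rule diff_le[OF Q pint[OF Q E] int_bdd[OF Q gmeas[OF Tmeas[OF E]] bdd]])
             (use p(2)[of _ m] in \<open>auto simp: abs_minus_commute intro: less_imp_le\<close>)
        then show "norm ((\<integral>\<omega>. p m (E \<omega>) \<partial>Q) - (\<integral>\<omega>. g (T A (E \<omega>)) \<partial>Q)) \<le> 1 / real (Suc m)"
          by simp
      qed
      show "eventually (\<lambda>n. \<bar>(\<integral>\<omega>. g (T A (D n \<omega>)) \<partial>P n) - (\<integral>\<omega>. p m (D n \<omega>) \<partial>P n)\<bar>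
          \<le> 1 / real (Suc m) + 0) sequentially" for m
      proof (rule always_eventually, rule allI)
        fix n
        have "\<bar>(\<integral>\<omega>. g (T A (D n \<omega>)) \<partial>P n) - (\<integral>\<omega>. p m (D n \<omega>) \<partial>P n)\<bar> \<le> 1 / real (Suc m)"
          by (rule diff_le[OF P int_bdd[OF P gmeas[OF Tmeas[OF D]] bdd] pint[OF P D]])
             (use p(2)[of _ m] in \<open>auto intro: less_imp_le\<close>)
        then show "\<bar>(\<integral>\<omega>. g (T A (D n \<omega>)) \<partial>P n) - (\<integral>\<omega>. p m (D n \<omega>) \<partial>P n)\<bar>
          \<le> 1 / real (Suc m) + 0" by simp
      qed
    qed (use l0 in auto)
  qed
  \<comment> \<open>Quadratic in the coordinate, so that the fourth moments control its expectation,
    with the factor \<open>1 / A\<close> to be sent to zero.\<close>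
  have T_close: "\<bar>x i - T A x i\<bar> \<le> (x i)\<^sup>2 / A" if "i < k" "A > 0" for A x i
  proof -
    have "\<bar>x i - T A x i\<bar> = A * \<bar>sin (x i / A) - x i / A\<bar>"
      using that by (simp add: T_def sin_cube_def abs_mult_pos' field_simps abs_minus_commute)
    also have "\<dots> \<le> A * (x i / A)\<^sup>2" using that by (intro mult_left_mono abs_sin_minus_le) auto
    also have "\<dots> = (x i)\<^sup>2 / A" using that by (simp add: power2_eq_square)
    finally show ?thesis .
  qed
  have lN: "(\<lambda>m. c / real (Suc m)) \<longlonglongrightarrow> 0" for c
    by (intro LIMSEQ_Suc lim_const_over_n)
  show ?thesis
  proof (rule tendsto_by_approximations[where b = "\<lambda>m n. \<integral>\<omega>. g (T (real (Suc m)) (D n \<omega>)) \<partial>P n"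
        and e = "\<lambda>m. L * (real k * (1 + C)) / real (Suc m)" and d = "\<lambda>_. 0"])
    show "(\<lambda>m. \<integral>\<omega>. g (T (real (Suc m)) (E \<omega>)) \<partial>Q) \<longlonglongrightarrow> (\<integral>\<omega>. g (E \<omega>) \<partial>Q)"
    proof (rule integral_dominated_convergence[where w = "\<lambda>_. B"])
      interpret Q: prob_space Q by (rule Q)
      show "(\<lambda>\<omega>. g (E \<omega>)) \<in> borel_measurable Q" using E by (rule gmeas)
      show "(\<lambda>\<omega>. g (T (real (Suc m)) (E \<omega>))) \<in> borel_measurable Q" for m
        by (rule gmeas[OF Tmeas[OF E]])
      show "integrable Q (\<lambda>_. B)" by simp
      show "AE \<omega> in Q. (\<lambda>m. g (T (real (Suc m)) (E \<omega>))) \<longlonglongrightarrow> g (E \<omega>)"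
      proof (rule AE_I2)
        fix \<omega>
        have "(\<lambda>m. L * (\<Sum>i<k. (E \<omega> i)\<^sup>2 / real (Suc m))) \<longlonglongrightarrow> L * (\<Sum>i<k. 0)"
          by (intro tendsto_intros lN)
        then have lim0: "(\<lambda>m. L * (\<Sum>i<k. (E \<omega> i)\<^sup>2 / real (Suc m))) \<longlonglongrightarrow> 0" by simp
        have bound: "norm (g (T (real (Suc m)) (E \<omega>)) - g (E \<omega>)) \<le> L * (\<Sum>i<k. (E \<omega> i)\<^sup>2 / real (Suc m))" for m
        proof -
          have "L * (\<Sum>i<k. \<bar>E \<omega> i - T (real (Suc m)) (E \<omega>) i\<bar>) \<le> L * (\<Sum>i<k. (E \<omega> i)\<^sup>2 / real (Suc m))"
            using L by (intro mult_left_mono sum_mono T_close) auto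
          then show ?thesis
            using lip[of "E \<omega>" "T (real (Suc m)) (E \<omega>)"] by (simp add: abs_minus_commute)
        qed
        have "eventually (\<lambda>m. norm (g (T (real (Suc m)) (E \<omega>)) - g (E \<omega>)) \<le> L * (\<Sum>i<k. (E \<omega> i)\<^sup>2 / real (Suc m))) sequentially"
          using bound by (intro always_eventually allI)
        from Lim_null_comparison[OF this lim0]
        show "(\<lambda>m. g (T (real (Suc m)) (E \<omega>))) \<longlonglongrightarrow> g (E \<omega>)" by (rule LIM_zero_cancel)
      qed
    qed (use bdd in auto)
    show "eventually (\<lambda>n. \<bar>(\<integral>\<omega>. g (D n \<omega>) \<partial>P n) - (\<integral>\<omega>. g (T (real (Suc m)) (D n \<omega>)) \<partial>P n)\<bar>
      \<le> L * (real k * (1 + C)) / real (Suc m) + 0) sequentially" for m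
      using mom
    proof eventually_elim
      case (elim n)
      interpret Pn: prob_space "P n" by (rule P)
      let ?A = "real (Suc m)"
      have sq: "(y::real)\<^sup>2 \<le> 1 + y ^ 4" for y
      proof -
        have "0 \<le> (y\<^sup>2 - 1)\<^sup>2 + y\<^sup>2" by simp
        then show ?thesis by (simp add: power2_eq_square algebra_simps numeral_eq_Suc)
      qed
      have "integrable (P n) (\<lambda>\<omega>. (1 + D n \<omega> i ^ 4) / ?A)" if "i < k" for i
        using elim that by (intro integrable_divide Bochner_Integration.integrable_add) auto
      then have int4: "integrable (P n) (\<lambda>\<omega>. \<Sum>i<k. (1 + D n \<omega> i ^ 4) / ?A)"
        by (intro Bochner_Integration.integrable_sum) simp
      have ig1: "integrable (P n) (\<lambda>\<omega>. g (D n \<omega>))"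
        by (rule int_bdd[OF P gmeas bdd]) (rule D)
      have ig2: "integrable (P n) (\<lambda>\<omega>. g (T ?A (D n \<omega>)))"
        by (rule int_bdd[OF P gmeas[OF Tmeas] bdd]) (rule D)
      have "\<bar>(\<integral>\<omega>. g (D n \<omega>) \<partial>P n) - (\<integral>\<omega>. g (T ?A (D n \<omega>)) \<partial>P n)\<bar> = \<bar>\<integral>\<omega>. g (D n \<omega>) - g (T ?A (D n \<omega>)) \<partial>P n\<bar>"
        using ig1 ig2 by simp
      also have "\<dots> \<le> (\<integral>\<omega>. \<bar>g (D n \<omega>) - g (T ?A (D n \<omega>))\<bar> \<partial>P n)" by (rule integral_abs_bound)
      also have "\<dots> \<le> (\<integral>\<omega>. L * (\<Sum>i<k. (1 + D n \<omega> i ^ 4) / ?A) \<partial>P n)"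
      proof (rule integral_mono)
        fix \<omega>
        have "\<bar>g (D n \<omega>) - g (T ?A (D n \<omega>))\<bar> \<le> L * (\<Sum>i<k. \<bar>D n \<omega> i - T ?A (D n \<omega>) i\<bar>)" by (rule lip)
        also have "\<dots> \<le> L * (\<Sum>i<k. (1 + D n \<omega> i ^ 4) / ?A)"
          using L by (intro mult_left_mono sum_mono order_trans[OF T_close] divide_right_mono sq) auto
        finally show "\<bar>g (D n \<omega>) - g (T ?A (D n \<omega>))\<bar> \<le> L * (\<Sum>i<k. (1 + D n \<omega> i ^ 4) / ?A)" .
      next
        show "integrable (P n) (\<lambda>\<omega>. \<bar>g (D n \<omega>) - g (T ?A (D n \<omega>))\<bar>)"
          by (intro integrable_abs Bochner_Integration.integrable_diff ig1 ig2)
        show "integrable (P n) (\<lambda>\<omega>. L * (\<Sum>i<k. (1 + D n \<omega> i ^ 4) / ?A))"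
          by (rule integrable_mult_right) (rule int4)
      qed
      also have "\<dots> = L * (\<Sum>i<k. \<integral>\<omega>. (1 + D n \<omega> i ^ 4) / ?A \<partial>P n)"
        unfolding integral_mult_right_zero
        by (subst Bochner_Integration.integral_sum) (use \<open>\<And>i. i < k \<Longrightarrow> integrable (P n) (\<lambda>\<omega>. (1 + D n \<omega> i ^ 4) / ?A)\<close> in auto)
      also have "\<dots> = L * (\<Sum>i<k. (1 + (\<integral>\<omega>. D n \<omega> i ^ 4 \<partial>P n)) / ?A)"
      proof -
        have "(\<integral>\<omega>. (1 + D n \<omega> i ^ 4) / ?A \<partial>P n) = (1 + (\<integral>\<omega>. D n \<omega> i ^ 4 \<partial>P n)) / ?A" if "i < k" for i
          unfolding integral_divide_zero using elim that
          by (subst Bochner_Integration.integral_add) (auto simp: Pn.prob_space)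
        then show ?thesis by simp
      qed
      also have "\<dots> \<le> L * (\<Sum>i<k. (1 + C) / ?A)"
        using elim L by (intro mult_left_mono sum_mono divide_right_mono add_left_mono) auto
      also have "\<dots> = L * (real k * (1 + C)) / ?A + 0" by simp
      finally show ?case .
    qed
    show "(\<lambda>n. \<integral>\<omega>. g (T (real (Suc m)) (D n \<omega>)) \<partial>P n) \<longlonglongrightarrow> (\<integral>\<omega>. g (T (real (Suc m)) (E \<omega>)) \<partial>Q)" for m
      by (rule trunc)
    show "(\<lambda>m. L * (real k * (1 + C)) / real (Suc m)) \<longlonglongrightarrow> 0"
      by (rule lN)
    show "(\<lambda>_. 0 :: real) \<longlonglongrightarrow> 0"
      by (rule tendsto_const)
  qed
qed

section \<open>Cycles in random graphs\<close>

definition linked :: "'v set set \<Rightarrow> ('v \<times> 'v) set" where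
  "linked E = {(a, b). {a, b} \<in> E}\<^sup>*"

lemma linked_refl [simp]: "(u, u) \<in> linked E"
  by (simp add: linked_def)

lemma linked_sym: "(u, v) \<in> linked E \<Longrightarrow> (v, u) \<in> linked E"
proof -
  have "sym {(a, b). {a, b} \<in> E}" by (auto simp: sym_def insert_commute)
  then have "sym (linked E)" unfolding linked_def by (rule sym_rtrancl)
  then show "(u, v) \<in> linked E \<Longrightarrow> (v, u) \<in> linked E" by (rule symD)
qed

lemma linked_trans: "(u, v) \<in> linked E \<Longrightarrow> (v, w) \<in> linked E \<Longrightarrow> (u, w) \<in> linked E"
  unfolding linked_def by (rule rtrancl_trans)

lemma linked_mono: "E \<subseteq> F \<Longrightarrow> linked E \<subseteq> linked F"
  unfolding linked_def by (rule rtrancl_mono) auto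

lemma linked_edge: "{u, v} \<in> E \<Longrightarrow> (u, v) \<in> linked E"
  unfolding linked_def by auto

text \<open>A walk through the new edge stays in \<open>E\<close> until it meets an endpoint and
  after it leaves an endpoint for the last time; only the classes of \<open>a\<close> and
  \<open>b\<close> merge.\<close>

lemma linked_insert:
  "(u, v) \<in> linked (insert {a, b} E) \<longleftrightarrow> (u, v) \<in> linked E \<or>
    ((u, a) \<in> linked E \<or> (u, b) \<in> linked E) \<and> ((v, a) \<in> linked E \<or> (v, b) \<in> linked E)"
    (is "?L \<longleftrightarrow> ?R")
proof
  assume ?L
  then have "(u, v) \<in> {(x, y). {x, y} \<in> insert {a, b} E}\<^sup>*" by (simp add: linked_def)
  then show ?R
  proof induction
    case (step y z)
    then consider "{y, z} \<in> E" | "{y, z} = {a, b}" by auto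
    then show ?case
    proof cases
      case 1
      then have "(y, z) \<in> linked E" by (rule linked_edge)
      then show ?thesis using step.IH by (meson linked_sym linked_trans)
    next
      case 2
      then have "y = a \<and> z = b \<or> y = b \<and> z = a" by (auto simp: doubleton_eq_iff)
      then show ?thesis using step.IH by (meson linked_sym linked_trans linked_refl)
    qed
  qed simp
next
  have sub: "linked E \<subseteq> linked (insert {a, b} E)" by (rule linked_mono) auto
  have "(a, b) \<in> linked (insert {a, b} E)" by (rule linked_edge) simp
  then show "?R \<Longrightarrow> ?L" using sub by (meson linked_sym linked_trans subsetD)
qed

lemma equiv_linked: "equiv V {(u, v). u \<in> V \<and> v \<in> V \<and> (u, v) \<in> linked E}"
  by (rule equivI) (auto simp: refl_on_def sym_def trans_def intro: linked_sym linked_trans)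

lemma connected_components_linked:
  "connected_components V E = V // {(u, v). u \<in> V \<and> v \<in> V \<and> (u, v) \<in> linked E}"
  by (simp add: connected_components_def linked_def)

text \<open>If the endpoints lie in different classes \<open>A\<close> and \<open>B\<close>, the new
  quotient loses these two and gains \<open>A \<union> B\<close>; otherwise the relation is
  unchanged.\<close>

lemma card_connected_components_insert:
  assumes V: "finite V" "a \<in> V" "b \<in> V"
  shows "card (connected_components V E) =
    card (connected_components V (insert {a, b} E)) + (if (a, b) \<in> linked E then 0 else 1)"
proof (cases "(a, b) \<in> linked E")
  case True
  then have "linked (insert {a, b} E) = linked E"
    using linked_insert[of _ _ a b E] by (auto; meson linked_sym linked_trans)
  then show ?thesis using True by (simp add: connected_components_linked)
next
  case False
  define r where "r = {(u, v). u \<in> V \<and> v \<in> V \<and> (u, v) \<in> linked E}"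
  define r' where "r' = {(u, v). u \<in> V \<and> v \<in> V \<and> (u, v) \<in> linked (insert {a, b} E)}"
  define A B where "A = r `` {a}" and "B = r `` {b}"
  have eq: "equiv V r" unfolding r_def by (rule equiv_linked)
  have A: "A \<in> V // r" "B \<in> V // r" using V by (auto simp: A_def B_def intro: quotientI)
  have mem: "x \<in> A \<longleftrightarrow> x \<in> V \<and> (x, a) \<in> linked E" "x \<in> B \<longleftrightarrow> x \<in> V \<and> (x, b) \<in> linked E" for x
    using V linked_sym by (fastforce simp: A_def B_def r_def)+
  have "A \<noteq> B" using False mem[of a] V by auto
  have cls: "r' `` {x} = (if x \<in> A \<union> B then A \<union> B else r `` {x})" if "x \<in> V" for x
  proof -
    have r'x: "y \<in> r' `` {x} \<longleftrightarrow> y \<in> V \<and> ((x, y) \<in> linked E \<or> x \<in> A \<union> B \<and> y \<in> A \<union> B)" for y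
      using that mem[of x] mem[of y] linked_insert[of x y a b E] by (auto simp: r'_def)
    have "y \<in> r' `` {x} \<longleftrightarrow> y \<in> (if x \<in> A \<union> B then A \<union> B else r `` {x})" for y
    proof (cases "x \<in> A \<union> B")
      case True
      have "y \<in> A \<union> B" if "y \<in> V" "(x, y) \<in> linked E"
        using True that mem[of x] mem[of y] by (meson Un_iff linked_sym linked_trans)
      then show ?thesis using True r'x[of y] mem[of y] by auto
    next
      case False
      then show ?thesis using \<open>x \<in> V\<close> r'x[of y] by (auto simp: r_def)
    qed
    then show ?thesis by blast
  qed
  have "V // r' = insert (A \<union> B) (V // r - {A, B})"
  proof (intro set_eqI iffI)
    fix C assume "C \<in> V // r'"
    then obtain x where x: "x \<in> V" "C = r' `` {x}" by (rule quotientE)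
    show "C \<in> insert (A \<union> B) (V // r - {A, B})"
    proof (cases "x \<in> A \<union> B")
      case False
      have "x \<in> r `` {x}" using eq x(1) by (rule equiv_class_self)
      then have "r `` {x} \<noteq> A" "r `` {x} \<noteq> B" using False by auto
      then show ?thesis using False x cls[OF x(1)] by (auto intro: quotientI)
    qed (use x cls[OF x(1)] in simp)
  next
    fix C assume C: "C \<in> insert (A \<union> B) (V // r - {A, B})"
    show "C \<in> V // r'"
    proof (cases "C = A \<union> B")
      case True
      have "a \<in> A" using mem V by simp
      then have "C = r' `` {a}" using cls[OF V(2)] True by simp
      then show ?thesis using V(2) by (auto intro: quotientI)
    next
      case False
      then have "C \<in> V // r" "C \<noteq> A" "C \<noteq> B" using C by auto
      then obtain x where x: "x \<in> V" "C = r `` {x}" by (auto elim: quotientE)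
      have "x \<in> C" using equiv_class_self[OF eq x(1)] x(2) by simp
      then have "x \<notin> A \<union> B"
        using quotient_disj[OF eq \<open>C \<in> V // r\<close>] A \<open>C \<noteq> A\<close> \<open>C \<noteq> B\<close> by blast
      then show ?thesis using cls[OF x(1)] x quotientI[OF x(1), of r'] by simp
    qed
  qed
  moreover have "A \<union> B \<notin> V // r - {A, B}"
  proof
    assume "A \<union> B \<in> V // r - {A, B}"
    then have "A \<union> B \<in> V // r" "A \<union> B \<noteq> A" by auto
    moreover have "a \<in> A" using mem V by simp
    ultimately show False using quotient_disj[OF eq _ A(1), of "A \<union> B"] by blast
  qed
  moreover have fin: "finite (V // r)" using V eq by (intro finite_quotient) (auto simp: r_def)
  ultimately have "card (V // r') = Suc (card (V // r - {A, B}))" by simp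
  moreover have "card (V // r - {A, B}) = card (V // r) - 2"
    using A \<open>A \<noteq> B\<close> by (subst card_Diff_subset) auto
  \<comment> \<open>Rules out truncation in the natural-number subtraction of
    \<open>2\<close>.\<close>
  moreover have "card {A, B} \<le> card (V // r)" using A by (intro card_mono fin) auto
  ultimately show ?thesis
    using False \<open>A \<noteq> B\<close> by (simp add: connected_components_linked r_def[symmetric] r'_def[symmetric])
qed

lemma card_connected_components_empty: "finite V \<Longrightarrow> card (connected_components V {}) = card V"
proof -
  have "linked {} = (Id :: ('a \<times> 'a) set)" by (simp add: linked_def)
  then have "connected_components V {} = (\<lambda>x. {x}) ` V"
    by (auto simp: connected_components_linked quotient_def)
  then show ?thesis by (simp add: card_image)
qed

text \<open>The number of independent cycles.\<close>

definition excess :: "nat \<Rightarrow> nat set set \<Rightarrow> int" where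
  "excess n F = int (card (connected_components {1..n} F)) + int (card F) - int n"

text \<open>The edges that are not bridges. Deleting \<open>e\<close> before testing connectivity
  separates the event that \<open>e\<close> is present from an event about the other edges, so the
  two are independent.\<close>

definition cyclic_edges :: "nat set set \<Rightarrow> nat set set" where
  "cyclic_edges F = {e \<in> F. \<exists>a b. e = {a, b} \<and> (a, b) \<in> linked (F - {e})}"

lemma finite_complete_edges: "finite (complete_edges n)"
  unfolding complete_edges_def by (rule finite_subset[of _ "Pow {1..n}"]) auto

lemma card_complete_edges: "card (complete_edges n) = n choose 2"
  unfolding complete_edges_def using n_subsets[of "{1..n}" 2] by simp

lemma complete_edgesE:
  assumes "e \<in> complete_edges n"
  obtains a b where "e = {a, b}" "a \<noteq> b" "a \<in> {1..n}" "b \<in> {1..n}"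
  using assms by (auto simp: complete_edges_def card_2_iff)

lemma excess_insert:
  assumes "finite F" "e \<notin> F" "a \<in> {1..n}" "b \<in> {1..n}" "e = {a, b}"
  shows "excess n (insert e F) = excess n F + (if (a, b) \<in> linked F then 1 else 0)"
  using card_connected_components_insert[of "{1..n}" a b F] assms by (simp add: excess_def)

lemma excess_empty: "excess n {} = 0"
  by (simp add: excess_def card_connected_components_empty)

text \<open>Edges added one at a time never lower the excess. Its value at the final time therefore
  bounds it along the whole path, so an estimate at a single time suffices.\<close>

lemma excess_mono:
  assumes "F \<subseteq> F'" "F' \<subseteq> complete_edges n"
  shows "excess n F \<le> excess n F'"
proof -
  have fin: "finite F'" using assms(2) finite_complete_edges by (rule finite_subset)
  have "H \<subseteq> F' - F \<Longrightarrow> excess n F \<le> excess n (F \<union> H)" if "finite H" for H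
    using that
  proof induction
    case (insert e H)
    have "e \<in> complete_edges n" using insert.prems assms(2) by auto
    then obtain a b where "e = {a, b}" "a \<in> {1..n}" "b \<in> {1..n}" by (rule complete_edgesE)
    moreover have "finite (F \<union> H)" using insert.hyps assms(1) fin finite_subset by auto
    ultimately have "excess n (F \<union> H) \<le> excess n (insert e (F \<union> H))"
      using insert by (subst excess_insert[of _ e a n b]) auto
    then show ?case using insert by simp
  qed simp
  from this[of "F' - F"] show ?thesis using fin assms(1) by (simp add: Un_absorb1)
qed

lemma excess_nonneg: "F \<subseteq> complete_edges n \<Longrightarrow> 0 \<le> excess n F"
  using excess_mono[of "{}" F n] by (simp add: excess_empty)

text \<open>An insertion that raises the excess makes the inserted edge itself cyclic, and cyclic
  edges remain cyclic as the graph grows.\<close>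

lemma excess_le_cyclic_edges:
  assumes "F \<subseteq> complete_edges n"
  shows "excess n F \<le> int (card (cyclic_edges F))"
proof -
  have "finite F" using assms finite_complete_edges by (rule finite_subset)
  then show ?thesis using assms
  proof induction
    case (insert e F)
    have sub: "cyclic_edges F \<subseteq> cyclic_edges (insert e F)"
    proof
      fix e' assume "e' \<in> cyclic_edges F"
      then obtain a b where "e' \<in> F" "e' = {a, b}" "(a, b) \<in> linked (F - {e'})"
        by (auto simp: cyclic_edges_def)
      moreover have "linked (F - {e'}) \<subseteq> linked (insert e F - {e'})" by (rule linked_mono) auto
      ultimately show "e' \<in> cyclic_edges (insert e F)" by (auto simp: cyclic_edges_def)
    qed
    have fin: "finite (cyclic_edges (insert e F))" using insert.hyps by (simp add: cyclic_edges_def)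
    obtain a b where ab: "e = {a, b}" "a \<in> {1..n}" "b \<in> {1..n}"
      using insert.prems by (auto elim: complete_edgesE)
    note ex = excess_insert[OF insert.hyps ab(2,3,1)]
    show ?case
    proof (cases "(a, b) \<in> linked F")
      case True
      have "insert e F - {e} = F" using insert.hyps by auto
      then have "insert e (cyclic_edges F) \<subseteq> cyclic_edges (insert e F)"
        using sub True ab(1) by (auto simp: cyclic_edges_def)
      moreover have "e \<notin> cyclic_edges F" "finite (cyclic_edges F)"
        using insert.hyps by (auto simp: cyclic_edges_def)
      ultimately have "Suc (card (cyclic_edges F)) \<le> card (cyclic_edges (insert e F))"
        using card_mono[OF fin, of "insert e (cyclic_edges F)"] by simp
      then show ?thesis using insert True by (simp add: ex)
    next
      case False
      then show ?thesis using insert card_mono[OF fin sub] by (simp add: ex)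
    qed
  qed (simp add: excess_empty)
qed

text \<open>Cut a walk at its last visit to \<open>u\<close>. The rest avoids all edges at
  \<open>u\<close> and is thus independent of the edge taken out of \<open>u\<close>.\<close>

lemma linked_last_exit:
  assumes "(u, v) \<in> linked E" "u \<noteq> v"
  shows "\<exists>w. {u, w} \<in> E \<and> w \<noteq> u \<and> (w, v) \<in> linked {e \<in> E. u \<notin> e}"
proof -
  have "(u, v) \<in> {(a, b). {a, b} \<in> E}\<^sup>*" using assms(1) by (simp add: linked_def)
  then have "v = u \<or> (\<exists>w. {u, w} \<in> E \<and> w \<noteq> u \<and> (w, v) \<in> linked {e \<in> E. u \<notin> e})"
  proof induction
    case (step y z)
    show ?case
    proof (cases "z = u \<or> y = u")
      case True
      then show ?thesis using step.hyps by auto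
    next
      case False
      then have "(y, z) \<in> linked {e \<in> E. u \<notin> e}" using step.hyps by (intro linked_edge) auto
      then show ?thesis using step.IH False by (meson linked_trans)
    qed
  qed simp
  then show ?thesis using assms(2) by auto
qed

section \<open>Events about the random edge set\<close>

lemma measurable_random_set:
  fixes X :: "'e \<Rightarrow> 'a \<Rightarrow> bool"
  assumes "finite J" "\<And>e. e \<in> J \<Longrightarrow> X e \<in> M \<rightarrow>\<^sub>M count_space UNIV" "\<And>S. F S \<in> space N"
  shows "(\<lambda>\<omega>. F {e \<in> J. X e \<omega>}) \<in> M \<rightarrow>\<^sub>M N"
proof -
  have "(\<lambda>\<omega>. restrict (\<lambda>e. X e \<omega>) J) \<in> M \<rightarrow>\<^sub>M PiM J (\<lambda>_. count_space UNIV)"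
    using assms(2) by (intro measurable_restrict)
  \<comment> \<open>The indicator vector of the random set lives in a finite product of discrete
    spaces, which is discrete again.\<close>
  moreover have "(\<lambda>f. F {e \<in> J. f e}) \<in> PiM J (\<lambda>_. count_space UNIV) \<rightarrow>\<^sub>M N"
    by (subst count_space_PiM_finite) (use assms(1,3) in auto)
  ultimately have "(\<lambda>\<omega>. F {e \<in> J. restrict (\<lambda>e. X e \<omega>) J e}) \<in> M \<rightarrow>\<^sub>M N"
    by (rule measurable_compose)
  then show ?thesis by (simp cong: conj_cong)
qed

lemma (in prob_space) random_set_event:
  fixes X :: "'e \<Rightarrow> 'a \<Rightarrow> bool"
  assumes "indep_vars (\<lambda>_. count_space UNIV) X I" "J \<subseteq> I" "finite J"
  shows "{\<omega> \<in> space M. R {e \<in> J. X e \<omega>}} \<in> events"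
proof -
  have "(\<lambda>\<omega>. R {e \<in> J. X e \<omega>}) \<in> M \<rightarrow>\<^sub>M count_space UNIV"
    by (rule measurable_random_set) (use assms in \<open>auto simp: indep_vars_def\<close>)
  then show ?thesis by (simp add: pred_def)
qed

lemma (in prob_space) prob_indep_random_sets:
  fixes X :: "'e \<Rightarrow> 'a \<Rightarrow> bool"
  assumes ind: "indep_vars (\<lambda>_. count_space UNIV) X I"
    and AB: "finite A" "finite B" "A \<inter> B = {}" "A \<subseteq> I" "B \<subseteq> I"
  shows "prob {\<omega> \<in> space M. P {e \<in> A. X e \<omega>} \<and> Q {e \<in> B. X e \<omega>}} =
    prob {\<omega> \<in> space M. P {e \<in> A. X e \<omega>}} * prob {\<omega> \<in> space M. Q {e \<in> B. X e \<omega>}}"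
proof -
  have meas: "(\<lambda>f. R {e \<in> J. f e}) \<in> PiM J (\<lambda>_. count_space UNIV) \<rightarrow>\<^sub>M count_space UNIV"
    if "finite J" for R :: "'e set \<Rightarrow> bool" and J
    by (subst count_space_PiM_finite) (use that in auto)
  have "indep_var (count_space UNIV) ((\<lambda>f. P {e \<in> A. f e}) \<circ> (\<lambda>\<omega>. restrict (\<lambda>i. X i \<omega>) A))
    (count_space UNIV) ((\<lambda>f. Q {e \<in> B. f e}) \<circ> (\<lambda>\<omega>. restrict (\<lambda>i. X i \<omega>) B))"
    by (rule indep_var_compose[OF indep_var_restrict[OF ind AB(3-5)] meas[OF AB(1)] meas[OF AB(2)]])
  from prob_indep_random_variable[OF this, of "{True}" "{True}"]
  show ?thesis by (simp cong: conj_cong)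
qed

text \<open>Every vertex has at most \<open>n\<close> candidates \<open>w\<close> for the first step after the last exit, so the
  connection probability \<open>q\<close> satisfies \<open>q \<le> p + n p q\<close>.\<close>

lemma (in prob_space) prob_linked_le:
  fixes X :: "nat set \<Rightarrow> 'a \<Rightarrow> bool"
  assumes ind: "indep_vars (\<lambda>_. count_space UNIV) X (complete_edges n)"
    and p: "\<And>e. e \<in> complete_edges n \<Longrightarrow> prob {\<omega> \<in> space M. X e \<omega>} = p" and "0 \<le> p" "real n * p < 1"
    and V: "V \<subseteq> {1..n}" "u \<in> V" "v \<in> V" "u \<noteq> v"
  shows "prob {\<omega> \<in> space M. (u, v) \<in> linked {e \<in> complete_edges n. e \<subseteq> V \<and> X e \<omega>}} \<le> p / (1 - real n * p)"
proof -
  \<comment> \<open>\<open>b\<close> solves the recursion with equality: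
    \<open>b = p + n * p * b\<close>.\<close>
  define b where "b = p / (1 - real n * p)"
  have b: "0 \<le> b" "p + real n * p * b = b" using assms(3,4) by (auto simp: b_def field_simps)
  have meas: "{\<omega> \<in> space M. R {e \<in> J. X e \<omega>}} \<in> events" if "J \<subseteq> complete_edges n" for R J
    using ind that finite_subset[OF that finite_complete_edges] by (rule random_set_event)
  have "finite V" using V(1) by (rule finite_subset) simp
  then have "prob {\<omega> \<in> space M. (u, v) \<in> linked {e \<in> complete_edges n. e \<subseteq> V \<and> X e \<omega>}} \<le> b"
    using V
  \<comment> \<open>Induction over the vertex set, since the path after the last exit from
    \<open>u\<close> lives in \<open>V - {u}\<close>.\<close>
  proof (induction arbitrary: u rule: finite_psubset_induct)
    case (psubset V)
    let ?EV = "\<lambda>V. {e \<in> complete_edges n. e \<subseteq> V}"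
    let ?W = "V - {u, v}"
    let ?A = "\<lambda>w. {\<omega> \<in> space M. X {u, w} \<omega>}"
    let ?B = "\<lambda>w. {\<omega> \<in> space M. X {u, w} \<omega> \<and> (w, v) \<in> linked {e \<in> ?EV (V - {u}). X e \<omega>}}"
    have edge: "{u, w} \<in> complete_edges n" if "w \<in> V" "w \<noteq> u" for w
      using that psubset.prems by (auto simp: complete_edges_def)
    have Am: "?A w \<in> events" if "w \<in> V" "w \<noteq> u" for w
      using meas[of "{{u, w}}" "\<lambda>S. S \<noteq> {}"] edge[OF that] by simp
    have Bm': "{\<omega> \<in> space M. (w, v) \<in> linked {e \<in> ?EV (V - {u}). X e \<omega>}} \<in> events" for w
      using meas[of "?EV (V - {u})" "\<lambda>S. (w, v) \<in> linked S"] by auto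
    have Bm: "?B w \<in> events" if "w \<in> V" "w \<noteq> u" for w
    proof -
      have "?B w = ?A w \<inter> {\<omega> \<in> space M. (w, v) \<in> linked {e \<in> ?EV (V - {u}). X e \<omega>}}" by auto
      then show ?thesis using Am[OF that] Bm' by simp
    qed
    have Bp: "prob (?B w) \<le> p * b" if w: "w \<in> ?W" for w
    proof -
      have "prob {\<omega> \<in> space M. {e \<in> {{u, w}}. X e \<omega>} \<noteq> {} \<and> (w, v) \<in> linked {e \<in> ?EV (V - {u}). X e \<omega>}}
        = prob {\<omega> \<in> space M. {e \<in> {{u, w}}. X e \<omega>} \<noteq> {}} *
          prob {\<omega> \<in> space M. (w, v) \<in> linked {e \<in> ?EV (V - {u}). X e \<omega>}}"
        using edge[of w] w finite_complete_edges
        by (intro prob_indep_random_sets[OF ind, of "{{u, w}}" "?EV (V - {u})" "\<lambda>S. S \<noteq> {}" "\<lambda>S. (w, v) \<in> linked S"]) auto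
      moreover have "prob {\<omega> \<in> space M. (w, v) \<in> linked {e \<in> ?EV (V - {u}). X e \<omega>}} \<le> b"
        using psubset.IH[of "V - {u}" w] psubset.prems w by (auto simp: conj_assoc)
      ultimately show ?thesis using p[OF edge[of w]] w \<open>0 \<le> p\<close> by (simp add: mult_left_mono)
    qed
    have "{\<omega> \<in> space M. (u, v) \<in> linked {e \<in> complete_edges n. e \<subseteq> V \<and> X e \<omega>}} \<subseteq> ?A v \<union> (\<Union>w\<in>?W. ?B w)"
    proof
      fix \<omega> assume \<omega>: "\<omega> \<in> {\<omega> \<in> space M. (u, v) \<in> linked {e \<in> complete_edges n. e \<subseteq> V \<and> X e \<omega>}}"
      then obtain w where w: "{u, w} \<in> complete_edges n" "{u, w} \<subseteq> V" "X {u, w} \<omega>" "w \<noteq> u"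
        "(w, v) \<in> linked {e \<in> {e \<in> complete_edges n. e \<subseteq> V \<and> X e \<omega>}. u \<notin> e}"
        using linked_last_exit[of u v "{e \<in> complete_edges n. e \<subseteq> V \<and> X e \<omega>}"] psubset.prems by blast
      moreover have "{e \<in> {e \<in> complete_edges n. e \<subseteq> V \<and> X e \<omega>}. u \<notin> e} = {e \<in> ?EV (V - {u}). X e \<omega>}"
        by auto
      ultimately show "\<omega> \<in> ?A v \<union> (\<Union>w\<in>?W. ?B w)" using \<omega> by (cases "w = v") auto
    qed
    then have "prob {\<omega> \<in> space M. (u, v) \<in> linked {e \<in> complete_edges n. e \<subseteq> V \<and> X e \<omega>}} \<le> prob (?A v \<union> (\<Union>w\<in>?W. ?B w))"
      using psubset.prems psubset.hyps Am Bm by (intro finite_measure_mono sets.Un sets.finite_UN) auto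
    also have "\<dots> \<le> prob (?A v) + prob (\<Union>w\<in>?W. ?B w)"
      using psubset.prems psubset.hyps Am Bm by (intro measure_Un_le sets.finite_UN) auto
    also have "\<dots> \<le> p + (\<Sum>w\<in>?W. prob (?B w))"
      using psubset.prems psubset.hyps Bm p[OF edge[of v]]
      by (intro add_mono finite_measure_subadditive_finite) auto
    also have "(\<Sum>w\<in>?W. prob (?B w)) \<le> (\<Sum>w\<in>?W. p * b)" using Bp by (rule sum_mono)
    also have "\<dots> \<le> real n * (p * b)"
    proof -
      have "card ?W \<le> n" using card_mono[of "{1..n}" ?W] psubset.prems by auto
      then show ?thesis using \<open>0 \<le> p\<close> b by (simp add: mult_right_mono)
    qed
    finally show ?case using b(2) by (simp add: mult.assoc)
  qed
  then show ?thesis by (simp add: b_def)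
qed

text \<open>An edge is cyclic iff it is present and the other edges join its endpoints, two
  independent events. For \<open>p\<close> of order \<open>1 / n\<close> each edge is cyclic with
  probability of order \<open>1 / n^2\<close>, so the expected number over all pairs stays
  bounded.\<close>

lemma (in prob_space) expectation_cyclic_edges_le:
  fixes X :: "nat set \<Rightarrow> 'a \<Rightarrow> bool"
  assumes ind: "indep_vars (\<lambda>_. count_space UNIV) X (complete_edges n)"
    and p: "\<And>e. e \<in> complete_edges n \<Longrightarrow> prob {\<omega> \<in> space M. X e \<omega>} = p" and "0 \<le> p" "real n * p < 1"
  shows "integrable M (\<lambda>\<omega>. real (card (cyclic_edges {e \<in> complete_edges n. X e \<omega>})))"
    and "expectation (\<lambda>\<omega>. real (card (cyclic_edges {e \<in> complete_edges n. X e \<omega>})))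
      \<le> real (n choose 2) * (p * (p / (1 - real n * p)))"
proof -
  let ?I = "complete_edges n"
  let ?G = "\<lambda>\<omega>. {e \<in> ?I. X e \<omega>}"
  let ?C = "\<lambda>e. {\<omega> \<in> space M. e \<in> cyclic_edges (?G \<omega>)}"
  have Cm: "?C e \<in> events" for e
    by (rule random_set_event[OF ind order_refl finite_complete_edges, where R = "\<lambda>S. e \<in> cyclic_edges S"])
  have Cp: "prob (?C e) \<le> p * (p / (1 - real n * p))" if e: "e \<in> ?I" for e
  proof -
    obtain a b where ab: "e = {a, b}" "a \<noteq> b" "a \<in> {1..n}" "b \<in> {1..n}" using e by (rule complete_edgesE)
    let ?L = "{\<omega> \<in> space M. (a, b) \<in> linked {f \<in> ?I - {e}. X f \<omega>}}"
    let ?L' = "{\<omega> \<in> space M. (a, b) \<in> linked {e \<in> ?I. e \<subseteq> {1..n} \<and> X e \<omega>}}"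
    have mL: "?L' \<in> events"
      using random_set_event[OF ind, of "{e \<in> ?I. e \<subseteq> {1..n}}" "\<lambda>S. (a, b) \<in> linked S"]
        finite_complete_edges by (simp add: conj_assoc)
    have "?C e = {\<omega> \<in> space M. {f \<in> {e}. X f \<omega>} \<noteq> {} \<and> (a, b) \<in> linked {f \<in> ?I - {e}. X f \<omega>}}"
    proof -
      have "?G \<omega> - {e} = {f \<in> ?I - {e}. X f \<omega>}" for \<omega> by auto
      then show ?thesis
        using e ab(1) by (auto simp: cyclic_edges_def doubleton_eq_iff dest: linked_sym)
    qed
    then have "prob (?C e) = prob {\<omega> \<in> space M. {f \<in> {e}. X f \<omega>} \<noteq> {}} * prob ?L"
      using e finite_complete_edges
      by (simp only:) (intro prob_indep_random_sets[OF ind, of "{e}" "?I - {e}" "\<lambda>S. S \<noteq> {}" "\<lambda>S. (a, b) \<in> linked S"], auto)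
    also have "prob {\<omega> \<in> space M. {f \<in> {e}. X f \<omega>} \<noteq> {}} = p" using p[OF e] by simp
    \<comment> \<open>Putting \<open>e\<close> back can only help connectivity and gives the event
      the form treated in \<open>prob_linked_le\<close>.\<close>
    also have "prob ?L \<le> prob ?L'"
    proof (rule finite_measure_mono[OF _ mL])
      have "linked {f \<in> ?I - {e}. X f \<omega>} \<subseteq> linked {e \<in> ?I. e \<subseteq> {1..n} \<and> X e \<omega>}" for \<omega>
        by (rule linked_mono) (auto simp: complete_edges_def)
      then show "?L \<subseteq> ?L'" by blast
    qed
    also have "prob ?L' \<le> p / (1 - real n * p)"
      by (rule prob_linked_le[OF ind p assms(3,4)]) (use ab in auto)
    finally show ?thesis using \<open>0 \<le> p\<close> by (simp add: mult_left_mono)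
  qed
  have card: "real (card (cyclic_edges (?G \<omega>))) = (\<Sum>e\<in>?I. indicator (?C e) \<omega>)" if "\<omega> \<in> space M" for \<omega>
  proof -
    have "cyclic_edges (?G \<omega>) = {e \<in> ?I. \<omega> \<in> ?C e}" using that by (auto simp: cyclic_edges_def)
    then have "real (card (cyclic_edges (?G \<omega>))) = (\<Sum>e\<in>{e \<in> ?I. \<omega> \<in> ?C e}. 1)" by simp
    also have "\<dots> = (\<Sum>e\<in>?I. indicator (?C e) \<omega>)"
      unfolding indicator_def of_bool_def
      by (rule sum.inter_filter) (rule finite_complete_edges)
    finally show ?thesis .
  qed
  have int: "integrable M (\<lambda>\<omega>. \<Sum>e\<in>?I. indicator (?C e) \<omega> :: real)"
    using Cm by (intro Bochner_Integration.integrable_sum) (auto simp: emeasure_eq_measure)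
  then show "integrable M (\<lambda>\<omega>. real (card (cyclic_edges (?G \<omega>))))"
    by (subst Bochner_Integration.integrable_cong[OF refl card])
  have "expectation (\<lambda>\<omega>. real (card (cyclic_edges (?G \<omega>)))) = expectation (\<lambda>\<omega>. \<Sum>e\<in>?I. indicator (?C e) \<omega>)"
    by (rule Bochner_Integration.integral_cong[OF refl card])
  also have "\<dots> = (\<Sum>e\<in>?I. prob (?C e))"
    using Cm by (subst Bochner_Integration.integral_sum) (auto simp: emeasure_eq_measure Int_absorb2 intro!: sum.cong)
  also have "\<dots> \<le> (\<Sum>e\<in>?I. p * (p / (1 - real n * p)))" by (rule sum_mono) (rule Cp)
  also have "\<dots> = real (n choose 2) * (p * (p / (1 - real n * p)))"
    by (simp add: card_complete_edges)
  finally show "expectation (\<lambda>\<omega>. real (card (cyclic_edges (?G \<omega>))))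
      \<le> real (n choose 2) * (p * (p / (1 - real n * p)))" .
qed

section \<open>Chaining and moments\<close>

text \<open>Dyadic chaining for a process \<open>z = \<alpha> t - N t\<close> with \<open>N\<close> nondecreasing: monotonicity controls
  the oscillation of \<open>z\<close> below the finest level \<open>R\<close>. The bound \<open>\<bar>x\<bar> \<le> a + x^4 / a^3\<close> replaces a maximum
  over the increments of one level by a sum of fourth powers.\<close>

definition level_bound :: "real \<Rightarrow> (nat \<Rightarrow> real) \<Rightarrow> (real \<Rightarrow> real) \<Rightarrow> nat \<Rightarrow> real" where
  "level_bound c a z l =
     a l + (\<Sum>i<2 ^ l. (z (c * real (Suc i) / 2 ^ l) - z (c * real i / 2 ^ l)) ^ 4) / a l ^ 3"

lemma abs_le_fourth_power:
  fixes x a :: real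
  assumes "a > 0"
  shows "\<bar>x\<bar> \<le> a + x ^ 4 / a ^ 3"
proof (cases "\<bar>x\<bar> \<le> a")
  case True
  have "0 \<le> x ^ 4 / a ^ 3" using assms by simp
  then show ?thesis using True by linarith
next
  case False
  then have "a ^ 3 \<le> \<bar>x\<bar> ^ 3" using assms by (intro power_mono) auto
  then have "\<bar>x\<bar> * a ^ 3 \<le> \<bar>x\<bar> * \<bar>x\<bar> ^ 3" by (intro mult_left_mono) auto
  also have "\<dots> = x ^ 4" by (simp add: power_abs[symmetric] eval_nat_numeral abs_mult)
  finally have "\<bar>x\<bar> \<le> x ^ 4 / a ^ 3" using assms by (simp add: field_simps)
  then show ?thesis using assms by linarith
qed

lemma increment_le_level_bound:
  assumes "i < 2 ^ l" "a l > 0"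
  shows "\<bar>z (c * real (Suc i) / 2 ^ l) - z (c * real i / 2 ^ l)\<bar> \<le> level_bound c a z l"
proof -
  let ?d = "\<lambda>i. z (c * real (Suc i) / 2 ^ l) - z (c * real i / 2 ^ l)"
  have "(?d i) ^ 4 \<le> (\<Sum>i<2 ^ l. (?d i) ^ 4)"
    using assms by (intro member_le_sum) auto
  then have "(?d i) ^ 4 / a l ^ 3 \<le> (\<Sum>i<2 ^ l. (?d i) ^ 4) / a l ^ 3"
    using assms by (intro divide_right_mono) auto
  then show ?thesis using abs_le_fourth_power[OF assms(2), of "?d i"] unfolding level_bound_def by linarith
qed

text \<open>The grid point below \<open>t\<close> either stays the same from one level to the next
  or moves by one fine cell, so a level costs at most one of its increments. The last two terms pay
  for the way from the finest grid point to \<open>t\<close>.\<close>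

lemma chaining:
  assumes z: "\<And>t. z t = \<alpha> * t - N t" and "0 \<le> \<alpha>" and N: "mono N"
    and a: "\<And>l. a l > (0::real)" and "b \<le> R" and t: "0 \<le> t" "t \<le> c"
  shows "\<bar>z t - z (c * real (grid_index c (2 ^ b) t) / 2 ^ b)\<bar> \<le>
    (\<Sum>l\<in>{b<..R}. level_bound c a z l) + level_bound c a z R + \<alpha> * c / 2 ^ R"
proof -
  define i where "i l = grid_index c (2 ^ l) t" for l
  define p where "p l = c * real (i l) / 2 ^ l" for l
  have c: "0 \<le> c" using t by linarith
  have i_le: "i l \<le> 2 ^ l" for l unfolding i_def by (rule grid_index_le[OF t])
  have chain: "\<bar>z (p R) - z (p b)\<bar> \<le> (\<Sum>l\<in>{b<..R}. level_bound c a z l)"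
    using \<open>b \<le> R\<close>
  proof (induction R rule: dec_induct)
    case (step l)
    \<comment> \<open>The floor of \<open>2 * x\<close> is twice the floor of \<open>x\<close>, or
      one more.\<close>
    have double: "i (Suc l) = 2 * i l \<or> i (Suc l) = 2 * i l + 1"
    proof -
      define x where "x = 2 ^ l * t / c"
      have "0 \<le> x" using t c by (simp add: x_def)
      moreover have "i l = nat \<lfloor>x\<rfloor>" by (simp add: i_def grid_index_def x_def)
      moreover have "i (Suc l) = nat \<lfloor>2 * x\<rfloor>" by (simp add: i_def grid_index_def x_def mult.assoc)
      moreover have "\<lfloor>2 * x\<rfloor> = 2 * \<lfloor>x\<rfloor> \<or> \<lfloor>2 * x\<rfloor> = 2 * \<lfloor>x\<rfloor> + 1" by linarith
      ultimately show ?thesis by linarith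
    qed
    have "\<bar>z (p (Suc l)) - z (p l)\<bar> \<le> level_bound c a z (Suc l)"
    proof (cases "i (Suc l) = 2 * i l")
      case True
      then have "p (Suc l) = p l" by (simp add: p_def)
      moreover have "0 \<le> level_bound c a z (Suc l)"
        using a[of "Suc l"] unfolding level_bound_def
        by (intro add_nonneg_nonneg divide_nonneg_nonneg sum_nonneg) auto
      ultimately show ?thesis by simp
    next
      case False
      then have odd: "i (Suc l) = Suc (2 * i l)" using double by simp
      then have "2 * i l < 2 ^ Suc l" using i_le[of "Suc l"] by simp
      from increment_le_level_bound[of "2 * i l" "Suc l" a z c, OF this a]
      show ?thesis using odd by (simp add: p_def)
    qed
    moreover have "{b<..Suc l} = insert (Suc l) {b<..l}" using step.hyps by auto
    ultimately show ?case using step.IH by simp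
  qed simp
  have nn: "0 \<le> level_bound c a z R"
    using a[of R] unfolding level_bound_def
    by (intro add_nonneg_nonneg divide_nonneg_nonneg sum_nonneg) auto
  have "\<bar>z t - z (p R)\<bar> \<le> level_bound c a z R + \<alpha> * c / 2 ^ R"
  \<comment> \<open>Inside a cell, \<open>N t\<close> is squeezed between the values of
    \<open>N\<close> at its ends, so \<open>z t\<close> leaves the range of \<open>z\<close> at the
    ends by at most the drift over the cell. Index \<open>2 ^ R\<close> occurs only at
    \<open>t = c\<close>, where there is no cell to the right.\<close>
  proof (cases "i R < 2 ^ R")
    case True
    define s where "s = c * real (Suc (i R)) / 2 ^ R"
    have ts: "p R \<le> t" "t \<le> s"
      using grid_index_bounds[OF t, of "2 ^ R"] by (simp_all add: p_def s_def i_def)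
    have sp: "s - p R = c / 2 ^ R" by (simp add: s_def p_def field_simps)
    have "N (p R) \<le> N t" "N t \<le> N s" using N ts by (auto dest: monoD)
    moreover have "\<bar>z s - z (p R)\<bar> \<le> level_bound c a z R"
      unfolding s_def p_def by (rule increment_le_level_bound[OF True a])
    moreover have "\<alpha> * p R \<le> \<alpha> * t" "\<alpha> * t \<le> \<alpha> * s" using ts \<open>0 \<le> \<alpha>\<close> by (auto intro: mult_left_mono)
    moreover have "\<alpha> * c / 2 ^ R = \<alpha> * s - \<alpha> * p R"
      using sp by (metis right_diff_distrib times_divide_eq_right)
    ultimately show ?thesis using nn unfolding z by linarith
  next
    case False
    then have "i R = 2 ^ R" using i_le[of R] by simp
    then have "p R = c" by (simp add: p_def)
    moreover have "p R \<le> t" using grid_index_bounds(1)[OF t, of "2 ^ R"] by (simp add: p_def i_def)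
    ultimately have "t = p R" using t by simp
    then show ?thesis using nn \<open>0 \<le> \<alpha>\<close> c by simp
  qed
  then have "\<bar>z t - z (p b)\<bar> \<le> (\<Sum>l\<in>{b<..R}. level_bound c a z l) + level_bound c a z R + \<alpha> * c / 2 ^ R"
    using chain by linarith
  then show ?thesis by (simp add: p_def i_def)
qed

text \<open>Expanding the fourth power of \<open>Y j + S\<close>, the mixed terms of odd degree
  vanish by independence and centring. What is left is
  \<open>E Y^4 + 6 (E Y^2) (E S^2) + E S^4\<close>, and \<open>E Y^4 \<le> q\<close> because the
  variables are bounded by one.\<close>

lemma (in prob_space) fourth_moment_indep_sum:
  fixes Y :: "'i \<Rightarrow> 'a \<Rightarrow> real"
  assumes "finite I" "indep_vars (\<lambda>_. borel) Y I"
    and bdd: "\<And>i \<omega>. i \<in> I \<Longrightarrow> \<bar>Y i \<omega>\<bar> \<le> 1"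
    and mean: "\<And>i. i \<in> I \<Longrightarrow> expectation (Y i) = 0"
    and var: "\<And>i. i \<in> I \<Longrightarrow> expectation (\<lambda>\<omega>. (Y i \<omega>)\<^sup>2) \<le> q"
  shows "expectation (\<lambda>\<omega>. (\<Sum>i\<in>I. Y i \<omega>) ^ 4) \<le> real (card I) * q + 3 * (real (card I))\<^sup>2 * q\<^sup>2"
proof -
  \<comment> \<open>The expansion of the fourth moment uses mean and second moment of the partial
    sum, so the induction carries all three.\<close>
  have "expectation (\<lambda>\<omega>. \<Sum>i\<in>I. Y i \<omega>) = 0 \<and>
    expectation (\<lambda>\<omega>. (\<Sum>i\<in>I. Y i \<omega>) ^ 2) \<le> real (card I) * q \<and>
    expectation (\<lambda>\<omega>. (\<Sum>i\<in>I. Y i \<omega>) ^ 4) \<le> real (card I) * q + 3 * (real (card I))\<^sup>2 * q\<^sup>2"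
    using assms
  proof (induction I rule: finite_induct)
    case (insert j I)
    let ?S = "\<lambda>\<omega>. \<Sum>i\<in>I. Y i \<omega>"
    let ?k = "real (card I)"
    have meas: "Y i \<in> borel_measurable M" if "i \<in> insert j I" for i
      using insert.prems(1) that by (auto simp: indep_vars_def)
    have Sb: "\<bar>?S \<omega>\<bar> \<le> ?k" for \<omega>
    proof -
      have "\<bar>?S \<omega>\<bar> \<le> (\<Sum>i\<in>I. 1)"
        using insert.prems(2) by (intro order_trans[OF sum_abs] sum_mono) auto
      then show ?thesis by simp
    qed
    have Yb: "\<bar>Y j \<omega>\<bar> \<le> 1" for \<omega> using insert.prems(2) by auto
    have Sm: "?S \<in> borel_measurable M" using meas by (intro borel_measurable_sum) auto
    have Ym: "Y j \<in> borel_measurable M" using meas by auto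
    have intS: "integrable M (\<lambda>\<omega>. ?S \<omega> ^ r)" for r
      using Sb Sm by (intro integrable_const_bound[where B = "?k ^ r"]) (auto simp: power_abs intro!: AE_I2 power_mono)
    have intY: "integrable M (\<lambda>\<omega>. Y j \<omega> ^ r)" for r
      using Yb Ym by (intro integrable_const_bound[where B = "1 ^ r"]) (auto simp: power_abs power_le_one)
    have ind: "indep_var borel (Y j) borel ?S"
      using insert.hyps insert.prems(1) by (intro indep_vars_sum) auto
    have indr: "indep_var borel (\<lambda>\<omega>. Y j \<omega> ^ r) borel (\<lambda>\<omega>. ?S \<omega> ^ s)" for r s
      using indep_var_compose[OF ind, of "\<lambda>x. x ^ r" borel "\<lambda>x. x ^ s" borel] by (simp add: comp_def)
    have prod: "expectation (\<lambda>\<omega>. Y j \<omega> ^ r * ?S \<omega> ^ s) = expectation (\<lambda>\<omega>. Y j \<omega> ^ r) * expectation (\<lambda>\<omega>. ?S \<omega> ^ s)"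
      "integrable M (\<lambda>\<omega>. Y j \<omega> ^ r * ?S \<omega> ^ s)" for r s
      using indep_var_lebesgue_integral[OF indr intY intS] indep_var_integrable[OF indr intY intS] by auto
    have IH: "expectation ?S = 0" "expectation (\<lambda>\<omega>. ?S \<omega> ^ 2) \<le> ?k * q"
      "expectation (\<lambda>\<omega>. ?S \<omega> ^ 4) \<le> ?k * q + 3 * ?k\<^sup>2 * q\<^sup>2"
      using insert.IH indep_vars_subset[OF insert.prems(1), of I] insert.prems by auto
    have Y1: "expectation (Y j) = 0" and Y2: "expectation (\<lambda>\<omega>. Y j \<omega> ^ 2) \<le> q" using insert.prems by auto
    have Y4: "expectation (\<lambda>\<omega>. Y j \<omega> ^ 4) \<le> q"
    proof (rule order_trans[OF integral_mono Y2])
      show "Y j \<omega> ^ 4 \<le> Y j \<omega> ^ 2" for \<omega>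
      proof -
        have "\<bar>Y j \<omega>\<bar> ^ 4 \<le> \<bar>Y j \<omega>\<bar> ^ 2" using Yb[of \<omega>] by (intro power_decreasing) auto
        then show ?thesis by (simp add: power_even_abs)
      qed
    qed (use intY in auto)
    have S2: "0 \<le> expectation (\<lambda>\<omega>. ?S \<omega> ^ 2)" and "0 \<le> expectation (\<lambda>\<omega>. Y j \<omega> ^ 2)"
      by (rule Bochner_Integration.integral_nonneg; simp)+
    then have q: "0 \<le> q" using Y2 by linarith
    have sum: "(\<Sum>i\<in>insert j I. Y i \<omega>) = Y j \<omega> + ?S \<omega>" for \<omega> using insert.hyps by simp
    have e1: "expectation (\<lambda>\<omega>. Y j \<omega> + ?S \<omega>) = 0"
      using intY[of 1] intS[of 1] IH(1) Y1 by simp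
    have e2: "expectation (\<lambda>\<omega>. (Y j \<omega> + ?S \<omega>) ^ 2) = expectation (\<lambda>\<omega>. Y j \<omega> ^ 2) + expectation (\<lambda>\<omega>. ?S \<omega> ^ 2)"
    proof -
      have "(Y j \<omega> + ?S \<omega>) ^ 2 = Y j \<omega> ^ 2 + ?S \<omega> ^ 2 + 2 * (Y j \<omega> ^ 1 * ?S \<omega> ^ 1)" for \<omega>
        by (simp add: power2_sum)
      then have "expectation (\<lambda>\<omega>. (Y j \<omega> + ?S \<omega>) ^ 2) =
        expectation (\<lambda>\<omega>. Y j \<omega> ^ 2 + ?S \<omega> ^ 2 + 2 * (Y j \<omega> ^ 1 * ?S \<omega> ^ 1))" by (simp only:)
      also have "\<dots> = expectation (\<lambda>\<omega>. Y j \<omega> ^ 2) + expectation (\<lambda>\<omega>. ?S \<omega> ^ 2)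
          + 2 * (expectation (\<lambda>\<omega>. Y j \<omega> ^ 1) * expectation (\<lambda>\<omega>. ?S \<omega> ^ 1))"
        by (simp only: Bochner_Integration.integral_add Bochner_Integration.integrable_add
            integral_mult_right_zero integrable_mult_right intY intS prod)
      finally show ?thesis using Y1 by simp
    qed
    have e4: "expectation (\<lambda>\<omega>. (Y j \<omega> + ?S \<omega>) ^ 4) = expectation (\<lambda>\<omega>. Y j \<omega> ^ 4)
        + 6 * (expectation (\<lambda>\<omega>. Y j \<omega> ^ 2) * expectation (\<lambda>\<omega>. ?S \<omega> ^ 2)) + expectation (\<lambda>\<omega>. ?S \<omega> ^ 4)"
    proof -
      have "(Y j \<omega> + ?S \<omega>) ^ 4 = Y j \<omega> ^ 4 + 6 * (Y j \<omega> ^ 2 * ?S \<omega> ^ 2) + ?S \<omega> ^ 4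
          + (4 * (Y j \<omega> ^ 1 * ?S \<omega> ^ 3) + 4 * (Y j \<omega> ^ 3 * ?S \<omega> ^ 1))" for \<omega>
        by (simp add: eval_nat_numeral algebra_simps)
      then have "expectation (\<lambda>\<omega>. (Y j \<omega> + ?S \<omega>) ^ 4) =
        expectation (\<lambda>\<omega>. Y j \<omega> ^ 4 + 6 * (Y j \<omega> ^ 2 * ?S \<omega> ^ 2) + ?S \<omega> ^ 4
          + (4 * (Y j \<omega> ^ 1 * ?S \<omega> ^ 3) + 4 * (Y j \<omega> ^ 3 * ?S \<omega> ^ 1)))" by (simp only:)
      also have "\<dots> = expectation (\<lambda>\<omega>. Y j \<omega> ^ 4)
        + 6 * (expectation (\<lambda>\<omega>. Y j \<omega> ^ 2) * expectation (\<lambda>\<omega>. ?S \<omega> ^ 2)) + expectation (\<lambda>\<omega>. ?S \<omega> ^ 4)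
        + (4 * (expectation (\<lambda>\<omega>. Y j \<omega> ^ 1) * expectation (\<lambda>\<omega>. ?S \<omega> ^ 3))
          + 4 * (expectation (\<lambda>\<omega>. Y j \<omega> ^ 3) * expectation (\<lambda>\<omega>. ?S \<omega> ^ 1)))"
        by (simp only: Bochner_Integration.integral_add Bochner_Integration.integrable_add
            integral_mult_right_zero integrable_mult_right intY intS prod)
      finally show ?thesis using Y1 IH(1) by simp
    qed
    have "expectation (\<lambda>\<omega>. Y j \<omega> ^ 2) * expectation (\<lambda>\<omega>. ?S \<omega> ^ 2) \<le> q * (?k * q)"
      using Y2 IH(2) S2 q by (intro mult_mono) auto
    then have "expectation (\<lambda>\<omega>. (Y j \<omega> + ?S \<omega>) ^ 4) \<le> q + 6 * (q * (?k * q)) + (?k * q + 3 * ?k\<^sup>2 * q\<^sup>2)"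
      unfolding e4 using Y4 IH(3) by linarith
    also have "\<dots> \<le> (?k + 1) * q + 3 * (?k + 1)\<^sup>2 * q\<^sup>2"
      by (simp add: power2_eq_square algebra_simps)
    finally have "expectation (\<lambda>\<omega>. (Y j \<omega> + ?S \<omega>) ^ 4) \<le> (?k + 1) * q + 3 * (?k + 1)\<^sup>2 * q\<^sup>2" .
    moreover have "expectation (\<lambda>\<omega>. (Y j \<omega> + ?S \<omega>) ^ 2) \<le> (?k + 1) * q"
      unfolding e2 using Y2 IH(2) by (simp add: algebra_simps)
    moreover have "real (card (insert j I)) = ?k + 1" using insert.hyps by simp
    ultimately show ?case unfolding sum using e1 by simp
  qed simp
  then show ?thesis by blast
qed

text \<open>\<open>q n j\<close> is the chance that a clock rings in window \<open>j\<close>, and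
  \<open>1 + w n\<close> is the characteristic function of the contribution of one edge; the power
  runs over all pairs and the leading phase is the centring. Replacing \<open>1 + w n\<close> by
  \<open>exp (w n)\<close> turns the power into an exponential of
  \<open>(n choose 2) * w n\<close>.\<close>

lemma binomial_char_tendsto:
  fixes \<tau> l :: "nat \<Rightarrow> real" and k :: nat
  assumes \<tau>: "mono \<tau>" "0 \<le> \<tau> 0"
  defines "q n j \<equiv> exp (- (\<tau> j / real n)) - exp (- (\<tau> (Suc j) / real n))"
  defines "w n \<equiv> (\<Sum>j<k. of_real (q n j) * (iexp (- (l j / sqrt (real n))) - 1))"
  shows "(\<lambda>n. iexp (sqrt (real n) * (\<Sum>j<k. (\<tau> (Suc j) - \<tau> j) * l j / 2)) * (1 + w n) ^ (n choose 2))
    \<longlonglongrightarrow> exp (of_real (- (\<Sum>j<k. (\<tau> (Suc j) - \<tau> j) * (l j)\<^sup>2 / 4)))"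
proof -
  let ?b = "\<Sum>j<k. (\<tau> (Suc j) - \<tau> j) * l j / 2" and ?\<sigma> = "\<Sum>j<k. (\<tau> (Suc j) - \<tau> j) * (l j)\<^sup>2 / 4"
  let ?m = "\<lambda>n. real n * (real n - 1) / 2"
  have m: "real (n choose 2) = ?m n" for n
    by (cases n) (simp_all add: choose_two real_of_nat_div algebra_simps)
  have \<tau>S: "\<tau> j \<le> \<tau> (Suc j)" for j using \<tau>(1) by (simp add: monoD)
  have q0: "0 \<le> q n j" for n j using \<tau>S[of j] by (auto simp: q_def intro: divide_right_mono)
  have qsum: "(\<Sum>j<k. q n j) \<le> 1" for n
  proof -
    have "(\<Sum>j<k. q n j) = exp (- (\<tau> 0 / real n)) - exp (- (\<tau> k / real n))"
      unfolding q_def by (rule sum_lessThan_telescope')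
    also have "\<dots> \<le> 1" using \<tau>(2) exp_ge_zero[of "- (\<tau> k / real n)"]
      by (smt (verit) divide_nonneg_nonneg exp_le_one_iff of_nat_0_le_iff)
    finally show ?thesis .
  qed
  have Rew: "Re (w n) = (\<Sum>j<k. q n j * (cos (l j / sqrt (real n)) - 1))" for n
    by (simp add: w_def Re_exp)
  have Imw: "Im (w n) = - (\<Sum>j<k. q n j * sin (l j / sqrt (real n)))" for n
    by (simp add: w_def Im_exp sum_negf)
  \<comment> \<open>About \<open>n^2 / 2\<close> pairs, times
    \<open>(\<tau> (Suc j) - \<tau> j) / n\<close>, times \<open>- (l j)^2 / (2 * n)\<close> from
    the cosine: this is where the denominator \<open>4\<close> comes from.\<close>
  have "(\<lambda>n. ?m n * Re (w n)) \<longlonglongrightarrow> - ?\<sigma>"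
  proof -
    have "(\<lambda>n. ?m n * (q n j * (cos (l j / sqrt (real n)) - 1))) \<longlonglongrightarrow> - ((\<tau> (Suc j) - \<tau> j) * (l j)\<^sup>2 / 4)" for j
    proof -
      have "(\<lambda>n. real n * (real n - 1) / 2 * ((exp (- (a / real n)) - exp (- (b / real n))) * (cos (x / sqrt (real n)) - 1)))
        \<longlonglongrightarrow> - ((b - a) * (x * x) / 4)" for a b x :: real by real_asymp
      then show ?thesis unfolding q_def power2_eq_square .
    qed
    then have "(\<lambda>n. \<Sum>j<k. ?m n * (q n j * (cos (l j / sqrt (real n)) - 1))) \<longlonglongrightarrow> (\<Sum>j<k. - ((\<tau> (Suc j) - \<tau> j) * (l j)\<^sup>2 / 4))"
      by (intro tendsto_sum)
    then show ?thesis by (simp only: Rew sum_distrib_left[symmetric] sum_negf)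
  qed
  \<comment> \<open>The imaginary part is of order \<open>sqrt n\<close> and has to cancel against
    the centring phase.\<close>
  moreover have "(\<lambda>n. ?m n * Im (w n) + sqrt (real n) * ?b) \<longlonglongrightarrow> 0"
  proof -
    have "(\<lambda>n. sqrt (real n) * ((\<tau> (Suc j) - \<tau> j) * l j / 2) - ?m n * (q n j * sin (l j / sqrt (real n)))) \<longlonglongrightarrow> 0" for j
    proof -
      have "(\<lambda>n. sqrt (real n) * ((b - a) * x / 2) - real n * (real n - 1) / 2 * ((exp (- (a / real n)) - exp (- (b / real n))) * sin (x / sqrt (real n))))
        \<longlonglongrightarrow> 0" for a b x :: real by real_asymp
      then show ?thesis unfolding q_def .
    qed
    then have "(\<lambda>n. \<Sum>j<k. sqrt (real n) * ((\<tau> (Suc j) - \<tau> j) * l j / 2) - ?m n * (q n j * sin (l j / sqrt (real n)))) \<longlonglongrightarrow> (\<Sum>j<k. 0)"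
      by (intro tendsto_sum)
    then show ?thesis by (simp add: Imw sum_distrib_left sum_subtractf)
  qed
  ultimately have lim: "(\<lambda>n. Complex (?m n * Re (w n)) (?m n * Im (w n) + sqrt (real n) * ?b)) \<longlonglongrightarrow> Complex (- ?\<sigma>) 0"
    by (rule tendsto_Complex)
  have eq: "exp (Complex (?m n * Re (w n)) (?m n * Im (w n) + sqrt (real n) * ?b)) =
      iexp (sqrt (real n) * ?b) * exp (w n) ^ (n choose 2)" for n
  proof -
    have "Complex (?m n * Re (w n)) (?m n * Im (w n) + sqrt (real n) * ?b) =
      \<i> * of_real (sqrt (real n) * ?b) + of_nat (n choose 2) * w n"
      by (rule complex_eqI) (simp_all add: m[symmetric])
    then show ?thesis by (simp only: exp_add exp_of_nat_mult)
  qed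
  have "(\<lambda>n. iexp (sqrt (real n) * ?b) * exp (w n) ^ (n choose 2)) \<longlonglongrightarrow> exp (Complex (- ?\<sigma>) 0)"
    unfolding eq[symmetric] by (rule tendsto_exp[OF lim])
  then have main: "(\<lambda>n. iexp (sqrt (real n) * ?b) * exp (w n) ^ (n choose 2)) \<longlonglongrightarrow> exp (of_real (- ?\<sigma>))"
    by (simp only: complex_of_real_def)
  \<comment> \<open>\<open>w n\<close> is of order \<open>n^(-3/2)\<close>: a probability of order
    \<open>1 / n\<close> times a phase of order \<open>1 / sqrt n\<close>. Each factor is thus off
    by order \<open>n^-3\<close>, and all \<open>n choose 2\<close> factors together by order
    \<open>1 / n\<close>.\<close>
  define C where "C = (\<Sum>j<k. (\<tau> (Suc j) - \<tau> j) * \<bar>l j\<bar>)"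
  have wC: "norm (w n) \<le> C / (real n * sqrt (real n))" if "n > 0" for n
  proof -
    have "norm (of_real (q n j) * (iexp (- (l j / sqrt (real n))) - 1)) \<le> (\<tau> (Suc j) - \<tau> j) / real n * (\<bar>l j\<bar> / sqrt (real n))" for j
    proof -
      have "q n j \<le> (\<tau> (Suc j) - \<tau> j) / real n"
      proof -
        define x where "x = \<tau> j / real n"
        define y where "y = (\<tau> (Suc j) - \<tau> j) / real n"
        have "0 \<le> x" using \<tau> monoD[OF \<tau>(1), of 0 j] by (simp add: x_def)
        have "q n j = exp (- x) * (1 - exp (- y))"
          using that by (simp add: q_def x_def y_def right_diff_distrib exp_add[symmetric] diff_divide_distrib)
        also have "\<dots> \<le> 1 * y"
          using \<open>0 \<le> x\<close> exp_ge_add_one_self[of "- y"] \<tau>S[of j] by (intro mult_mono) (auto simp: y_def divide_nonneg_nonneg)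
        finally show ?thesis by (simp add: y_def)
      qed
      moreover have "norm (iexp (- (l j / sqrt (real n))) - 1) \<le> \<bar>l j\<bar> / sqrt (real n)"
        using iexp_approx1[of "- (l j / sqrt (real n))" 0] by simp
      ultimately show ?thesis unfolding norm_mult using q0 \<tau>S[of j] by (intro mult_mono) auto
    qed
    then have "norm (w n) \<le> (\<Sum>j<k. (\<tau> (Suc j) - \<tau> j) / real n * (\<bar>l j\<bar> / sqrt (real n)))"
      unfolding w_def by (intro sum_norm_le)
    also have "\<dots> = C / (real n * sqrt (real n))" unfolding C_def sum_divide_distrib by simp
    finally show ?thesis .
  qed
  \<comment> \<open>A convex combination of numbers of modulus one. With both bases in the unit
    disc, the difference of powers is at most the exponent times the difference of bases.\<close>
  have norm1: "norm (1 + w n) \<le> 1" for n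
  proof -
    have "1 + w n = of_real (1 - (\<Sum>j<k. q n j)) + (\<Sum>j<k. of_real (q n j) * iexp (- (l j / sqrt (real n))))"
      by (simp add: w_def right_diff_distrib sum_subtractf)
    also have "norm \<dots> \<le> norm (of_real (1 - (\<Sum>j<k. q n j)) :: complex) + norm (\<Sum>j<k. of_real (q n j) * iexp (- (l j / sqrt (real n))))"
      by (rule norm_triangle_ineq)
    also have "\<dots> \<le> (1 - (\<Sum>j<k. q n j)) + (\<Sum>j<k. q n j)"
      using qsum[of n] q0[of n] by (intro add_mono sum_norm_le) (auto simp: norm_mult norm_of_real simp del: of_real_diff of_real_sum)
    finally show ?thesis by simp
  qed
  have Re0: "Re (w n) \<le> 0" for n
    unfolding Rew using q0 by (intro sum_nonpos mult_nonneg_nonpos) auto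
  have lim2: "(\<lambda>n. 3 * C\<^sup>2 / real n) \<longlonglongrightarrow> 0" by real_asymp
  have "eventually (\<lambda>n. C / (real n * sqrt (real n)) < 1) sequentially"
    by (rule order_tendstoD(2)[of _ 0]) (real_asymp, simp)
  then have "eventually (\<lambda>n. norm (iexp (sqrt (real n) * ?b) * (1 + w n) ^ (n choose 2) - iexp (sqrt (real n) * ?b) * exp (w n) ^ (n choose 2))
      \<le> 3 * C\<^sup>2 / real n) sequentially"
    using eventually_gt_at_top[of 0]
  proof eventually_elim
    case (elim n)
    have w1: "norm (w n) \<le> 1" using wC[of n] elim by linarith
    have "norm (exp (w n) - (\<Sum>i\<le>1. w n ^ i / fact i)) \<le> exp \<bar>Re (w n)\<bar> * norm (w n) ^ Suc 1 / fact 1"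
      by (rule Taylor_exp)
    then have "norm (exp (w n) - (1 + w n)) \<le> exp \<bar>Re (w n)\<bar> * (norm (w n))\<^sup>2"
      by (simp add: numeral_2_eq_2)
    also have "\<dots> \<le> 3 * (norm (w n))\<^sup>2"
    proof -
      have "\<bar>Re (w n)\<bar> \<le> 1" using abs_Re_le_cmod[of "w n"] w1 by linarith
      then have "exp \<bar>Re (w n)\<bar> \<le> exp 1" by simp
      also have "\<dots> \<le> (3::real)" using exp_le by simp
      finally show ?thesis by (intro mult_right_mono) auto
    qed
    finally have T: "norm ((1 + w n) - exp (w n)) \<le> 3 * (norm (w n))\<^sup>2" by (simp add: norm_minus_commute)
    have "norm (iexp (sqrt (real n) * ?b) * (1 + w n) ^ (n choose 2) - iexp (sqrt (real n) * ?b) * exp (w n) ^ (n choose 2))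
      = norm ((1 + w n) ^ (n choose 2) - exp (w n) ^ (n choose 2))"
      by (subst right_diff_distrib[symmetric]) (simp only: norm_mult norm_exp_i_times mult_1_left)
    also have "\<dots> \<le> real (n choose 2) * norm ((1 + w n) - exp (w n))"
      using Re0 by (intro norm_power_diff norm1) simp
    also have "\<dots> \<le> (real n)\<^sup>2 * (3 * (C / (real n * sqrt (real n)))\<^sup>2)"
    proof (intro mult_mono)
      show "real (n choose 2) \<le> (real n)\<^sup>2" unfolding m by (simp add: power2_eq_square field_simps)
      show "norm ((1 + w n) - exp (w n)) \<le> 3 * (C / (real n * sqrt (real n)))\<^sup>2"
        using wC[of n] elim by (intro order_trans[OF T] mult_left_mono power_mono) auto
    qed auto
    also have "\<dots> = 3 * C\<^sup>2 / real n" using elim by (simp add: power_divide power_mult_distrib power2_eq_square)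
    finally show ?case .
  qed
  then have "(\<lambda>n. iexp (sqrt (real n) * ?b) * (1 + w n) ^ (n choose 2) - iexp (sqrt (real n) * ?b) * exp (w n) ^ (n choose 2)) \<longlonglongrightarrow> 0"
    by (rule Lim_null_comparison[OF _ lim2])
  from tendsto_add[OF this main] show ?thesis by simp
qed

section \<open>The edge counting process\<close>

lemma diff_power4_le: "(a - b) ^ 4 \<le> 8 * (a ^ 4 + b ^ 4)" for a b :: real
proof -
  have "(a - b)\<^sup>2 = 2 * (a\<^sup>2 + b\<^sup>2) - (a + b)\<^sup>2" by algebra
  then have "(a - b)\<^sup>2 \<le> 2 * (a\<^sup>2 + b\<^sup>2)" using zero_le_power2[of "a + b"] by linarith
  then have "((a - b)\<^sup>2)\<^sup>2 \<le> (2 * (a\<^sup>2 + b\<^sup>2))\<^sup>2" by (intro power_mono) auto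
  moreover have "(2 * (a\<^sup>2 + b\<^sup>2))\<^sup>2 = 8 * (a ^ 4 + b ^ 4) - 4 * (a\<^sup>2 - b\<^sup>2)\<^sup>2" by algebra
  moreover have "((a - b)\<^sup>2)\<^sup>2 = (a - b) ^ 4" by algebra
  ultimately show ?thesis using zero_le_power2[of "a\<^sup>2 - b\<^sup>2"] by linarith
qed

locale edge_clocks = prob_space M for M :: "'a measure" +
  fixes n :: nat and T :: "nat set \<Rightarrow> 'a \<Rightarrow> real"
  assumes indep: "indep_vars (\<lambda>_. borel) T (complete_edges n)"
    and exponential: "\<And>e. e \<in> complete_edges n \<Longrightarrow> distributed M lborel (T e) (exponential_density 1)"
begin

definition graph :: "real \<Rightarrow> 'a \<Rightarrow> nat set set" where
  "graph t \<omega> = {e \<in> complete_edges n. T e \<omega> \<le> t / real n}"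

definition edge_count :: "real \<Rightarrow> 'a \<Rightarrow> real" where
  "edge_count t \<omega> = real (card (graph t \<omega>))"

text \<open>The scaled component count with \<open>real n - edge_count\<close> in place of the
  number of components. Its sign gives a linear drift minus a nondecreasing process, the shape that
  \<open>chaining\<close> expects.\<close>

definition fluct :: "real \<Rightarrow> 'a \<Rightarrow> real" where
  "fluct t \<omega> = (real n * t / 2 - edge_count t \<omega>) / sqrt (real n)"

definition window :: "real \<Rightarrow> real \<Rightarrow> nat set \<Rightarrow> 'a \<Rightarrow> real" where
  "window s t e \<omega> = of_bool (s / real n < T e \<omega> \<and> T e \<omega> \<le> t / real n)"

definition window_prob :: "real \<Rightarrow> real \<Rightarrow> real" where
  "window_prob s t = exp (- (s / real n)) - exp (- (t / real n))"

lemma T_measurable: "e \<in> complete_edges n \<Longrightarrow> T e \<in> borel_measurable M"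
  using indep by (auto simp: indep_vars_def)

lemma finite_graph: "finite (graph t \<omega>)"
  using finite_complete_edges by (simp add: graph_def)

lemma graph_mono:
  assumes "s \<le> t"
  shows "graph s \<omega> \<subseteq> graph t \<omega>"
proof -
  have "s / real n \<le> t / real n" using assms by (intro divide_right_mono) auto
  then show ?thesis by (auto simp: graph_def)
qed

lemma edge_count_mono: "s \<le> t \<Longrightarrow> edge_count s \<omega> \<le> edge_count t \<omega>"
  unfolding edge_count_def by (simp add: card_mono finite_graph graph_mono)

lemma measurable_graph: "(\<And>S. F S \<in> space N) \<Longrightarrow> (\<lambda>\<omega>. F (graph t \<omega>)) \<in> M \<rightarrow>\<^sub>M N"
  unfolding graph_def
  by (rule measurable_random_set[OF finite_complete_edges]) (use T_measurable in measurable)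

lemma edge_count_measurable: "edge_count t \<in> borel_measurable M"
  unfolding edge_count_def by (rule measurable_graph) simp

lemma fluct_measurable: "fluct t \<in> borel_measurable M"
  unfolding fluct_def using edge_count_measurable by (intro borel_measurable_divide borel_measurable_diff) auto

lemma edge_count_diff:
  assumes "s \<le> t"
  shows "edge_count t \<omega> - edge_count s \<omega> = (\<Sum>e\<in>complete_edges n. window s t e \<omega>)"
proof -
  have count: "edge_count u \<omega> = (\<Sum>e\<in>complete_edges n. of_bool (T e \<omega> \<le> u / real n))" for u
    unfolding edge_count_def graph_def of_bool_def
    by (subst sum.inter_filter[OF finite_complete_edges, symmetric]) simp
  have "s / real n \<le> t / real n" using assms by (intro divide_right_mono) auto
  then have "of_bool (T e \<omega> \<le> t / real n) - of_bool (T e \<omega> \<le> s / real n) = window s t e \<omega>" for e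
    by (auto simp: window_def)
  then show ?thesis unfolding count sum_subtractf[symmetric] by simp
qed

lemma fluct_diff:
  assumes "s \<le> t"
  shows "fluct t \<omega> - fluct s \<omega> =
    (real n * (t - s) / 2 - (\<Sum>e\<in>complete_edges n. window s t e \<omega>)) / sqrt (real n)"
  unfolding edge_count_diff[OF assms, symmetric] fluct_def
  by (simp add: diff_divide_distrib[symmetric] algebra_simps)

lemma prob_clock_le:
  assumes "e \<in> complete_edges n" "0 \<le> u"
  shows "prob {\<omega> \<in> space M. T e \<omega> \<le> u} = 1 - exp (- u)"
  using exponential_distributedD_le[OF exponential[OF assms(1)] assms(2)] by simp

lemma window_measurable: "e \<in> complete_edges n \<Longrightarrow> window s t e \<in> borel_measurable M"
  unfolding window_def using T_measurable by measurable

lemma expectation_window: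
  assumes e: "e \<in> complete_edges n" and st: "0 \<le> s" "s \<le> t"
  shows "expectation (window s t e) = window_prob s t"
proof -
  have ev: "{\<omega> \<in> space M. T e \<omega> \<le> u} \<in> events" for u
    using T_measurable[OF e] by measurable
  have le: "s / real n \<le> t / real n" using st by (intro divide_right_mono) auto
  have "expectation (window s t e) =
      expectation (\<lambda>\<omega>. indicator {\<omega> \<in> space M. T e \<omega> \<le> t / real n} \<omega> - indicator {\<omega> \<in> space M. T e \<omega> \<le> s / real n} \<omega>)"
    by (rule Bochner_Integration.integral_cong) (use le in \<open>auto simp: window_def indicator_def\<close>)
  also have "\<dots> = prob {\<omega> \<in> space M. T e \<omega> \<le> t / real n} - prob {\<omega> \<in> space M. T e \<omega> \<le> s / real n}"
    using ev by (subst Bochner_Integration.integral_diff) (auto simp: emeasure_eq_measure Int_absorb2)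
  also have "\<dots> = window_prob s t"
    using st by (simp add: prob_clock_le[OF e] window_prob_def)
  finally show ?thesis .
qed

text \<open>The relative error \<open>t / n\<close> of the lower bound is what keeps the bias
  bounded: summed over all pairs, the deviation from the centring \<open>n * t / 2\<close> is of
  order \<open>t - s\<close>.\<close>

lemma window_prob_bounds:
  assumes n: "n > 0" and st: "0 \<le> s" "s \<le> t"
  shows "window_prob s t \<le> (t - s) / real n" "(t - s) / real n * (1 - t / real n) \<le> window_prob s t"
    "0 \<le> window_prob s t"
proof -
  define x y where "x = s / real n" and "y = (t - s) / real n"
  have xy: "0 \<le> x" "0 \<le> y" "x + y = t / real n"
    using st n by (auto simp: x_def y_def diff_divide_distrib intro: divide_right_mono)
  have q: "window_prob s t = exp (- x) * (1 - exp (- y))" "window_prob s t = exp (- (x + y)) * (exp y - 1)"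
    unfolding window_prob_def xy(3)[symmetric] x_def[symmetric]
    by (simp_all add: right_diff_distrib exp_add[symmetric])
  have "exp (- x) * (1 - exp (- y)) \<le> 1 * y"
    using xy exp_ge_add_one_self[of "- y"] by (intro mult_mono) auto
  then show "window_prob s t \<le> (t - s) / real n" by (simp add: q(1) y_def)
  have "(1 - (x + y)) * y \<le> exp (- (x + y)) * y"
    using xy exp_ge_add_one_self[of "- (x + y)"] by (intro mult_right_mono) auto
  also have "\<dots> \<le> exp (- (x + y)) * (exp y - 1)"
  proof (rule mult_left_mono)
    show "y \<le> exp y - 1" using exp_ge_add_one_self[of y] by linarith
  qed simp
  finally have "(1 - (x + y)) * y \<le> window_prob s t" unfolding q(2) .
  then have "(1 - t / real n) * y \<le> window_prob s t" unfolding xy(3) .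
  then show "(t - s) / real n * (1 - t / real n) \<le> window_prob s t"
    by (simp add: y_def mult.commute)
  show "0 \<le> window_prob s t" unfolding q(1) using xy by auto
qed

text \<open>The increment is \<open>(\<beta> - S) / sqrt n\<close> with \<open>S\<close> a centred
  sum over all pairs. In the fourth moment of \<open>S\<close>, of size
  \<open>n h + (n h)^2\<close>, the quadratic part yields \<open>(t - s)^2\<close> and the linear
  part, due to single edges, yields \<open>(t - s) / n\<close>.\<close>

lemma fluct_increment_moment:
  assumes n: "n > 0" and st: "0 \<le> s" "s \<le> t" "t \<le> 1"
  shows "integrable M (\<lambda>\<omega>. (fluct t \<omega> - fluct s \<omega>) ^ 4)"
    and "expectation (\<lambda>\<omega>. (fluct t \<omega> - fluct s \<omega>) ^ 4) \<le> 16 * ((t - s)\<^sup>2 + (t - s) / real n)"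
proof -
  let ?I = "complete_edges n"
  let ?q = "window_prob s t"
  define h where "h = t - s"
  define m where "m = real (n choose 2)"
  \<comment> \<open>The deterministic bias: the centring \<open>n * t / 2\<close> is the limiting,
    not the exact, mean of the edge count.\<close>
  define \<beta> where "\<beta> = real n * h / 2 - m * ?q"
  define Y where "Y e \<omega> = window s t e \<omega> - ?q" for e \<omega>
  define S where "S \<omega> = (\<Sum>e\<in>?I. Y e \<omega>)" for \<omega>
  have h: "0 \<le> h" "h \<le> 1" using st by (auto simp: h_def)
  have m: "m = real n * (real n - 1) / 2"
    by (cases n) (simp_all add: m_def choose_two real_of_nat_div algebra_simps)
  have n1: "1 \<le> real n" using n by simp
  note q = window_prob_bounds[OF n st(1,2), folded h_def]
  have m0: "0 \<le> m" by (simp add: m_def)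
  have mq: "m * ?q \<le> real n * h / 2"
  proof -
    have "m * ?q \<le> m * (h / real n)" using q(1) m0 by (rule mult_left_mono)
    also have "\<dots> = (real n - 1) * h / 2" using n by (simp add: m field_simps)
    also have "\<dots> \<le> real n * h / 2" using h by (simp add: mult_right_mono)
    finally show ?thesis .
  qed
  \<comment> \<open>\<open>t \<le> 1\<close> reduces the lower bound for the mean to
    \<open>h / 2 * (n - 1)^2 / n\<close>, which is at least \<open>h / 2 * (n - 2)\<close>.\<close>
  have \<beta>: "\<bar>\<beta>\<bar> \<le> h"
  proof -
    have "(real n - 2) * h / 2 \<le> m * (h / real n * (1 - 1 / real n))"
    proof -
      have "m * (h / real n * (1 - 1 / real n)) = h / 2 * ((real n - 1)\<^sup>2 / real n)"
        using n by (simp add: m field_simps power2_eq_square)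
      moreover have "real n - 2 \<le> (real n - 1)\<^sup>2 / real n"
        using n by (simp add: field_simps power2_eq_square)
      ultimately show ?thesis using h mult_left_mono[of "real n - 2" "(real n - 1)\<^sup>2 / real n" "h / 2"]
        by (simp add: mult.commute)
    qed
    also have "\<dots> \<le> m * (h / real n * (1 - t / real n))"
      using m0 h st(3) by (intro mult_left_mono diff_mono divide_right_mono) auto
    also have "\<dots> \<le> m * ?q" using q(2) m0 by (rule mult_left_mono)
    finally have "\<beta> \<le> h" by (simp add: \<beta>_def field_simps)
    then show ?thesis using mq h by (simp add: \<beta>_def)
  qed
  have D: "(fluct t \<omega> - fluct s \<omega>) ^ 4 = (\<beta> - S \<omega>) ^ 4 / (real n)\<^sup>2" for \<omega>
  proof -
    have "S \<omega> = (\<Sum>e\<in>?I. window s t e \<omega>) - m * ?q"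
      by (simp add: S_def Y_def sum_subtractf card_complete_edges m_def)
    then have "fluct t \<omega> - fluct s \<omega> = (\<beta> - S \<omega>) / sqrt (real n)"
      by (simp add: fluct_diff[OF st(2)] \<beta>_def h_def)
    moreover have "sqrt (real n) ^ 4 = (real n)\<^sup>2"
      using power_mult[of "sqrt (real n)" 2 2] by simp
    ultimately show ?thesis by (simp add: power_divide)
  qed
  have win01: "0 \<le> window s t e \<omega>" "window s t e \<omega> \<le> 1" for e \<omega> by (auto simp: window_def)
  have q1: "?q \<le> 1"
    using st by (simp add: window_prob_def) (smt (verit) divide_nonneg_nonneg exp_ge_zero exp_le_one_iff of_nat_0_le_iff)
  have Yb: "\<bar>Y e \<omega>\<bar> \<le> 1" for e \<omega>
    using win01[of e \<omega>] q1 q(3) unfolding Y_def by linarith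
  have Ym: "Y e \<in> borel_measurable M" if "e \<in> ?I" for e
    unfolding Y_def using window_measurable[OF that, of s t] by (intro borel_measurable_diff) auto
  have winint: "integrable M (window s t e)" if "e \<in> ?I" for e
    using window_measurable[OF that] win01 by (intro integrable_const_bound[where B = 1]) auto
  have Y4: "expectation (\<lambda>\<omega>. S \<omega> ^ 4) \<le> real (card ?I) * ?q + 3 * (real (card ?I))\<^sup>2 * ?q\<^sup>2"
    unfolding S_def
  proof (rule fourth_moment_indep_sum[OF finite_complete_edges])
    have "Y = (\<lambda>e. (\<lambda>x. of_bool (s / real n < x \<and> x \<le> t / real n) - ?q) \<circ> T e)"
      by (auto simp: Y_def window_def fun_eq_iff)
    then show "indep_vars (\<lambda>_. borel) Y ?I"
      using indep_vars_compose[OF indep, of "\<lambda>_ x. of_bool (s / real n < x \<and> x \<le> t / real n) - ?q" "\<lambda>_. borel"]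
      by simp
    show "\<bar>Y e \<omega>\<bar> \<le> 1" for e \<omega> by (rule Yb)
    show "expectation (Y e) = 0" if "e \<in> ?I" for e
      unfolding Y_def using winint[OF that] expectation_window[OF that st(1,2)] by (simp add: prob_space)
    show "expectation (\<lambda>\<omega>. (Y e \<omega>)\<^sup>2) \<le> ?q" if "e \<in> ?I" for e
    proof -
      have "(Y e \<omega>)\<^sup>2 = window s t e \<omega> * (1 - 2 * ?q) + ?q\<^sup>2" for \<omega>
        by (simp add: Y_def window_def power2_eq_square algebra_simps)
      then have "expectation (\<lambda>\<omega>. (Y e \<omega>)\<^sup>2) = ?q * (1 - 2 * ?q) + ?q\<^sup>2"
        using winint[OF that] expectation_window[OF that st(1,2)] by (simp add: prob_space)
      also have "\<dots> = ?q - ?q\<^sup>2" by (simp add: power2_eq_square algebra_simps)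
      also have "\<dots> \<le> ?q" by simp
      finally show ?thesis .
    qed
  qed
  have Sm: "S \<in> borel_measurable M" unfolding S_def using Ym by (intro borel_measurable_sum) auto
  have Sb: "\<bar>S \<omega>\<bar> \<le> real (card ?I)" for \<omega>
  proof -
    have "\<bar>S \<omega>\<bar> \<le> (\<Sum>e\<in>?I. 1)"
      unfolding S_def by (intro order_trans[OF sum_abs] sum_mono Yb)
    then show ?thesis by simp
  qed
  have S4: "integrable M (\<lambda>\<omega>. S \<omega> ^ 4)"
  proof (rule integrable_const_bound[where B = "real (card ?I) ^ 4"], rule AE_I2)
    show "norm (S \<omega> ^ 4) \<le> real (card ?I) ^ 4" for \<omega>
      using Sb[of \<omega>] unfolding real_norm_def power_abs by (intro power_mono) auto
  qed (use Sm in measurable)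
  have meas: "(\<lambda>\<omega>. (\<beta> - S \<omega>) ^ 4 / (real n)\<^sup>2) \<in> borel_measurable M" using Sm by measurable
  have dom: "integrable M (\<lambda>\<omega>. 8 * (\<beta> ^ 4 + S \<omega> ^ 4) / (real n)\<^sup>2)" using S4 by auto
  have le: "(\<beta> - S \<omega>) ^ 4 / (real n)\<^sup>2 \<le> 8 * (\<beta> ^ 4 + S \<omega> ^ 4) / (real n)\<^sup>2" for \<omega>
    by (intro divide_right_mono diff_power4_le) simp
  have int: "integrable M (\<lambda>\<omega>. (\<beta> - S \<omega>) ^ 4 / (real n)\<^sup>2)"
  proof (rule Bochner_Integration.integrable_bound[OF dom meas], rule AE_I2)
    fix \<omega>
    have "0 \<le> (\<beta> - S \<omega>) ^ 4 / (real n)\<^sup>2" by simp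
    then show "norm ((\<beta> - S \<omega>) ^ 4 / (real n)\<^sup>2) \<le> norm (8 * (\<beta> ^ 4 + S \<omega> ^ 4) / (real n)\<^sup>2)"
      using le[of \<omega>] unfolding real_norm_def by linarith
  qed
  then show "integrable M (\<lambda>\<omega>. (fluct t \<omega> - fluct s \<omega>) ^ 4)" unfolding D .
  have "expectation (\<lambda>\<omega>. (\<beta> - S \<omega>) ^ 4 / (real n)\<^sup>2) \<le> expectation (\<lambda>\<omega>. 8 * (\<beta> ^ 4 + S \<omega> ^ 4) / (real n)\<^sup>2)"
    by (rule integral_mono[OF int dom le])
  also have "\<dots> = 8 * (\<beta> ^ 4 + expectation (\<lambda>\<omega>. S \<omega> ^ 4)) / (real n)\<^sup>2"
    using S4 by (simp add: prob_space)
  also have "\<dots> \<le> 8 * (2 * (real n * h) + (real n * h)\<^sup>2) / (real n)\<^sup>2"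
  proof (intro divide_right_mono mult_left_mono)
    have "\<beta> ^ 4 \<le> h"
    proof -
      have "\<bar>\<beta>\<bar> ^ 4 \<le> h ^ 4" using \<beta> by (intro power_mono) auto
      also have "\<dots> \<le> h ^ 1" using h by (intro power_decreasing) auto
      finally show ?thesis by simp
    qed
    also have "h \<le> real n * h" using n1 h mult_right_mono[of 1 "real n" h] by simp
    finally have b: "\<beta> ^ 4 \<le> real n * h" .
    have "(m * ?q)\<^sup>2 \<le> (real n * h / 2)\<^sup>2" using mq m0 q(3) by (intro power_mono) auto
    then have "(m * ?q)\<^sup>2 \<le> (real n * h)\<^sup>2 / 4" by (simp add: power_divide)
    then have "3 * (m * ?q)\<^sup>2 \<le> (real n * h)\<^sup>2" using zero_le_power2[of "real n * h"] by linarith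
    moreover have "expectation (\<lambda>\<omega>. S \<omega> ^ 4) \<le> m * ?q + 3 * (m * ?q)\<^sup>2"
    proof -
      have "real (card ?I) = m" by (simp add: card_complete_edges m_def)
      then show ?thesis using Y4 by (simp only: power_mult_distrib mult.assoc)
    qed
    moreover have "0 \<le> real n * h" using h by simp
    ultimately show "\<beta> ^ 4 + expectation (\<lambda>\<omega>. S \<omega> ^ 4) \<le> 2 * (real n * h) + (real n * h)\<^sup>2"
      using b mq by linarith
  qed auto
  also have "\<dots> = 16 * (h / real n) + 8 * h\<^sup>2"
  proof -
    have "real n * h / (real n)\<^sup>2 = h / real n" using n by (simp add: power2_eq_square)
    moreover have "(real n * h)\<^sup>2 / (real n)\<^sup>2 = h\<^sup>2" using n by (simp add: power_mult_distrib)
    ultimately show ?thesis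
      unfolding times_divide_eq_right[symmetric] add_divide_distrib by (simp only: times_divide_eq_right[symmetric] mult.left_commute distrib_left)
  qed
  also have "\<dots> \<le> 16 * (h\<^sup>2 + h / real n)" using zero_le_power2[of h] by (simp add: distrib_left)
  finally show "expectation (\<lambda>\<omega>. (fluct t \<omega> - fluct s \<omega>) ^ 4) \<le> 16 * ((t - s)\<^sup>2 + (t - s) / real n)"
    unfolding D h_def .
qed

end

text \<open>Balances the two terms of \<open>level_bound\<close>: with thresholds
  \<open>r^l\<close>, the fourth powers of one level sum to order \<open>2^-l\<close>, and
  \<open>2^-l / r^(3 l)\<close> equals \<open>r^l\<close> exactly when
  \<open>r^4 = 1 / 2\<close>.\<close>

definition chain_rate :: real where "chain_rate = root 4 (1 / 2)"

lemma chain_rate: "0 < chain_rate" "chain_rate < 1" "chain_rate ^ 4 = 1 / 2"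
  by (simp_all add: chain_rate_def real_root_pow_pos2)

text \<open>\<open>33\<close> is the constant of one level, one for the threshold and
  \<open>32\<close> for the fourth powers. The fraction sums the geometric series over the levels,
  and the added \<open>1\<close> pays for the second use of the finest level.\<close>

definition chain_const :: real where "chain_const = 33 * (1 / (1 - chain_rate) + 1)"

section \<open>Chaining and characteristic functions for the edge fluctuations\<close>

context edge_clocks begin

text \<open>The condition \<open>2 ^ l \<le> n\<close> makes the term \<open>h / n\<close> at most
  \<open>4^-l\<close>, like \<open>h^2\<close>. Each fourth moment is then at most
  \<open>32 * 4^-l\<close>, and there are \<open>2 ^ l\<close> of them.\<close>

lemma expectation_level_bound:
  assumes c: "0 \<le> c" "c \<le> 1" and l: "2 ^ l \<le> n"
  shows "integrable M (\<lambda>\<omega>. level_bound c (\<lambda>l. chain_rate ^ l) (\<lambda>t. fluct t \<omega>) l)"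
    and "expectation (\<lambda>\<omega>. level_bound c (\<lambda>l. chain_rate ^ l) (\<lambda>t. fluct t \<omega>) l) \<le> 33 * chain_rate ^ l"
proof -
  have n: "n > 0" using l by (metis gr0I le_zero_eq power_not_zero zero_neq_numeral)
  define t where "t i = c * real i / 2 ^ l" for i
  have h: "t (Suc i) - t i = c / 2 ^ l" for i by (simp add: t_def field_simps)
  have ti: "0 \<le> t i" "t i \<le> t (Suc i)" for i
    using c h[of i] by (simp_all add: t_def divide_right_mono mult_left_mono)
  have t1: "t (Suc i) \<le> 1" if "i < 2 ^ l" for i
  proof -
    have "real (Suc i) \<le> 2 ^ l" using that by (metis Suc_leI of_nat_le_iff of_nat_numeral of_nat_power)
    then have "c * real (Suc i) \<le> 1 * 2 ^ l" using c by (intro mult_mono) auto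
    then show ?thesis by (simp add: t_def field_simps)
  qed
  let ?D = "\<lambda>i \<omega>. (fluct (t (Suc i)) \<omega> - fluct (t i) \<omega>) ^ 4"
  have Dint: "integrable M (?D i)" if "i < 2 ^ l" for i
    by (rule fluct_increment_moment(1)[OF n ti t1[OF that]])
  have DE: "expectation (?D i) \<le> 32 * ((1 / 2) ^ l)\<^sup>2" if "i < 2 ^ l" for i
  proof -
    have "expectation (?D i) \<le> 16 * ((c / 2 ^ l)\<^sup>2 + (c / 2 ^ l) / real n)"
      using fluct_increment_moment(2)[OF n ti t1[OF that]] by (simp add: h)
    also have "\<dots> \<le> 16 * (((1 / 2) ^ l)\<^sup>2 + ((1 / 2) ^ l)\<^sup>2)"
    proof (intro mult_left_mono add_mono)
      have c2: "c / 2 ^ l \<le> (1 / 2) ^ l" using c by (simp add: power_one_over divide_right_mono)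
      then show "(c / 2 ^ l)\<^sup>2 \<le> ((1 / 2) ^ l)\<^sup>2" using c by (intro power_mono) auto
      have "2 ^ l \<le> real n" using l by (metis of_nat_le_iff of_nat_numeral of_nat_power)
      then have "1 / real n \<le> (1 / 2) ^ l" by (simp add: power_one_over frac_le)
      then have "c / 2 ^ l * (1 / real n) \<le> (1 / 2) ^ l * (1 / 2) ^ l"
        using c2 c by (intro mult_mono) auto
      then show "c / 2 ^ l / real n \<le> ((1 / 2) ^ l)\<^sup>2" by (simp add: power2_eq_square)
    qed auto
    finally show ?thesis by simp
  qed
  have eq: "level_bound c (\<lambda>l. chain_rate ^ l) (\<lambda>t. fluct t \<omega>) l =
      chain_rate ^ l + (\<Sum>i<2 ^ l. ?D i \<omega>) / (chain_rate ^ l) ^ 3" for \<omega>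
    by (simp add: level_bound_def t_def)
  have sint: "integrable M (\<lambda>\<omega>. \<Sum>i<2 ^ l. ?D i \<omega>)"
    using Dint by (intro Bochner_Integration.integrable_sum) auto
  then show "integrable M (\<lambda>\<omega>. level_bound c (\<lambda>l. chain_rate ^ l) (\<lambda>t. fluct t \<omega>) l)"
    unfolding eq by simp
  have "expectation (\<lambda>\<omega>. level_bound c (\<lambda>l. chain_rate ^ l) (\<lambda>t. fluct t \<omega>) l)
    = chain_rate ^ l + (\<Sum>i<2 ^ l. expectation (?D i)) / (chain_rate ^ l) ^ 3"
    unfolding eq using sint Dint by (simp add: prob_space)
  also have "\<dots> \<le> chain_rate ^ l + (\<Sum>i<(2::nat) ^ l. 32 * ((1 / 2) ^ l)\<^sup>2) / (chain_rate ^ l) ^ 3"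
    using DE chain_rate(1) by (intro add_left_mono divide_right_mono sum_mono) auto
  also have "(\<Sum>i<(2::nat) ^ l. 32 * ((1 / 2) ^ l)\<^sup>2) = 32 * (chain_rate ^ l) ^ 4"
  proof -
    have "(chain_rate ^ l) ^ 4 = (1 / 2) ^ l"
      unfolding chain_rate(3)[symmetric] by (simp add: power_mult[symmetric] mult.commute)
    then show ?thesis by (simp add: power_one_over power2_eq_square)
  qed
  also have "chain_rate ^ l + 32 * (chain_rate ^ l) ^ 4 / (chain_rate ^ l) ^ 3 = 33 * chain_rate ^ l"
    using chain_rate(1) by (simp add: field_simps eval_nat_numeral)
  finally show "expectation (\<lambda>\<omega>. level_bound c (\<lambda>l. chain_rate ^ l) (\<lambda>t. fluct t \<omega>) l) \<le> 33 * chain_rate ^ l" .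
qed

lemma fluct_oscillation:
  assumes c: "0 \<le> c" "c \<le> 1" and b: "2 ^ b \<le> n"
  obtains W where "integrable M W" "expectation W \<le> chain_const * chain_rate ^ b + 1 / sqrt (real n)"
    "\<And>\<omega> t. 0 \<le> t \<Longrightarrow> t \<le> c \<Longrightarrow> \<bar>fluct t \<omega> - fluct (c * real (grid_index c (2 ^ b) t) / 2 ^ b) \<omega>\<bar> \<le> W \<omega>"
proof -
  have n: "n > 0" using b by (metis gr0I le_zero_eq power_not_zero zero_neq_numeral)
  \<comment> \<open>The finest level at which the moment bound still applies. Since
    \<open>n < 2 ^ (R + 1)\<close>, the drift over one of its cells is at most
    \<open>1 / sqrt n\<close>.\<close>
  obtain R where R: "2 ^ R \<le> n" "n < 2 ^ (R + 1)"
    using ex_power_ivl1[of 2 n] n by auto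
  have "2 ^ b < (2::nat) ^ (R + 1)" using b R(2) by linarith
  then have "b \<le> R" by (simp add: power_strict_increasing_iff del: power_Suc)
  define V where "V l \<omega> = level_bound c (\<lambda>l. chain_rate ^ l) (\<lambda>t. fluct t \<omega>) l" for l \<omega>
  define W where "W \<omega> = (\<Sum>l\<in>{b<..R}. V l \<omega>) + V R \<omega> + (sqrt (real n) / 2) * c / 2 ^ R" for \<omega>
  have V: "integrable M (V l)" "expectation (V l) \<le> 33 * chain_rate ^ l" if "l \<le> R" for l
  proof -
    have "(2::nat) ^ l \<le> 2 ^ R" using that by (intro power_increasing) auto
    then have "2 ^ l \<le> n" using R(1) by linarith
    from expectation_level_bound[OF c this]
    show "integrable M (V l)" "expectation (V l) \<le> 33 * chain_rate ^ l" unfolding V_def .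
  qed
  have Vsum: "integrable M (\<lambda>\<omega>. \<Sum>l\<in>{b<..R}. V l \<omega>)"
    using V(1) by (intro Bochner_Integration.integrable_sum) auto
  have int: "integrable M W"
    unfolding W_def using V(1)[of R] Vsum by (intro Bochner_Integration.integrable_add) auto
  have "expectation W = expectation (\<lambda>\<omega>. \<Sum>l\<in>{b<..R}. V l \<omega>) + expectation (V R) + (sqrt (real n) / 2) * c / 2 ^ R"
    unfolding W_def using V(1)[of R] Vsum by (simp add: prob_space)
  also have "expectation (\<lambda>\<omega>. \<Sum>l\<in>{b<..R}. V l \<omega>) = (\<Sum>l\<in>{b<..R}. expectation (V l))"
    using V(1) by (intro Bochner_Integration.integral_sum) auto
  also have "(\<Sum>l\<in>{b<..R}. expectation (V l)) + expectation (V R) + (sqrt (real n) / 2) * c / 2 ^ R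
      \<le> (\<Sum>l\<in>{b<..R}. 33 * chain_rate ^ l) + 33 * chain_rate ^ b + 1 / sqrt (real n)"
  proof (intro add_mono sum_mono)
    show "expectation (V l) \<le> 33 * chain_rate ^ l" if "l \<in> {b<..R}" for l using V(2)[of l] that by simp
    have "chain_rate ^ R \<le> chain_rate ^ b"
      using chain_rate \<open>b \<le> R\<close> by (intro power_decreasing) auto
    then show "expectation (V R) \<le> 33 * chain_rate ^ b" using V(2)[of R] by simp
    have "real n \<le> real (2 ^ (R + 1))" using R(2) by (intro of_nat_mono) simp
    then have "real n \<le> 2 ^ R * 2" by simp
    then have "sqrt (real n) * c / (2 ^ R * 2) \<le> sqrt (real n) * 1 / real n"
      using c n by (intro frac_le mult_left_mono) auto
    also have "\<dots> = 1 / sqrt (real n)" using sqrt_divide_self_eq[of "real n"] by (simp add: inverse_eq_divide)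
    finally show "(sqrt (real n) / 2) * c / 2 ^ R \<le> 1 / sqrt (real n)" by (simp add: mult.commute)
  qed
  also have "(\<Sum>l\<in>{b<..R}. 33 * chain_rate ^ l) \<le> 33 * (chain_rate ^ b / (1 - chain_rate))"
  proof -
    have "(\<Sum>l\<in>{b<..R}. chain_rate ^ l) = (chain_rate ^ Suc b - chain_rate ^ Suc R) / (1 - chain_rate)"
      using \<open>b \<le> R\<close>
    proof (induction R rule: dec_induct)
      case (step r)
      have "{b<..Suc r} = insert (Suc r) {b<..r}" using step.hyps by auto
      then have "(\<Sum>l\<in>{b<..Suc r}. chain_rate ^ l) =
          chain_rate ^ Suc r + (chain_rate ^ Suc b - chain_rate ^ Suc r) / (1 - chain_rate)"
        using step.IH by simp
      also have "\<dots> = (chain_rate ^ Suc b - chain_rate ^ Suc (Suc r)) / (1 - chain_rate)"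
        using chain_rate(2) by (simp add: field_simps)
      finally show ?case .
    qed simp
    also have "\<dots> \<le> chain_rate ^ b / (1 - chain_rate)"
    proof (rule divide_right_mono)
      have "chain_rate ^ Suc b \<le> chain_rate ^ b" using chain_rate by (intro power_decreasing) auto
      moreover have "0 \<le> chain_rate ^ Suc R" using chain_rate by simp
      ultimately show "chain_rate ^ Suc b - chain_rate ^ Suc R \<le> chain_rate ^ b" by linarith
    qed (use chain_rate in simp)
    finally show ?thesis by (simp add: sum_distrib_left[symmetric])
  qed
  finally have E: "expectation W \<le> chain_const * chain_rate ^ b + 1 / sqrt (real n)"
    by (simp add: chain_const_def algebra_simps)
  have dom: "\<bar>fluct t \<omega> - fluct (c * real (grid_index c (2 ^ b) t) / 2 ^ b) \<omega>\<bar> \<le> W \<omega>"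
    if "0 \<le> t" "t \<le> c" for t \<omega>
    unfolding W_def V_def
  proof (rule chaining[where N = "\<lambda>t. edge_count t \<omega> / sqrt (real n)"])
    show "fluct t \<omega> = sqrt (real n) / 2 * t - edge_count t \<omega> / sqrt (real n)" for t
    proof -
      have "real n * t / 2 / sqrt (real n) = real n / sqrt (real n) * (t / 2)" by simp
      then show ?thesis by (simp add: fluct_def diff_divide_distrib real_div_sqrt)
    qed
    show "mono (\<lambda>t. edge_count t \<omega> / sqrt (real n))"
      by (intro monoI divide_right_mono edge_count_mono) auto
  qed (use that \<open>b \<le> R\<close> chain_rate in auto)
  show thesis by (rule that[OF int E dom])
qed

text \<open>The windows are disjoint, so a clock rings in at most one of them and the exponential of
  its contribution is linear in the window indicators. Independence gives a product over the pairs,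
  all with the same factor; the centring is the deterministic phase in front.\<close>

lemma char_fluct_increments:
  fixes \<tau> l :: "nat \<Rightarrow> real"
  assumes n: "n > 0" and \<tau>: "mono \<tau>" "0 \<le> \<tau> 0"
  shows "expectation (\<lambda>\<omega>. iexp (\<Sum>j<k. l j * (fluct (\<tau> (Suc j)) \<omega> - fluct (\<tau> j) \<omega>))) =
    iexp (sqrt (real n) * (\<Sum>j<k. (\<tau> (Suc j) - \<tau> j) * l j / 2)) *
    (1 + (\<Sum>j<k. of_real (exp (- (\<tau> j / real n)) - exp (- (\<tau> (Suc j) / real n))) *
      (iexp (- (l j / sqrt (real n))) - 1))) ^ (n choose 2)"
proof -
  let ?I = "complete_edges n"
  let ?W = "\<lambda>j e \<omega>. window (\<tau> j) (\<tau> (Suc j)) e \<omega>"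
  have \<tau>S: "\<tau> j \<le> \<tau> (Suc j)" "0 \<le> \<tau> j" for j
    using \<tau> monoD[OF \<tau>(1), of j "Suc j"] monoD[OF \<tau>(1), of 0 j] by auto
  define g :: "real \<Rightarrow> complex" where "g x = 1 + (\<Sum>j<k. of_real (of_bool (\<tau> j / real n < x \<and> x \<le> \<tau> (Suc j) / real n)) *
      (iexp (- (l j / sqrt (real n))) - 1))" for x
  have gT: "g (T e \<omega>) = 1 + (\<Sum>j<k. of_real (?W j e \<omega>) * (iexp (- (l j / sqrt (real n))) - 1))" for e \<omega>
    by (simp add: g_def window_def)
  have g_exp: "iexp (- ((\<Sum>j<k. l j * ?W j e \<omega>) / sqrt (real n))) = g (T e \<omega>)" for e \<omega>
  proof (cases "\<exists>i<k. ?W i e \<omega> = 1")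
    case True
    then obtain i where i: "i < k" "?W i e \<omega> = 1" by blast
    have other: "?W j e \<omega> = 0" if "j \<noteq> i" for j
    proof -
      have "\<not> (\<tau> j / real n < T e \<omega> \<and> T e \<omega> \<le> \<tau> (Suc j) / real n)"
      proof
        assume *: "\<tau> j / real n < T e \<omega> \<and> T e \<omega> \<le> \<tau> (Suc j) / real n"
        have **: "\<tau> i / real n < T e \<omega>" "T e \<omega> \<le> \<tau> (Suc i) / real n"
          using i(2) by (auto simp: window_def)
        consider "Suc j \<le> i" | "Suc i \<le> j" using \<open>j \<noteq> i\<close> by linarith
        then show False
        proof cases
          case 1
          then have "\<tau> (Suc j) / real n \<le> \<tau> i / real n" using \<tau>(1) by (intro divide_right_mono) (auto dest: monoD)
          then show False using * ** by linarith
        next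
          case 2
          then have "\<tau> (Suc i) / real n \<le> \<tau> j / real n" using \<tau>(1) by (intro divide_right_mono) (auto dest: monoD)
          then show False using * ** by linarith
        qed
      qed
      then show ?thesis by (simp add: window_def)
    qed
    \<comment> \<open>Polymorphic, for use with the real exponent and with the complex sum in
      \<open>g\<close>.\<close>
    have single: "(\<Sum>j<k. f j * of_real (?W j e \<omega>)) = f i" for f :: "nat \<Rightarrow> 'c :: real_normed_field"
    proof -
      have "(\<Sum>j<k. f j * of_real (?W j e \<omega>)) = (\<Sum>j<k. if j = i then f i else 0)"
        by (rule sum.cong) (use other i in auto)
      then show ?thesis using i by simp
    qed
    show ?thesis unfolding gT
      using single[of l] single[of "\<lambda>j. iexp (- (l j / sqrt (real n))) - 1"] by (simp add: mult.commute)
  next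
    case False
    then have "?W j e \<omega> = 0" if "j < k" for j using that by (auto simp: window_def)
    then show ?thesis unfolding gT by simp
  qed
  have gm: "g \<in> borel_measurable borel" unfolding g_def by measurable
  have gb: "norm (g (T e \<omega>)) = 1" for e \<omega> unfolding g_exp[symmetric] by (rule norm_exp_i_times)
  have Eg: "expectation (\<lambda>\<omega>. g (T e \<omega>)) = 1 + (\<Sum>j<k. of_real (window_prob (\<tau> j) (\<tau> (Suc j))) *
      (iexp (- (l j / sqrt (real n))) - 1))" if e: "e \<in> ?I" for e
  proof -
    have wint: "integrable M (window s t e)" for s t
      using window_measurable[OF e] by (intro integrable_const_bound[where B = 1]) (auto simp: window_def)
    then have wint': "integrable M (\<lambda>\<omega>. complex_of_real (window s t e \<omega>))" for s t by (rule integrable_of_real)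
    have "expectation (\<lambda>\<omega>. g (T e \<omega>)) = 1 + (\<Sum>j<k. expectation (\<lambda>\<omega>. of_real (?W j e \<omega>)) * (iexp (- (l j / sqrt (real n))) - 1))"
      unfolding gT using wint'
      by (subst Bochner_Integration.integral_add) (auto simp: prob_space Bochner_Integration.integral_sum)
    then show ?thesis using expectation_window[OF e \<tau>S(2,1)] by simp
  qed
  have ind: "indep_vars (\<lambda>_. borel) (\<lambda>e \<omega>. g (T e \<omega>)) ?I"
    using indep_vars_compose2[OF indep, of "\<lambda>_. g" "\<lambda>_. borel"] gm by simp
  have gint: "integrable M (\<lambda>\<omega>. g (T e \<omega>))" if "e \<in> ?I" for e
    using measurable_compose[OF T_measurable[OF that] gm] gb
    by (intro integrable_const_bound[where B = 1]) auto
  have "iexp (\<Sum>j<k. l j * (fluct (\<tau> (Suc j)) \<omega> - fluct (\<tau> j) \<omega>)) =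
      iexp (sqrt (real n) * (\<Sum>j<k. (\<tau> (Suc j) - \<tau> j) * l j / 2)) * (\<Prod>e\<in>?I. g (T e \<omega>))" for \<omega>
  proof -
    have "(\<Sum>j<k. l j * (fluct (\<tau> (Suc j)) \<omega> - fluct (\<tau> j) \<omega>)) =
      (\<Sum>j<k. sqrt (real n) * ((\<tau> (Suc j) - \<tau> j) * l j / 2) - (\<Sum>e\<in>?I. l j * ?W j e \<omega>) / sqrt (real n))"
    proof (rule sum.cong)
      fix j
      have "real n * (\<tau> (Suc j) - \<tau> j) / 2 / sqrt (real n) = real n / sqrt (real n) * ((\<tau> (Suc j) - \<tau> j) / 2)"
        by simp
      then have key: "real n * (\<tau> (Suc j) - \<tau> j) / 2 / sqrt (real n) = sqrt (real n) * ((\<tau> (Suc j) - \<tau> j) / 2)"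
        by (simp only: real_div_sqrt of_nat_0_le_iff)
      show "l j * (fluct (\<tau> (Suc j)) \<omega> - fluct (\<tau> j) \<omega>) =
        sqrt (real n) * ((\<tau> (Suc j) - \<tau> j) * l j / 2) - (\<Sum>e\<in>?I. l j * ?W j e \<omega>) / sqrt (real n)"
        unfolding fluct_diff[OF \<tau>S(1)] diff_divide_distrib[of _ _ "sqrt (real n)"] key sum_distrib_left[symmetric]
        by (simp add: right_diff_distrib[of "l j"])
    qed simp
    also have "\<dots> = sqrt (real n) * (\<Sum>j<k. (\<tau> (Suc j) - \<tau> j) * l j / 2) +
        (\<Sum>e\<in>?I. - ((\<Sum>j<k. l j * ?W j e \<omega>) / sqrt (real n)))"
      by (subst sum_subtractf) (simp add: sum_distrib_left sum_negf sum_divide_distrib[symmetric] sum.swap[of _ "{..<k}" ?I])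
    finally have "iexp (\<Sum>j<k. l j * (fluct (\<tau> (Suc j)) \<omega> - fluct (\<tau> j) \<omega>)) =
      iexp (sqrt (real n) * (\<Sum>j<k. (\<tau> (Suc j) - \<tau> j) * l j / 2)) *
      exp (\<Sum>e\<in>?I. \<i> * of_real (- ((\<Sum>j<k. l j * ?W j e \<omega>) / sqrt (real n))))"
      by (simp only: of_real_add distrib_left exp_add of_real_sum sum_distrib_left)
    then show ?thesis by (simp only: exp_sum[OF finite_complete_edges] g_exp)
  qed
  then have "expectation (\<lambda>\<omega>. iexp (\<Sum>j<k. l j * (fluct (\<tau> (Suc j)) \<omega> - fluct (\<tau> j) \<omega>))) =
    iexp (sqrt (real n) * (\<Sum>j<k. (\<tau> (Suc j) - \<tau> j) * l j / 2)) * expectation (\<lambda>\<omega>. \<Prod>e\<in>?I. g (T e \<omega>))"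
    by (simp only: integral_mult_right_zero)
  also have "expectation (\<lambda>\<omega>. \<Prod>e\<in>?I. g (T e \<omega>)) = (\<Prod>e\<in>?I. expectation (\<lambda>\<omega>. g (T e \<omega>)))"
    by (rule indep_vars_lebesgue_integral[OF finite_complete_edges ind gint])
  finally show ?thesis using Eg by (simp add: card_complete_edges window_prob_def)
qed

section \<open>Components as a process in time\<close>

definition components :: "real \<Rightarrow> 'a \<Rightarrow> real" where
  "components t \<omega> = real (card (connected_components {1..n} (graph t \<omega>)))"

definition cycle_bound :: "real \<Rightarrow> 'a \<Rightarrow> real" where
  "cycle_bound t \<omega> = real (card (cyclic_edges (graph t \<omega>)))"

lemma components_measurable: "components t \<in> borel_measurable M"
  unfolding components_def by (rule measurable_graph) simp

lemma components_approx:
  assumes "s \<le> t"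
  shows "\<bar>components s \<omega> - (real n - edge_count s \<omega>)\<bar> \<le> cycle_bound t \<omega>"
proof -
  have sub: "graph u \<omega> \<subseteq> complete_edges n" for u by (auto simp: graph_def)
  have "components s \<omega> - (real n - edge_count s \<omega>) = of_int (excess n (graph s \<omega>))"
    by (simp add: components_def edge_count_def excess_def)
  moreover have "excess n (graph s \<omega>) \<le> excess n (graph t \<omega>)"
    using assms by (intro excess_mono graph_mono sub)
  then have "excess n (graph s \<omega>) \<le> int (card (cyclic_edges (graph t \<omega>)))"
    using excess_le_cyclic_edges[OF sub[of t]] by linarith
  ultimately show ?thesis using excess_nonneg[OF sub[of s]] by (simp add: cycle_bound_def)
qed

lemma expectation_cycle_bound:
  assumes c: "0 \<le> c" "c < 1"
  shows "integrable M (cycle_bound c)" "expectation (cycle_bound c) \<le> 1 / (1 - c)"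
proof -
  define p where "p = 1 - exp (- (c / real n))"
  define X where "X e \<omega> \<longleftrightarrow> T e \<omega> \<le> c / real n" for e \<omega>
  have p: "0 \<le> p" "p \<le> c / real n"
    using c exp_ge_add_one_self[of "- (c / real n)"] by (simp_all add: p_def)
  \<comment> \<open>Subcriticality: the mean degree is at most \<open>c < 1\<close>, so the
    denominator \<open>1 - n * p\<close> is at least \<open>1 - c\<close> for every
    \<open>n\<close>.\<close>
  have np: "real n * p \<le> c" using p c by (cases "n = 0") (simp_all add: field_simps)
  have "(\<lambda>x. x \<le> c / real n) \<in> borel \<rightarrow>\<^sub>M count_space UNIV" for x :: real by measurable
  then have ind: "indep_vars (\<lambda>_. count_space UNIV) X (complete_edges n)"
    using indep_vars_compose2[OF indep, of "\<lambda>_ x. x \<le> c / real n" "\<lambda>_. count_space UNIV"]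
    by (simp add: X_def[abs_def])
  have pX: "prob {\<omega> \<in> space M. X e \<omega>} = p" if "e \<in> complete_edges n" for e
    using prob_clock_le[OF that, of "c / real n"] c by (simp add: X_def p_def)
  have cb: "cycle_bound c = (\<lambda>\<omega>. real (card (cyclic_edges {e \<in> complete_edges n. X e \<omega>})))"
    by (simp add: cycle_bound_def graph_def X_def fun_eq_iff)
  have "real n * p < 1" using np c by linarith
  note * = expectation_cyclic_edges_le[OF ind pX p(1) this, folded cb]
  show "integrable M (cycle_bound c)" by (rule *(1))
  have "real (n choose 2) * (p * (p / (1 - real n * p))) \<le> (real n)\<^sup>2 * (p * (p / (1 - c)))"
  proof (intro mult_mono divide_left_mono)
    show "real (n choose 2) \<le> (real n)\<^sup>2"
      by (cases n) (simp_all add: choose_two real_of_nat_div power2_eq_square field_simps)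
    show "0 < (1 - real n * p) * (1 - c)" using np c by (intro mult_pos_pos) auto
  qed (use p np c in \<open>auto intro!: mult_nonneg_nonneg divide_nonneg_nonneg\<close>)
  also have "\<dots> = (real n * p)\<^sup>2 / (1 - c)" by (simp add: power2_eq_square)
  also have "\<dots> \<le> 1 / (1 - c)"
    using c np p by (intro divide_right_mono power_le_one) auto
  finally show "expectation (cycle_bound c) \<le> 1 / (1 - c)" using *(2) by linarith
qed

text \<open>There are finitely many clocks, so the graph does not change during a short time after
  \<open>t\<close>.\<close>

lemma tendsto_components_right: "((\<lambda>s. components s \<omega>) \<longlongrightarrow> components t \<omega>) (at_right t)"
proof -
  have "eventually (\<lambda>s. \<forall>e\<in>complete_edges n. T e \<omega> \<le> s / real n \<longleftrightarrow> T e \<omega> \<le> t / real n) (at_right t)"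
  proof (rule eventually_ball_finite[OF finite_complete_edges], rule ballI)
    fix e assume "e \<in> complete_edges n"
    have lim: "((\<lambda>s. s * inverse (real n)) \<longlongrightarrow> t * inverse (real n)) (at_right t)"
      by (intro tendsto_intros)
    have gt: "eventually (\<lambda>s. t < s) (at_right t)" by (simp add: eventually_at_filter)
    show "eventually (\<lambda>s. T e \<omega> \<le> s / real n \<longleftrightarrow> T e \<omega> \<le> t / real n) (at_right t)"
    proof (cases "T e \<omega> \<le> t / real n")
      case True
      from gt show ?thesis
      proof eventually_elim
        case (elim s)
        have "t / real n \<le> s / real n" using elim by (intro divide_right_mono) auto
        then show ?case using True by linarith
      qed
    next
      case False
      then have "eventually (\<lambda>s. s * inverse (real n) < T e \<omega>) (at_right t)"
        by (intro order_tendstoD(2)[OF lim]) (simp add: divide_inverse)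
      then show ?thesis by eventually_elim (use False in \<open>simp add: divide_inverse\<close>)
    qed
  qed
  then have "eventually (\<lambda>s. components s \<omega> = components t \<omega>) (at_right t)"
    by eventually_elim (simp add: components_def graph_def cong: conj_cong)
  then show ?thesis by (rule tendsto_eventually)
qed

lemma tendsto_components_left: "\<exists>k. ((\<lambda>s. components s \<omega>) \<longlongrightarrow> k) (at_left t)"
proof -
  \<comment> \<open>Clocks ringing exactly at \<open>t / n\<close> have not rung yet, so the left
    limit belongs to the graph given by the strict inequality.\<close>
  have "eventually (\<lambda>s. \<forall>e\<in>complete_edges n. T e \<omega> \<le> s / real n \<longleftrightarrow> T e \<omega> < t / real n) (at_left t)"
  proof (rule eventually_ball_finite[OF finite_complete_edges], rule ballI)
    fix e assume e: "e \<in> complete_edges n"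
    then have n: "n > 0" by (rule complete_edgesE) auto
    have lim: "((\<lambda>s. s / real n) \<longlongrightarrow> t / real n) (at_left t)"
      using n by (intro tendsto_intros) auto
    have lt: "eventually (\<lambda>s. s < t) (at_left t)" by (simp add: eventually_at_filter)
    show "eventually (\<lambda>s. T e \<omega> \<le> s / real n \<longleftrightarrow> T e \<omega> < t / real n) (at_left t)"
    proof (cases "T e \<omega> < t / real n")
      case True
      from order_tendstoD(1)[OF lim True] show ?thesis by eventually_elim (use True in simp)
    next
      case False
      from lt show ?thesis
      proof eventually_elim
        case (elim s)
        have "s / real n < t / real n" using elim n by (intro divide_strict_right_mono) auto
        then show ?case using False by linarith
      qed
    qed
  qed
  then have "eventually (\<lambda>s. components s \<omega> =
      real (card (connected_components {1..n} {e \<in> complete_edges n. T e \<omega> < t / real n}))) (at_left t)"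
    by eventually_elim (simp add: components_def graph_def cong: conj_cong)
  from tendsto_eventually[OF this] show ?thesis by (rule exI)
qed

end

section \<open>Step approximation of the component process\<close>

lemma restrict_cadlag:
  assumes "\<And>t. t \<in> {0..<c} \<Longrightarrow> (f \<longlongrightarrow> f t) (at_right t)"
    and "\<And>t. t \<in> {0<..c} \<Longrightarrow> \<exists>l. (f \<longlongrightarrow> l) (at_left t)"
  shows "(\<lambda>t\<in>{0..c}. f t) \<in> cadlag c"
proof -
  let ?x = "\<lambda>t\<in>{0..c}. f t"
  have "(?x \<longlongrightarrow> ?x t) (at_right t)" if t: "t \<in> {0..<c}" for t
  proof -
    have "eventually (\<lambda>s. ?x s = f s) (at_right t)"
      unfolding eventually_at_right_field using t by (intro exI[of _ c]) auto
    from tendsto_cong[OF this, of "f t"] have "(?x \<longlongrightarrow> f t) (at_right t)"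
      using assms(1)[OF t] by (simp only:)
    then show ?thesis using t by simp
  qed
  moreover have "\<exists>l. (?x \<longlongrightarrow> l) (at_left t)" if t: "t \<in> {0<..c}" for t
  proof -
    have "eventually (\<lambda>s. ?x s = f s) (at_left t)"
      unfolding eventually_at_left_field using t by (intro exI[of _ 0]) auto
    from tendsto_cong[OF this] show ?thesis using assms(2)[OF t] by (simp only:)
  qed
  ultimately show ?thesis by (simp add: cadlag_def)
qed

lemma continuous_restrict_cadlag:
  assumes "continuous_on {0..c} f"
  shows "(\<lambda>t\<in>{0..c}. f t) \<in> cadlag c"
proof (rule restrict_cadlag)
  have within: "(f \<longlongrightarrow> f t) (at t within {0..c})" if "t \<in> {0..c}" for t
    using assms that by (simp add: continuous_on_def)
  show "(f \<longlongrightarrow> f t) (at_right t)" if "t \<in> {0..<c}" for t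
  proof -
    have "(f \<longlongrightarrow> f t) (at t within {t..c})"
      by (rule tendsto_within_subset[OF within]) (use that in auto)
    then show ?thesis using that by (simp add: at_within_Icc_at_right)
  qed
  show "\<exists>l. (f \<longlongrightarrow> l) (at_left t)" if "t \<in> {0<..c}" for t
  proof -
    have "(f \<longlongrightarrow> f t) (at t within {0..t})"
      by (rule tendsto_within_subset[OF within]) (use that in auto)
    then show ?thesis using that by (auto simp: at_within_Icc_at_left)
  qed
qed

text \<open>Parametrised by increments because their joint characteristic functions are the
  computable ones. Such a path vanishes on the first cell, so it can only approximate paths starting
  at \<open>0\<close>.\<close>

definition step_path :: "real \<Rightarrow> nat \<Rightarrow> (nat \<Rightarrow> real) \<Rightarrow> real \<Rightarrow> real" where
  "step_path c k d = (\<lambda>t\<in>{0..c}. \<Sum>j<grid_index c k t. d j)"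

lemma step_path_cadlag: "0 \<le> c \<Longrightarrow> step_path c k d \<in> cadlag c"
  unfolding step_path_def by (rule step_function_cadlag[where F = "\<lambda>i. \<Sum>j<i. d j"])

text \<open>Turns a Lipschitz functional of the path into a function of the increments that is
  Lipschitz in the sense of \<open>multivariate_Levy_continuity\<close>.\<close>

lemma step_path_dist_le:
  assumes "0 \<le> c"
  shows "skorokhod_dist c (step_path c k d) (step_path c k d') \<le> (\<Sum>j<k. \<bar>d j - d' j\<bar>)"
proof (rule skorokhod_dist_le_sup)
  fix t assume t: "t \<in> {0..c}"
  then have "grid_index c k t \<le> k" by (intro grid_index_le) auto
  have "\<bar>step_path c k d t - step_path c k d' t\<bar> = \<bar>\<Sum>j<grid_index c k t. d j - d' j\<bar>"
    using t by (simp add: step_path_def sum_subtractf)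
  also have "\<dots> \<le> (\<Sum>j<grid_index c k t. \<bar>d j - d' j\<bar>)" by (rule sum_abs)
  also have "\<dots> \<le> (\<Sum>j<k. \<bar>d j - d' j\<bar>)"
    using \<open>grid_index c k t \<le> k\<close> by (intro sum_mono2) auto
  finally show "\<bar>step_path c k d t - step_path c k d' t\<bar> \<le> (\<Sum>j<k. \<bar>d j - d' j\<bar>)" .
qed (use assms in \<open>auto intro: step_path_cadlag sum_nonneg\<close>)

lemma step_path_measurable:
  assumes "0 \<le> c" "\<And>j. j < k \<Longrightarrow> (\<lambda>\<omega>. d \<omega> j) \<in> borel_measurable M"
  shows "(\<lambda>\<omega>. step_path c k (d \<omega>)) \<in> M \<rightarrow>\<^sub>M borel_algebra (skorokhod_topology c)"
proof (rule measurable_skorokhod[OF assms(1)])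
  fix t assume t: "t \<in> {0..c}"
  then have "grid_index c k t \<le> k" by (intro grid_index_le) auto
  then show "(\<lambda>\<omega>. step_path c k (d \<omega>) t) \<in> borel_measurable M"
    using t assms(2) by (auto simp: step_path_def intro!: borel_measurable_sum)
qed (rule step_path_cadlag[OF assms(1)])

lemma step_path_increments:
  assumes "t \<in> {0..c}"
  shows "step_path c k (\<lambda>j. x (c * real (Suc j) / real k) - x (c * real j / real k)) t =
    x (c * real (grid_index c k t) / real k) - x 0"
  using assms sum_lessThan_telescope[of "\<lambda>j. x (c * real j / real k)" "grid_index c k t"]
  by (simp add: step_path_def)

section \<open>Lipschitz functionals of random paths\<close>

lemma skorokhod_Lipschitz_measurable:
  assumes c: "0 \<le> c" and f: "Metric_space.Lipschitz_real (cadlag c) (skorokhod_dist c) f L"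
    and X: "X \<in> M \<rightarrow>\<^sub>M borel_algebra (skorokhod_topology c)"
  shows "(\<lambda>\<omega>. f (X \<omega>)) \<in> borel_measurable M"
proof -
  interpret S: Metric_space "cadlag c" "skorokhod_dist c" by (rule Metric_space_skorokhod[OF c])
  have "f \<in> borel_measurable (borel_algebra (skorokhod_topology c))"
    unfolding skorokhod_topology_def
    by (rule continuous_map_borel_measurable[OF S.Lipschitz_real_continuous_map[OF f]])
  from measurable_compose[OF X this] show ?thesis .
qed

lemma skorokhod_random_element:
  assumes c: "0 \<le> c" and X: "X \<in> M \<rightarrow>\<^sub>M borel_algebra (skorokhod_topology c)" and "\<omega> \<in> space M"
  shows "X \<omega> \<in> cadlag c"
proof -
  interpret S: Metric_space "cadlag c" "skorokhod_dist c" by (rule Metric_space_skorokhod[OF c])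
  show ?thesis
    using measurable_space[OF X assms(3)] by (simp add: space_borel_algebra skorokhod_topology_def)
qed

text \<open>An integrable majorant \<open>V\<close> of the sup distance stands in for the supremum,
  so measurability of the supremum itself is not an issue.\<close>

lemma (in prob_space) Lipschitz_expectation_diff:
  assumes c: "0 \<le> c" and f: "Metric_space.Lipschitz_real (cadlag c) (skorokhod_dist c) f L"
    and bdd: "\<And>x. x \<in> cadlag c \<Longrightarrow> \<bar>f x\<bar> \<le> B" and L: "0 \<le> L"
    and X: "X \<in> M \<rightarrow>\<^sub>M borel_algebra (skorokhod_topology c)"
    and Y: "Y \<in> M \<rightarrow>\<^sub>M borel_algebra (skorokhod_topology c)"
    and V: "integrable M V" "AE \<omega> in M. \<forall>t\<in>{0..c}. \<bar>X \<omega> t - Y \<omega> t\<bar> \<le> V \<omega>"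
  shows "\<bar>expectation (\<lambda>\<omega>. f (X \<omega>)) - expectation (\<lambda>\<omega>. f (Y \<omega>))\<bar> \<le> L * expectation V"
proof -
  interpret S: Metric_space "cadlag c" "skorokhod_dist c" by (rule Metric_space_skorokhod[OF c])
  have int: "integrable M (\<lambda>\<omega>. f (Z \<omega>))" if "Z \<in> M \<rightarrow>\<^sub>M borel_algebra (skorokhod_topology c)" for Z
    using skorokhod_Lipschitz_measurable[OF c f that] bdd skorokhod_random_element[OF c that]
    by (intro integrable_const_bound[where B = B]) auto
  have "\<bar>expectation (\<lambda>\<omega>. f (X \<omega>)) - expectation (\<lambda>\<omega>. f (Y \<omega>))\<bar> = \<bar>expectation (\<lambda>\<omega>. f (X \<omega>) - f (Y \<omega>))\<bar>"
    using int[OF X] int[OF Y] by simp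
  also have "\<dots> \<le> expectation (\<lambda>\<omega>. \<bar>f (X \<omega>) - f (Y \<omega>)\<bar>)" by (rule integral_abs_bound)
  also have "\<dots> \<le> expectation (\<lambda>\<omega>. L * V \<omega>)"
  proof (rule integral_mono_AE)
    show "AE \<omega> in M. \<bar>f (X \<omega>) - f (Y \<omega>)\<bar> \<le> L * V \<omega>"
      using V(2) AE_space
    proof eventually_elim
      case (elim \<omega>)
      have XY: "X \<omega> \<in> cadlag c" "Y \<omega> \<in> cadlag c"
        using skorokhod_random_element[OF c X] skorokhod_random_element[OF c Y] elim by auto
      have "0 \<in> {0..c}" using c by simp
      then have "0 \<le> V \<omega>" using elim(1) abs_ge_zero order_trans by blast
      have "\<bar>f (X \<omega>) - f (Y \<omega>)\<bar> \<le> L * skorokhod_dist c (X \<omega>) (Y \<omega>)"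
        using f XY by (auto simp: S.Lipschitz_real_def)
      also have "\<dots> \<le> L * V \<omega>"
        using elim XY \<open>0 \<le> V \<omega>\<close> L by (intro mult_left_mono skorokhod_dist_le_sup) auto
      finally show ?case .
    qed
  qed (use int[OF X] int[OF Y] V(1) in auto)
  finally show ?thesis by simp
qed

section \<open>The scaled component process and its step approximation\<close>

context edge_clocks begin

definition scaled :: "real \<Rightarrow> 'a \<Rightarrow> real" where
  "scaled t \<omega> = sqrt (real n) * ((1 / real n) * components t \<omega> - (1 - t / 2))"

lemma scaled_approx:
  assumes n: "n > 0" and "s \<le> t"
  shows "\<bar>scaled s \<omega> - fluct s \<omega>\<bar> \<le> cycle_bound t \<omega> / sqrt (real n)"
proof -
  define r where "r = sqrt (real n)"
  have s: "sqrt (real n) > 0" and r: "r > 0" "real n = r * r" using n by (simp_all add: r_def)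
  have "scaled s \<omega> = r * ((1 / (r * r)) * components s \<omega> - (1 - s / 2))"
    unfolding scaled_def r(2) using r(1) by simp
  also have "\<dots> = (components s \<omega> - r * r * (1 - s / 2)) / r" using r(1) by (simp add: field_simps)
  finally have "scaled s \<omega> = (components s \<omega> - real n * (1 - s / 2)) / r" unfolding r(2)[symmetric] .
  then have "scaled s \<omega> = (components s \<omega> - real n * (1 - s / 2)) / sqrt (real n)" unfolding r_def .
  then have "scaled s \<omega> - fluct s \<omega> = (components s \<omega> - (real n - edge_count s \<omega>)) / sqrt (real n)"
    by (simp add: fluct_def diff_divide_distrib[symmetric] algebra_simps)
  then show ?thesis using components_approx[OF assms(2), of \<omega>] s by (simp add: divide_right_mono)
qed

text \<open>The coefficients \<open>\<alpha>\<close> and \<open>\<beta>\<close> cover both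
  normalisations of the component count.\<close>

lemma components_path_measurable:
  assumes c: "0 \<le> c" and \<beta>: "continuous_on UNIV \<beta>"
  shows "(\<lambda>\<omega>. \<lambda>t\<in>{0..c}. \<alpha> * components t \<omega> + \<beta> t) \<in> M \<rightarrow>\<^sub>M borel_algebra (skorokhod_topology c)"
proof (rule measurable_skorokhod[OF c])
  fix \<omega>
  have \<beta>lim: "(\<beta> \<longlongrightarrow> \<beta> t) (at t within A)" for t A
  proof -
    have "(\<beta> \<longlongrightarrow> \<beta> t) (at t within UNIV)" using \<beta> by (simp add: continuous_on_def)
    then show ?thesis by (rule tendsto_within_subset) simp
  qed
  show "(\<lambda>t\<in>{0..c}. \<alpha> * components t \<omega> + \<beta> t) \<in> cadlag c"
  proof (rule restrict_cadlag)
    show "((\<lambda>t. \<alpha> * components t \<omega> + \<beta> t) \<longlongrightarrow> \<alpha> * components t \<omega> + \<beta> t) (at_right t)" for t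
      by (intro tendsto_intros tendsto_components_right \<beta>lim)
    show "\<exists>l. ((\<lambda>t. \<alpha> * components t \<omega> + \<beta> t) \<longlongrightarrow> l) (at_left t)" for t
    proof -
      obtain k where "((\<lambda>s. components s \<omega>) \<longlongrightarrow> k) (at_left t)" using tendsto_components_left by blast
      then have "((\<lambda>t. \<alpha> * components t \<omega> + \<beta> t) \<longlongrightarrow> \<alpha> * k + \<beta> t) (at_left t)"
        by (intro tendsto_intros \<beta>lim)
      then show ?thesis by (rule exI)
    qed
  qed
next
  show "(\<lambda>\<omega>. (\<lambda>t\<in>{0..c}. \<alpha> * components t \<omega> + \<beta> t) t) \<in> borel_measurable M" if "t \<in> {0..c}" for t
    using components_measurable[of t] that by simp
qed

text \<open>An exponential clock is positive only almost surely. The statement lets a step path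
  built from increments reproduce the values of \<open>fluct\<close> on the grid.\<close>

lemma AE_fluct_0: "AE \<omega> in M. fluct 0 \<omega> = 0"
proof -
  have "AE \<omega> in M. \<not> T e \<omega> \<le> 0" if e: "e \<in> complete_edges n" for e
  proof -
    have ev: "{\<omega> \<in> space M. \<not> \<not> T e \<omega> \<le> 0} \<in> events" using T_measurable[OF e] by measurable
    have "{\<omega> \<in> space M. \<not> \<not> T e \<omega> \<le> 0} \<in> null_sets M"
      using prob_clock_le[OF e, of 0] ev by (intro null_setsI) (auto simp: emeasure_eq_measure)
    then show ?thesis using AE_iff_null[OF ev] by blast
  qed
  then have "AE \<omega> in M. \<forall>e\<in>complete_edges n. \<not> T e \<omega> \<le> 0"
    by (intro AE_finite_allI finite_complete_edges)
  then show ?thesis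
  proof eventually_elim
    case (elim \<omega>)
    then have "graph 0 \<omega> = {}" by (auto simp: graph_def)
    then show ?case by (simp add: fluct_def edge_count_def)
  qed
qed

definition increments :: "real \<Rightarrow> nat \<Rightarrow> 'a \<Rightarrow> nat \<Rightarrow> real" where
  "increments c k \<omega> j = fluct (c * real (Suc j) / real k) \<omega> - fluct (c * real j / real k) \<omega>"

text \<open>The chaining error depends on \<open>b\<close> alone, and the bias at the finest scale
  together with the cycles vanishes with \<open>n\<close>: these are the errors \<open>e\<close> and
  \<open>d\<close> of \<open>tendsto_by_approximations\<close>.\<close>

lemma scaled_step_approx:
  assumes c: "0 \<le> c" "c < 1" and b: "2 ^ b \<le> n"
  obtains V where "integrable M V"
    "expectation V \<le> chain_const * chain_rate ^ b + (1 + 1 / (1 - c)) / sqrt (real n)"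
    "AE \<omega> in M. \<forall>t\<in>{0..c}. \<bar>scaled t \<omega> - step_path c (2 ^ b) (increments c (2 ^ b) \<omega>) t\<bar> \<le> V \<omega>"
proof -
  have n: "n > 0" using b by (metis gr0I le_zero_eq power_not_zero zero_neq_numeral)
  obtain W where W: "integrable M W" "expectation W \<le> chain_const * chain_rate ^ b + 1 / sqrt (real n)"
    "\<And>\<omega> t. 0 \<le> t \<Longrightarrow> t \<le> c \<Longrightarrow> \<bar>fluct t \<omega> - fluct (c * real (grid_index c (2 ^ b) t) / 2 ^ b) \<omega>\<bar> \<le> W \<omega>"
    using fluct_oscillation[OF c(1) less_imp_le[OF c(2)] b] by blast
  define V where "V \<omega> = W \<omega> + cycle_bound c \<omega> / sqrt (real n)" for \<omega>
  note cb = expectation_cycle_bound[OF c]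
  have int: "integrable M V" unfolding V_def using W(1) cb(1) by auto
  have "expectation V = expectation W + expectation (cycle_bound c) / sqrt (real n)"
    unfolding V_def using W(1) cb(1) by simp
  also have "\<dots> \<le> (chain_const * chain_rate ^ b + 1 / sqrt (real n)) + (1 / (1 - c)) / sqrt (real n)"
    by (intro add_mono W(2) divide_right_mono cb(2)) auto
  also have "\<dots> = chain_const * chain_rate ^ b + (1 + 1 / (1 - c)) / sqrt (real n)"
    by (simp add: add_divide_distrib)
  finally have E: "expectation V \<le> chain_const * chain_rate ^ b + (1 + 1 / (1 - c)) / sqrt (real n)" .
  have ae: "AE \<omega> in M. \<forall>t\<in>{0..c}. \<bar>scaled t \<omega> - step_path c (2 ^ b) (increments c (2 ^ b) \<omega>) t\<bar> \<le> V \<omega>"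
    using AE_fluct_0
  proof eventually_elim
    case (elim \<omega>)
    show ?case
    proof
      fix t assume t: "t \<in> {0..c}"
      have "step_path c (2 ^ b) (increments c (2 ^ b) \<omega>) t = fluct (c * real (grid_index c (2 ^ b) t) / 2 ^ b) \<omega>"
        using step_path_increments[OF t, of "2 ^ b" "\<lambda>t. fluct t \<omega>"] elim
        by (simp add: increments_def[abs_def])
      then show "\<bar>scaled t \<omega> - step_path c (2 ^ b) (increments c (2 ^ b) \<omega>) t\<bar> \<le> V \<omega>"
        using W(3)[of t \<omega>] scaled_approx[OF n, of t c \<omega>] t unfolding V_def by auto
    qed
  qed
  show thesis by (rule that[OF int E ae])
qed

lemma increments_moment:
  assumes c: "0 \<le> c" "c \<le> 1" and n: "n > 0" and j: "j < k"
  shows "integrable M (\<lambda>\<omega>. increments c k \<omega> j ^ 4)" "expectation (\<lambda>\<omega>. increments c k \<omega> j ^ 4) \<le> 32"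
proof -
  define s t where "s = c * real j / real k" and "t = c * real (Suc j) / real k"
  have k: "real k > 0" using j by simp
  have st: "0 \<le> s" "s \<le> t" using c k by (auto simp: s_def t_def intro!: divide_right_mono mult_left_mono)
  have "c * real (Suc j) \<le> 1 * real k" using c j by (intro mult_mono) auto
  then have t1: "t \<le> 1" using k by (simp add: t_def)
  have eq: "increments c k \<omega> j = fluct t \<omega> - fluct s \<omega>" for \<omega> by (simp add: increments_def s_def t_def)
  note m = fluct_increment_moment[OF n st t1, folded eq]
  show "integrable M (\<lambda>\<omega>. increments c k \<omega> j ^ 4)" by (rule m(1))
  have h: "t - s \<le> 1" "0 \<le> t - s" using st t1 by auto
  then have "(t - s)\<^sup>2 \<le> 1" by (simp add: power_le_one)
  moreover have "(t - s) / real n \<le> 1" using h n by (simp add: divide_le_eq)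
  ultimately have "16 * ((t - s)\<^sup>2 + (t - s) / real n) \<le> 16 * (1 + 1)"
    by (intro mult_left_mono add_mono) auto
  from order_trans[OF m(2) this] show "expectation (\<lambda>\<omega>. increments c k \<omega> j ^ 4) \<le> 32" by simp
qed

text \<open>Chaining from level \<open>0\<close> compares the path with its single increment over
  \<open>[0, c]\<close>. Of the constant \<open>34\<close>, one comes from the remainder over
  \<open>sqrt n\<close>, and \<open>33 = 1 + 32\<close> from
  \<open>\<bar>x\<bar> \<le> 1 + x^4\<close> with fourth moment at most \<open>32\<close>.\<close>

lemma scaled_sup_bound:
  assumes c: "0 \<le> c" "c < 1" and n: "n > 0"
  obtains V where "integrable M V" "expectation V \<le> chain_const + 34 + 1 / (1 - c)"
    "AE \<omega> in M. \<forall>t\<in>{0..c}. \<bar>scaled t \<omega>\<bar> \<le> V \<omega>"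
proof -
  have "2 ^ 0 \<le> n" using n by simp
  from scaled_step_approx[OF c this] obtain V where V: "integrable M V"
    "expectation V \<le> chain_const * chain_rate ^ 0 + (1 + 1 / (1 - c)) / sqrt (real n)"
    "AE \<omega> in M. \<forall>t\<in>{0..c}. \<bar>scaled t \<omega> - step_path c (2 ^ 0) (increments c (2 ^ 0) \<omega>) t\<bar> \<le> V \<omega>" by blast
  note m = increments_moment[OF c(1) less_imp_le[OF c(2)] n, of 0 1]
  let ?U = "\<lambda>\<omega>. V \<omega> + (1 + increments c 1 \<omega> 0 ^ 4)"
  have int: "integrable M ?U" using V(1) m(1) by auto
  have "expectation ?U = expectation V + (1 + expectation (\<lambda>\<omega>. increments c 1 \<omega> 0 ^ 4))"
    using V(1) m(1) by (simp add: prob_space)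
  also have "\<dots> \<le> (chain_const + (1 + 1 / (1 - c)) / 1) + (1 + 32)"
  proof (intro add_mono order_refl)
    have "(1 + 1 / (1 - c)) / sqrt (real n) \<le> (1 + 1 / (1 - c)) / 1"
      using n c by (intro divide_left_mono) auto
    then show "expectation V \<le> chain_const + (1 + 1 / (1 - c)) / 1" using V(2) by simp
  qed (use m(2) in simp)
  finally have E: "expectation ?U \<le> chain_const + 34 + 1 / (1 - c)" by simp
  have ae: "AE \<omega> in M. \<forall>t\<in>{0..c}. \<bar>scaled t \<omega>\<bar> \<le> ?U \<omega>"
    using V(3)
  proof eventually_elim
    case (elim \<omega>)
    show ?case
    proof
      fix t assume t: "t \<in> {0..c}"
      have "grid_index c 1 t \<le> 1" using t by (intro grid_index_le) auto
      then have "grid_index c 1 t = 0 \<or> grid_index c 1 t = 1" by linarith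
      then have "\<bar>step_path c 1 (increments c 1 \<omega>) t\<bar> \<le> \<bar>increments c 1 \<omega> 0\<bar>"
        using t by (auto simp: step_path_def)
      also have "\<dots> \<le> 1 + increments c 1 \<omega> 0 ^ 4"
        using abs_le_fourth_power[of 1 "increments c 1 \<omega> 0"] by simp
      finally show "\<bar>scaled t \<omega>\<bar> \<le> ?U \<omega>" using bspec[OF elim t] by simp
    qed
  qed
  show thesis by (rule that[OF int E ae])
qed

end

section \<open>Brownian increments and step paths\<close>

lemma normal_iexp_integral:
  assumes "prob_space N" "distributed N lborel X (normal_density 0 \<sigma>)" "\<sigma> > 0"
  shows "(\<integral>\<omega>. iexp (l * X \<omega>) \<partial>N) = exp (of_real (- (l\<^sup>2 * \<sigma>\<^sup>2 / 2)))"
proof -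
  interpret prob_space N by fact
  let ?Z = "\<lambda>\<omega>. (X \<omega> - 0) / \<sigma>"
  have Z: "distributed N lborel ?Z std_normal_density"
    using normal_standard_normal_convert[OF assms(3)] assms(2) by blast
  have "?Z \<in> borel_measurable N" using distributed_measurable[OF Z] by simp
  then have "char (distr N lborel ?Z) (l * \<sigma>) = (\<integral>\<omega>. iexp (l * \<sigma> * ?Z \<omega>) \<partial>N)"
    unfolding char_def by (subst integral_distr) auto
  also have "distr N lborel ?Z = std_normal_distribution"
    using distributed_distr_eq_density[OF Z] by simp
  finally have "(\<integral>\<omega>. iexp (l * \<sigma> * ?Z \<omega>) \<partial>N) = exp (of_real (- ((l * \<sigma>)\<^sup>2) / 2))"
    by (simp only: char_std_normal_distribution exp_of_real)
  moreover have "l * \<sigma> * ?Z \<omega> = l * X \<omega>" for \<omega> using assms(3) by simp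
  moreover have "- ((l * \<sigma>)\<^sup>2) / 2 = - (l\<^sup>2 * \<sigma>\<^sup>2 / 2)" by (simp add: power_mult_distrib)
  ultimately show ?thesis by (simp only:)
qed

lemma brownian_iexp_increments:
  assumes B: "standard_brownian_motion N B" and \<tau>: "mono \<tau>" "0 \<le> \<tau> 0"
  shows "(\<integral>\<omega>. iexp (\<Sum>j<k. l j * (B (\<tau> (Suc j)) \<omega> - B (\<tau> j) \<omega>)) \<partial>N) =
    exp (of_real (- (\<Sum>j<k. (\<tau> (Suc j) - \<tau> j) * (l j)\<^sup>2 / 2)))"
proof -
  interpret prob_space N using B by (simp add: standard_brownian_motion_def)
  have \<tau>S: "\<tau> j \<le> \<tau> (Suc j)" "0 \<le> \<tau> j" for j
    using \<tau> monoD[OF \<tau>(1), of j "Suc j"] monoD[OF \<tau>(1), of 0 j] by auto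
  let ?D = "\<lambda>j \<omega>. B (\<tau> (Suc j)) \<omega> - B (\<tau> j) \<omega>"
  have ind: "indep_vars (\<lambda>_. borel) ?D {..<k}"
    using B \<tau>(2) \<tau>S(1) by (simp add: standard_brownian_motion_def)
  have m: "?D j \<in> borel_measurable N" for j
    using B \<tau>S(2) by (intro borel_measurable_diff) (auto simp: standard_brownian_motion_def)
  have gm: "(\<lambda>x. iexp (l j * x)) \<in> borel_measurable borel" for j by measurable
  have ind': "indep_vars (\<lambda>_. borel) (\<lambda>j \<omega>. iexp (l j * ?D j \<omega>)) {..<k}"
    using indep_vars_compose2[OF ind, of "\<lambda>j x. iexp (l j * x)" "\<lambda>_. borel"] gm by simp
  have int: "integrable N (\<lambda>\<omega>. iexp (l j * ?D j \<omega>))" for j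
    using measurable_compose[OF m gm] by (intro integrable_const_bound[where B = 1]) auto
  have one: "expectation (\<lambda>\<omega>. iexp (l j * ?D j \<omega>)) = exp (of_real (- ((\<tau> (Suc j) - \<tau> j) * (l j)\<^sup>2 / 2)))" for j
  \<comment> \<open>Normal increments are given only for \<open>s < t\<close>; an empty window, as
    for \<open>c = 0\<close>, contributes the factor one.\<close>
  proof (cases "\<tau> j = \<tau> (Suc j)")
    case True
    then show ?thesis by (simp add: prob_space)
  next
    case False
    then have lt: "\<tau> j < \<tau> (Suc j)" using \<tau>S(1)[of j] by simp
    then have "distributed N lborel (?D j) (normal_density 0 (sqrt (\<tau> (Suc j) - \<tau> j)))"
      using B \<tau>S(2) by (simp add: standard_brownian_motion_def)
    from normal_iexp_integral[OF prob_space_axioms this] lt show ?thesis by (simp add: mult.commute)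
  qed
  have "iexp (\<Sum>j<k. l j * ?D j \<omega>) = (\<Prod>j<k. iexp (l j * ?D j \<omega>))" for \<omega>
    by (simp only: of_real_sum sum_distrib_left exp_sum[OF finite_lessThan])
  then have "expectation (\<lambda>\<omega>. iexp (\<Sum>j<k. l j * ?D j \<omega>)) = expectation (\<lambda>\<omega>. \<Prod>j<k. iexp (l j * ?D j \<omega>))"
    by (simp only:)
  also have "\<dots> = (\<Prod>j<k. expectation (\<lambda>\<omega>. iexp (l j * ?D j \<omega>)))"
    by (rule indep_vars_lebesgue_integral[OF finite_lessThan ind' int])
  also have "\<dots> = exp (of_real (- (\<Sum>j<k. (\<tau> (Suc j) - \<tau> j) * (l j)\<^sup>2 / 2)))"
    unfolding one by (simp only: exp_sum[OF finite_lessThan, symmetric] of_real_sum[symmetric] sum_negf)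
  finally show ?thesis .
qed

text \<open>As \<open>x 0 = 0\<close>, the step path at \<open>t\<close> is \<open>x\<close> at the
  grid point below \<open>t\<close>, and uniform continuity applies.\<close>

lemma step_path_tendsto_continuous:
  assumes c: "0 \<le> c" and x: "continuous_on {0..c} x" and x0: "x 0 = 0"
  shows "(\<lambda>m. skorokhod_dist c (step_path c (2 ^ m) (\<lambda>j. x (c * real (Suc j) / 2 ^ m) - x (c * real j / 2 ^ m)))
    (\<lambda>t\<in>{0..c}. x t)) \<longlonglongrightarrow> 0"
proof (rule LIMSEQ_I)
  interpret S: Metric_space "cadlag c" "skorokhod_dist c" by (rule Metric_space_skorokhod[OF c])
  fix \<epsilon> :: real assume \<epsilon>: "\<epsilon> > 0"
  have "uniformly_continuous_on {0..c} x" using x by (intro compact_uniformly_continuous) auto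
  then obtain \<delta> where \<delta>: "\<delta> > 0"
    "\<And>s t. s \<in> {0..c} \<Longrightarrow> t \<in> {0..c} \<Longrightarrow> dist s t < \<delta> \<Longrightarrow> dist (x s) (x t) < \<epsilon> / 2"
    using \<epsilon> unfolding uniformly_continuous_on_def by (meson half_gt_zero)
  have "(\<lambda>m. c * (1 / 2) ^ m) \<longlonglongrightarrow> c * 0" by (intro tendsto_intros LIMSEQ_realpow_zero) auto
  then have "eventually (\<lambda>m. c * (1 / 2) ^ m < \<delta>) sequentially"
    using order_tendstoD(2)[of _ "c * 0" _ \<delta>] \<delta>(1) by simp
  then obtain m0 where m0: "\<And>m. m \<ge> m0 \<Longrightarrow> c * (1 / 2) ^ m < \<delta>" by (auto simp: eventually_sequentially)
  have "norm (skorokhod_dist c (step_path c (2 ^ m) (\<lambda>j. x (c * real (Suc j) / 2 ^ m) - x (c * real j / 2 ^ m)))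
      (\<lambda>t\<in>{0..c}. x t) - 0) < \<epsilon>" if m: "m \<ge> m0" for m
  proof -
    have "skorokhod_dist c (step_path c (2 ^ m) (\<lambda>j. x (c * real (Suc j) / 2 ^ m) - x (c * real j / 2 ^ m)))
      (\<lambda>t\<in>{0..c}. x t) \<le> \<epsilon> / 2"
    proof (rule skorokhod_dist_le_sup[OF step_path_cadlag[OF c] continuous_restrict_cadlag[OF x]])
      fix t assume t: "t \<in> {0..c}"
      let ?g = "c * real (grid_index c (2 ^ m) t) / 2 ^ m"
      have g: "?g \<le> t" "t \<le> c * real (Suc (grid_index c (2 ^ m) t)) / 2 ^ m" "0 \<le> ?g"
        using grid_index_bounds[of t c "2 ^ m"] t by simp_all
      have "c * real (Suc (grid_index c (2 ^ m) t)) / 2 ^ m = ?g + c * (1 / 2) ^ m"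
        by (simp add: field_simps power_one_over)
      then have "dist ?g t < \<delta>" using g m0[OF m] by (simp add: dist_real_def)
      then have "dist (x ?g) (x t) < \<epsilon> / 2" using g t by (intro \<delta>(2)) auto
      then show "\<bar>step_path c (2 ^ m) (\<lambda>j. x (c * real (Suc j) / 2 ^ m) - x (c * real j / 2 ^ m)) t
          - (\<lambda>t\<in>{0..c}. x t) t\<bar> \<le> \<epsilon> / 2"
        using step_path_increments[OF t, of "2 ^ m" x] t x0 by (simp add: dist_real_def)
    qed (use \<epsilon> in simp)
    then show ?thesis using S.nonneg \<epsilon> by (simp add: abs_of_nonneg)
  qed
  then show "\<exists>m0. \<forall>m\<ge>m0. norm (skorokhod_dist c (step_path c (2 ^ m) (\<lambda>j. x (c * real (Suc j) / 2 ^ m) - x (c * real j / 2 ^ m)))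
      (\<lambda>t\<in>{0..c}. x t) - 0) < \<epsilon>" by blast
qed

lemma ER_process_edge_clocks:
  assumes "ER_process n M G"
  obtains T where "edge_clocks M n T"
    "\<And>t \<omega>. \<omega> \<in> space M \<Longrightarrow> 0 \<le> t \<Longrightarrow> real (K_ER n G (t / real n) \<omega>) = edge_clocks.components n T t \<omega>"
proof -
  obtain T where T: "prob_space.indep_vars M (\<lambda>_. borel) T (complete_edges n)"
    "\<And>e. e \<in> complete_edges n \<Longrightarrow> distributed M lborel (T e) (exponential_density 1)"
    "\<And>\<omega> t. \<omega> \<in> space M \<Longrightarrow> 0 \<le> t \<Longrightarrow> G t \<omega> = {e \<in> complete_edges n. T e \<omega> \<le> t}" and M: "prob_space M"
    using assms unfolding ER_process_def by blast
  interpret prob_space M by fact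
  have ec: "edge_clocks M n T" by (unfold_locales) (use T in auto)
  then interpret edge_clocks M n T .
  show thesis
    by (rule that[OF ec]) (simp add: K_ER_def components_def graph_def T(3))
qed

section \<open>Limit theorems\<close>

text \<open>On a fixed grid both sides are functions of finitely many increments. Brownian motion
  run at half speed has variance \<open>(\<tau> (Suc j) - \<tau> j) / 2\<close> on window
  \<open>j\<close>, which matches the limit in \<open>binomial_char_tendsto\<close>.\<close>

lemma increments_tendsto_brownian:
  fixes N :: "'b measure" and M :: "nat \<Rightarrow> 'a measure"
  assumes ec: "\<And>n. edge_clocks (M n) n (T n)" and c: "0 \<le> c" "c < 1"
    and B: "standard_brownian_motion N B"
    and f: "Metric_space.Lipschitz_real (cadlag c) (skorokhod_dist c) f L" and L: "0 \<le> L"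
    and bdd: "\<And>x. x \<in> cadlag c \<Longrightarrow> \<bar>f x\<bar> \<le> b" and k: "k > 0"
  shows "(\<lambda>n. \<integral>\<omega>. f (step_path c k (edge_clocks.increments n (T n) c k \<omega>)) \<partial>M n) \<longlonglongrightarrow>
    (\<integral>\<omega>. f (step_path c k (\<lambda>j. B (c * real (Suc j) / real k / 2) \<omega> - B (c * real j / real k / 2) \<omega>)) \<partial>N)"
proof -
  interpret S: Metric_space "cadlag c" "skorokhod_dist c" by (rule Metric_space_skorokhod[OF c(1)])
  have P: "prob_space (M n)" for n using ec[of n] by (simp add: edge_clocks_def)
  have N: "prob_space N" using B by (simp add: standard_brownian_motion_def)
  have Bm: "B t \<in> borel_measurable N" if "0 \<le> t" for t using B that by (simp add: standard_brownian_motion_def)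
  define \<tau> where "\<tau> j = c * real j / real k" for j
  have \<tau>: "mono \<tau>" "0 \<le> \<tau> 0" "0 \<le> \<tau> j" for j
    using c by (auto simp: \<tau>_def intro!: monoI divide_right_mono mult_left_mono)
  define D where "D = (\<lambda>n \<omega>. edge_clocks.increments n (T n) c k \<omega>)"
  define E where "E = (\<lambda>\<omega> j. B (\<tau> (Suc j) / 2) \<omega> - B (\<tau> j / 2) \<omega>)"
  have "(\<lambda>n. \<integral>\<omega>. f (step_path c k (D n \<omega>)) \<partial>M n) \<longlonglongrightarrow> (\<integral>\<omega>. f (step_path c k (E \<omega>)) \<partial>N)"
  proof (rule multivariate_Levy_continuity[OF P N, where D = D and E = E and g = "\<lambda>x. f (step_path c k x)" and C = 32 and k = k and B = b and L = L])
    fix n j assume j: "j < k"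
    interpret edge_clocks "M n" n "T n" by (rule ec)
    show "(\<lambda>\<omega>. D n \<omega> j) \<in> borel_measurable (M n)"
      unfolding D_def increments_def by (intro borel_measurable_diff fluct_measurable)
  next
    show "(\<lambda>\<omega>. E \<omega> j) \<in> borel_measurable N" for j
      unfolding E_def using \<tau>(3) by (intro borel_measurable_diff Bm) simp_all
  next
    show "eventually (\<lambda>n. \<forall>j<k. integrable (M n) (\<lambda>\<omega>. D n \<omega> j ^ 4) \<and> (\<integral>\<omega>. D n \<omega> j ^ 4 \<partial>M n) \<le> 32) sequentially"
      using eventually_gt_at_top[of 0]
    proof eventually_elim
      case (elim n)
      interpret edge_clocks "M n" n "T n" by (rule ec)
      show ?case unfolding D_def using increments_moment[OF c(1) less_imp_le[OF c(2)] elim] by blast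
    qed
  next
    fix l :: "nat \<Rightarrow> real"
    have EB: "(\<integral>\<omega>. iexp (\<Sum>j<k. l j * E \<omega> j) \<partial>N) =
        exp (of_real (- (\<Sum>j<k. (\<tau> (Suc j) - \<tau> j) * (l j)\<^sup>2 / 4)))"
    proof -
      have "mono (\<lambda>j. \<tau> j / 2)" using \<tau>(1) by (auto simp: mono_def intro: divide_right_mono)
      moreover have "0 \<le> \<tau> 0 / 2" using \<tau>(2) by simp
      ultimately have "(\<integral>\<omega>. iexp (\<Sum>j<k. l j * E \<omega> j) \<partial>N) =
          exp (of_real (- (\<Sum>j<k. (\<tau> (Suc j) / 2 - \<tau> j / 2) * (l j)\<^sup>2 / 2)))"
        unfolding E_def by (rule brownian_iexp_increments[OF B])
      also have "(\<Sum>j<k. (\<tau> (Suc j) / 2 - \<tau> j / 2) * (l j)\<^sup>2 / 2) = (\<Sum>j<k. (\<tau> (Suc j) - \<tau> j) * (l j)\<^sup>2 / 4)"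
        by (rule sum.cong) (simp_all add: field_simps)
      finally show ?thesis .
    qed
    have "eventually (\<lambda>n. (\<integral>\<omega>. iexp (\<Sum>j<k. l j * D n \<omega> j) \<partial>M n) =
      iexp (sqrt (real n) * (\<Sum>j<k. (\<tau> (Suc j) - \<tau> j) * l j / 2)) *
      (1 + (\<Sum>j<k. of_real (exp (- (\<tau> j / real n)) - exp (- (\<tau> (Suc j) / real n))) *
        (iexp (- (l j / sqrt (real n))) - 1))) ^ (n choose 2)) sequentially"
      using eventually_gt_at_top[of 0]
    proof eventually_elim
      case (elim n)
      interpret edge_clocks "M n" n "T n" by (rule ec)
      show ?case
        using char_fluct_increments[OF elim \<tau>(1,2), of l k] by (simp only: D_def increments_def \<tau>_def)
    qed
    from tendsto_cong[OF this]
    show "(\<lambda>n. \<integral>\<omega>. iexp (\<Sum>j<k. l j * D n \<omega> j) \<partial>M n) \<longlonglongrightarrow> (\<integral>\<omega>. iexp (\<Sum>j<k. l j * E \<omega> j) \<partial>N)"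
      unfolding EB using binomial_char_tendsto[OF \<tau>(1,2), where l = l and k = k] by (simp only:)
  next
    show "\<bar>f (step_path c k x)\<bar> \<le> b" for x by (rule bdd[OF step_path_cadlag[OF c(1)]])
    show "\<bar>f (step_path c k x) - f (step_path c k y)\<bar> \<le> L * (\<Sum>j<k. \<bar>x j - y j\<bar>)" for x y
    proof -
      have "\<bar>f (step_path c k x) - f (step_path c k y)\<bar> \<le> L * skorokhod_dist c (step_path c k x) (step_path c k y)"
        using f step_path_cadlag[OF c(1)] by (simp add: S.Lipschitz_real_def)
      also have "\<dots> \<le> L * (\<Sum>j<k. \<bar>x j - y j\<bar>)" using L step_path_dist_le[OF c(1)] by (intro mult_left_mono)
      finally show ?thesis .
    qed
  qed (rule L)
  then show ?thesis unfolding D_def E_def \<tau>_def .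
qed

lemma brownian_path_measurable:
  assumes B: "standard_brownian_motion N B" and c: "0 \<le> c"
  shows "(\<lambda>\<omega>. \<lambda>t\<in>{0..c}. B (t / 2) \<omega>) \<in> N \<rightarrow>\<^sub>M borel_algebra (skorokhod_topology c)"
    and "\<omega> \<in> space N \<Longrightarrow> continuous_on {0..c} (\<lambda>t. B (t / 2) \<omega>)"
proof -
  show cont: "continuous_on {0..c} (\<lambda>t. B (t / 2) \<omega>)" if "\<omega> \<in> space N" for \<omega>
  proof -
    have "continuous_on {0..} (\<lambda>t. B t \<omega>)" using B that by (simp add: standard_brownian_motion_def)
    then show ?thesis by (rule continuous_on_compose2) (auto intro!: continuous_intros)
  qed
  show "(\<lambda>\<omega>. \<lambda>t\<in>{0..c}. B (t / 2) \<omega>) \<in> N \<rightarrow>\<^sub>M borel_algebra (skorokhod_topology c)"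
  proof (rule measurable_skorokhod[OF c])
    show "(\<lambda>t\<in>{0..c}. B (t / 2) \<omega>) \<in> cadlag c" if "\<omega> \<in> space N" for \<omega>
      by (rule continuous_restrict_cadlag[OF cont[OF that]])
    show "(\<lambda>\<omega>. (\<lambda>t\<in>{0..c}. B (t / 2) \<omega>) t) \<in> borel_measurable N" if "t \<in> {0..c}" for t
      using B that by (simp add: standard_brownian_motion_def)
  qed
qed

lemma brownian_step_tendsto:
  assumes B: "standard_brownian_motion N B" and c: "0 \<le> c"
    and f: "Metric_space.Lipschitz_real (cadlag c) (skorokhod_dist c) f L"
    and bdd: "\<And>x. x \<in> cadlag c \<Longrightarrow> \<bar>f x\<bar> \<le> b"
  shows "(\<lambda>m. \<integral>\<omega>. f (step_path c (2 ^ m) (\<lambda>j. B (c * real (Suc j) / real (2 ^ m) / 2) \<omega> - B (c * real j / real (2 ^ m) / 2) \<omega>)) \<partial>N)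
    \<longlonglongrightarrow> (\<integral>\<omega>. f (\<lambda>t\<in>{0..c}. B (t / 2) \<omega>) \<partial>N)"
proof (rule integral_dominated_convergence[where w = "\<lambda>_. b"])
  interpret S: Metric_space "cadlag c" "skorokhod_dist c" by (rule Metric_space_skorokhod[OF c])
  interpret prob_space N using B by (simp add: standard_brownian_motion_def)
  let ?s = "\<lambda>m \<omega>. step_path c (2 ^ m) (\<lambda>j. B (c * real (Suc j) / real (2 ^ m) / 2) \<omega> - B (c * real j / real (2 ^ m) / 2) \<omega>)"
  let ?y = "\<lambda>\<omega>. \<lambda>t\<in>{0..c}. B (t / 2) \<omega>"
  show "(\<lambda>\<omega>. f (?y \<omega>)) \<in> borel_measurable N"
    by (rule skorokhod_Lipschitz_measurable[OF c f brownian_path_measurable(1)[OF B c]])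
  show "(\<lambda>\<omega>. f (?s m \<omega>)) \<in> borel_measurable N" for m
  proof (rule skorokhod_Lipschitz_measurable[OF c f step_path_measurable[OF c]])
    show "(\<lambda>\<omega>. B (c * real (Suc j) / real (2 ^ m) / 2) \<omega> - B (c * real j / real (2 ^ m) / 2) \<omega>) \<in> borel_measurable N" for j
      using B c by (intro borel_measurable_diff) (simp_all add: standard_brownian_motion_def)
  qed
  have "AE \<omega> in N. B 0 \<omega> = 0" using B by (simp add: standard_brownian_motion_def)
  then show "AE \<omega> in N. (\<lambda>m. f (?s m \<omega>)) \<longlonglongrightarrow> f (?y \<omega>)"
    using AE_space
  proof eventually_elim
    case (elim \<omega>)
    note cont = brownian_path_measurable(2)[OF B c elim(2)]
    have "(\<lambda>m. skorokhod_dist c (?s m \<omega>) (?y \<omega>)) \<longlonglongrightarrow> 0"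
      using step_path_tendsto_continuous[OF c cont] elim(1) by simp
    then have lim: "(\<lambda>m. L * skorokhod_dist c (?s m \<omega>) (?y \<omega>)) \<longlonglongrightarrow> 0"
      by (rule tendsto_mult_right_zero)
    have "eventually (\<lambda>m. norm (f (?s m \<omega>) - f (?y \<omega>)) \<le> L * skorokhod_dist c (?s m \<omega>) (?y \<omega>)) sequentially"
      using f step_path_cadlag[OF c] continuous_restrict_cadlag[OF cont]
      by (intro always_eventually) (simp add: S.Lipschitz_real_def)
    from LIM_zero_cancel[OF Lim_null_comparison[OF this lim]] show ?case .
  qed
  show "integrable N (\<lambda>_. b)" by simp
qed (use bdd step_path_cadlag[OF c] in auto)

lemma fluctuation_limit:
  fixes N :: "'b measure" and M :: "nat \<Rightarrow> 'a measure"
  assumes ec: "\<And>n. edge_clocks (M n) n (T n)" and c: "0 \<le> c" "c < 1"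
    and B: "standard_brownian_motion N B"
    and X: "\<And>n. X n \<in> M n \<rightarrow>\<^sub>M borel_algebra (skorokhod_topology c)"
    and X_scaled: "\<And>n \<omega> t. \<omega> \<in> space (M n) \<Longrightarrow> t \<in> {0..c} \<Longrightarrow> X n \<omega> t = edge_clocks.scaled n (T n) t \<omega>"
  shows "converges_in_distribution (skorokhod_topology c) M X N (\<lambda>\<omega>. \<lambda>t\<in>{0..c}. B (t / 2) \<omega>)"
proof -
  interpret S: Metric_space "cadlag c" "skorokhod_dist c" by (rule Metric_space_skorokhod[OF c(1)])
  have P: "prob_space (M n)" for n using ec[of n] by (simp add: edge_clocks_def)
  have N: "prob_space N" using B by (simp add: standard_brownian_motion_def)
  have "converges_in_distribution S.mtopology M X N (\<lambda>\<omega>. \<lambda>t\<in>{0..c}. B (t / 2) \<omega>)"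
  proof (rule S.converges_in_distribution_Lipschitz[OF P N])
    show "X n \<in> M n \<rightarrow>\<^sub>M borel_algebra S.mtopology" for n
      using X[of n] by (simp add: skorokhod_topology_def)
    show "(\<lambda>\<omega>. \<lambda>t\<in>{0..c}. B (t / 2) \<omega>) \<in> N \<rightarrow>\<^sub>M borel_algebra S.mtopology"
      using brownian_path_measurable(1)[OF B c(1)] by (simp add: skorokhod_topology_def)
  next
    fix f L b assume L: "0 \<le> L" and f: "S.Lipschitz_real f L" and bdd: "\<And>x. x \<in> cadlag c \<Longrightarrow> \<bar>f x\<bar> \<le> b"
    show "(\<lambda>n. \<integral>\<omega>. f (X n \<omega>) \<partial>M n) \<longlonglongrightarrow> (\<integral>\<omega>. f (\<lambda>t\<in>{0..c}. B (t / 2) \<omega>) \<partial>N)"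
    proof (rule tendsto_by_approximations[where e = "\<lambda>m. L * (chain_const * chain_rate ^ m)"
          and d = "\<lambda>n. L * ((1 + 1 / (1 - c)) / sqrt (real n))"])
      show "(\<lambda>n. \<integral>\<omega>. f (step_path c (2 ^ m) (edge_clocks.increments n (T n) c (2 ^ m) \<omega>)) \<partial>M n) \<longlonglongrightarrow>
          (\<integral>\<omega>. f (step_path c (2 ^ m) (\<lambda>j. B (c * real (Suc j) / real (2 ^ m) / 2) \<omega> - B (c * real j / real (2 ^ m) / 2) \<omega>)) \<partial>N)" for m
        by (rule increments_tendsto_brownian[OF ec c B f L bdd]) simp_all
      show "(\<lambda>m. \<integral>\<omega>. f (step_path c (2 ^ m) (\<lambda>j. B (c * real (Suc j) / real (2 ^ m) / 2) \<omega> - B (c * real j / real (2 ^ m) / 2) \<omega>)) \<partial>N)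
          \<longlonglongrightarrow> (\<integral>\<omega>. f (\<lambda>t\<in>{0..c}. B (t / 2) \<omega>) \<partial>N)"
        by (rule brownian_step_tendsto[OF B c(1) f bdd])
      show "(\<lambda>m. L * (chain_const * chain_rate ^ m)) \<longlonglongrightarrow> 0"
        using chain_rate by (intro tendsto_mult_right_zero LIMSEQ_realpow_zero) auto
      have "(\<lambda>n. a / sqrt (real n)) \<longlonglongrightarrow> 0" for a by real_asymp
      then show "(\<lambda>n. L * ((1 + 1 / (1 - c)) / sqrt (real n))) \<longlonglongrightarrow> 0" by (rule tendsto_mult_right_zero)
      show "eventually (\<lambda>n. \<bar>(\<integral>\<omega>. f (X n \<omega>) \<partial>M n) -
          (\<integral>\<omega>. f (step_path c (2 ^ m) (edge_clocks.increments n (T n) c (2 ^ m) \<omega>)) \<partial>M n)\<bar>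
          \<le> L * (chain_const * chain_rate ^ m) + L * ((1 + 1 / (1 - c)) / sqrt (real n))) sequentially" for m
        \<comment> \<open>Chaining can start at level \<open>m\<close> only if its cells are not
          finer than \<open>1 / n\<close>.\<close>
        using eventually_ge_at_top[of "2 ^ m"]
      proof eventually_elim
        case (elim n)
        interpret edge_clocks "M n" n "T n" by (rule ec)
        obtain V where V: "integrable (M n) V"
          "expectation V \<le> chain_const * chain_rate ^ m + (1 + 1 / (1 - c)) / sqrt (real n)"
          "AE \<omega> in M n. \<forall>t\<in>{0..c}. \<bar>scaled t \<omega> - step_path c (2 ^ m) (increments c (2 ^ m) \<omega>) t\<bar> \<le> V \<omega>"
          using scaled_step_approx[OF c elim] by blast
        have "\<bar>expectation (\<lambda>\<omega>. f (X n \<omega>)) - expectation (\<lambda>\<omega>. f (step_path c (2 ^ m) (increments c (2 ^ m) \<omega>)))\<bar>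
          \<le> L * expectation V"
        proof (rule Lipschitz_expectation_diff[OF c(1) f bdd L X _ V(1)])
          show "(\<lambda>\<omega>. step_path c (2 ^ m) (increments c (2 ^ m) \<omega>)) \<in> M n \<rightarrow>\<^sub>M borel_algebra (skorokhod_topology c)"
            unfolding increments_def
            by (intro step_path_measurable[OF c(1)] borel_measurable_diff fluct_measurable)
          show "AE \<omega> in M n. \<forall>t\<in>{0..c}. \<bar>X n \<omega> t - step_path c (2 ^ m) (increments c (2 ^ m) \<omega>) t\<bar> \<le> V \<omega>"
            using V(3) AE_space by eventually_elim (simp add: X_scaled)
        qed
        also have "\<dots> \<le> L * (chain_const * chain_rate ^ m + (1 + 1 / (1 - c)) / sqrt (real n))"
          using V(2) L by (rule mult_left_mono)
        finally show ?case by (simp add: distrib_left)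
      qed
    qed
  qed
  then show ?thesis by (simp add: skorokhod_topology_def)
qed

text \<open>The deviation from the line is \<open>scaled\<close> divided by \<open>sqrt n\<close>,
  and the supremum of \<open>scaled\<close> has a majorant whose expectation is bounded in
  \<open>n\<close>. The deterministic limit lives on a one-point probability space.\<close>

lemma law_of_large_numbers_limit:
  fixes M :: "nat \<Rightarrow> 'a measure"
  assumes ec: "\<And>n. edge_clocks (M n) n (T n)" and c: "0 \<le> c" "c < 1"
    and X: "\<And>n. X n \<in> M n \<rightarrow>\<^sub>M borel_algebra (skorokhod_topology c)"
    and X_components: "\<And>n \<omega> t. \<omega> \<in> space (M n) \<Longrightarrow> t \<in> {0..c} \<Longrightarrow>
      X n \<omega> t = (1 / real n) * edge_clocks.components n (T n) t \<omega>"
  shows "converges_in_distribution (skorokhod_topology c) M X (return_pmf ()) (\<lambda>_. \<lambda>t\<in>{0..c}. 1 - t / 2)"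
proof -
  interpret S: Metric_space "cadlag c" "skorokhod_dist c" by (rule Metric_space_skorokhod[OF c(1)])
  have P: "prob_space (M n)" for n using ec[of n] by (simp add: edge_clocks_def)
  define y where "y = (\<lambda>t\<in>{0..c}. 1 - t / 2)"
  have y: "y \<in> cadlag c" unfolding y_def by (intro continuous_restrict_cadlag continuous_intros) auto
  have ym: "(\<lambda>_. y) \<in> M' \<rightarrow>\<^sub>M borel_algebra (skorokhod_topology c)" for M' :: "'c measure"
    using y by (intro measurable_const) (simp add: space_borel_algebra skorokhod_topology_def)
  have "converges_in_distribution S.mtopology M X (return_pmf ()) (\<lambda>_. y)"
  proof (rule S.converges_in_distribution_Lipschitz[OF P measure_pmf.prob_space_axioms])
    show "X n \<in> M n \<rightarrow>\<^sub>M borel_algebra S.mtopology" for n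
      using X[of n] by (simp add: skorokhod_topology_def)
    show "(\<lambda>_. y) \<in> measure_pmf (return_pmf ()) \<rightarrow>\<^sub>M borel_algebra S.mtopology"
      by (rule ym[unfolded skorokhod_topology_def])
  next
    fix f L b assume L: "0 \<le> L" and f: "S.Lipschitz_real f L" and bdd: "\<And>x. x \<in> cadlag c \<Longrightarrow> \<bar>f x\<bar> \<le> b"
    define K where "K = chain_const + 34 + 1 / (1 - c)"
    have lim: "(\<lambda>n. L * (K / sqrt (real n))) \<longlonglongrightarrow> 0"
      by (rule tendsto_mult_right_zero) real_asymp
    have "eventually (\<lambda>n. norm ((\<integral>\<omega>. f (X n \<omega>) \<partial>M n) - f y) \<le> L * (K / sqrt (real n))) sequentially"
      using eventually_gt_at_top[of 0]
    proof eventually_elim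
      case (elim n)
      interpret edge_clocks "M n" n "T n" by (rule ec)
      obtain V where V: "integrable (M n) V" "expectation V \<le> K"
        "AE \<omega> in M n. \<forall>t\<in>{0..c}. \<bar>scaled t \<omega>\<bar> \<le> V \<omega>"
        using scaled_sup_bound[OF c elim] unfolding K_def by blast
      have "\<bar>expectation (\<lambda>\<omega>. f (X n \<omega>)) - expectation (\<lambda>\<omega>. f y)\<bar> \<le> L * expectation (\<lambda>\<omega>. V \<omega> / sqrt (real n))"
      proof (rule Lipschitz_expectation_diff[OF c(1) f bdd L X ym])
        show "integrable (M n) (\<lambda>\<omega>. V \<omega> / sqrt (real n))" using V(1) by simp
        show "AE \<omega> in M n. \<forall>t\<in>{0..c}. \<bar>X n \<omega> t - y t\<bar> \<le> V \<omega> / sqrt (real n)"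
          using V(3) AE_space
        proof eventually_elim
          case (elim \<omega>)
          show ?case
          proof
            fix t assume t: "t \<in> {0..c}"
            have "sqrt (real n) * (X n \<omega> t - y t) = scaled t \<omega>"
              using X_components[OF elim(2) t] t by (simp add: scaled_def y_def)
            moreover have "sqrt (real n) * \<bar>X n \<omega> t - y t\<bar> = \<bar>sqrt (real n) * (X n \<omega> t - y t)\<bar>"
              by (simp add: abs_mult)
            ultimately have "sqrt (real n) * \<bar>X n \<omega> t - y t\<bar> = \<bar>scaled t \<omega>\<bar>" by simp
            also have "\<dots> \<le> V \<omega>" using elim(1) t by blast
            finally show "\<bar>X n \<omega> t - y t\<bar> \<le> V \<omega> / sqrt (real n)"
              using \<open>0 < n\<close> by (simp add: pos_le_divide_eq mult.commute)
          qed
        qed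
      qed
      also have "\<dots> \<le> L * (K / sqrt (real n))"
      proof (rule mult_left_mono[OF _ L])
        show "expectation (\<lambda>\<omega>. V \<omega> / sqrt (real n)) \<le> K / sqrt (real n)"
          using V(2) by (simp add: divide_right_mono)
      qed
      finally show ?case by (simp add: prob_space)
    qed
    from LIM_zero_cancel[OF Lim_null_comparison[OF this lim]]
    show "(\<lambda>n. \<integral>\<omega>. f (X n \<omega>) \<partial>M n) \<longlonglongrightarrow> (\<integral>\<omega>. f y \<partial>measure_pmf (return_pmf ()))"
      by simp
  qed
  then show ?thesis by (simp add: skorokhod_topology_def y_def)
qed

theorem theorem1p1:
  fixes M :: "nat \<Rightarrow> 'a measure"
    and ER :: "nat \<Rightarrow> real \<Rightarrow> 'a \<Rightarrow> nat set set"
    and c :: real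
  assumes "\<And>n. ER_process n (M n) (ER n)"
    and "0 \<le> c" and "c < 1"
  shows "converges_in_distribution (skorokhod_topology c)
           M (\<lambda>n \<omega>. \<lambda>t\<in>{0..c}. (1 / real n) * real (K_ER n (ER n) (t / real n) \<omega>))
           (return_pmf ()) (\<lambda>_. \<lambda>t\<in>{0..c}. 1 - t / 2)
       \<and> (\<forall>(N :: 'b measure) B. standard_brownian_motion N B \<longrightarrow>
           converges_in_distribution (skorokhod_topology c)
             M (\<lambda>n \<omega>. \<lambda>t\<in>{0..c}. sqrt (real n) *
                  ((1 / real n) * real (K_ER n (ER n) (t / real n) \<omega>) - (1 - t / 2)))
             N (\<lambda>\<omega>. \<lambda>t\<in>{0..c}. B (t / 2) \<omega>))"
proof -
  have "\<exists>T. edge_clocks (M n) n T \<and> (\<forall>t \<omega>. \<omega> \<in> space (M n) \<longrightarrow> 0 \<le> t \<longrightarrow>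
      real (K_ER n (ER n) (t / real n) \<omega>) = edge_clocks.components n T t \<omega>)" for n
    using ER_process_edge_clocks[OF assms(1)[of n]] by metis
  then obtain T where T: "\<And>n. edge_clocks (M n) n (T n)"
    "\<And>n t \<omega>. \<omega> \<in> space (M n) \<Longrightarrow> 0 \<le> t \<Longrightarrow>
      real (K_ER n (ER n) (t / real n) \<omega>) = edge_clocks.components n (T n) t \<omega>" by metis
  \<comment> \<open>The map \<open>F\<close> is kept abstract so that both displayed normalisations
    match literally. The path agrees with that of \<open>components\<close> only on the space of
    \<open>M n\<close>, hence the passage through \<open>measurable_cong\<close>.\<close>
  have meas: "(\<lambda>\<omega>. \<lambda>t\<in>{0..c}. F t (real (K_ER n (ER n) (t / real n) \<omega>))) \<in> M n \<rightarrow>\<^sub>M borel_algebra (skorokhod_topology c)"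
    if F: "\<And>t k. F t k = \<alpha> * k + \<beta> t" and \<beta>: "continuous_on UNIV \<beta>" for n \<alpha> \<beta> F
  proof -
    interpret edge_clocks "M n" n "T n" by (rule T(1))
    have eq: "(\<lambda>t\<in>{0..c}. F t (real (K_ER n (ER n) (t / real n) \<omega>))) = (\<lambda>t\<in>{0..c}. \<alpha> * components t \<omega> + \<beta> t)"
      if "\<omega> \<in> space (M n)" for \<omega>
      using T(2)[OF that] by (intro restrict_ext) (simp add: F)
    show ?thesis
      by (subst measurable_cong[OF eq]) (simp_all add: components_path_measurable[OF assms(2) \<beta>])
  qed
  show ?thesis
  proof (intro conjI allI impI)
    show "converges_in_distribution (skorokhod_topology c)
        M (\<lambda>n \<omega>. \<lambda>t\<in>{0..c}. (1 / real n) * real (K_ER n (ER n) (t / real n) \<omega>))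
        (return_pmf ()) (\<lambda>_. \<lambda>t\<in>{0..c}. 1 - t / 2)"
    proof (rule law_of_large_numbers_limit[OF T(1) assms(2,3)])
      show "(\<lambda>\<omega>. \<lambda>t\<in>{0..c}. (1 / real n) * real (K_ER n (ER n) (t / real n) \<omega>)) \<in>
          M n \<rightarrow>\<^sub>M borel_algebra (skorokhod_topology c)" for n
        by (rule meas[where \<alpha> = "1 / real n" and \<beta> = "\<lambda>_. 0"]) auto
    qed (use T(2) in simp)
    fix N :: "'b measure" and B assume "standard_brownian_motion N B"
    then show "converges_in_distribution (skorokhod_topology c)
        M (\<lambda>n \<omega>. \<lambda>t\<in>{0..c}. sqrt (real n) *
          ((1 / real n) * real (K_ER n (ER n) (t / real n) \<omega>) - (1 - t / 2)))
        N (\<lambda>\<omega>. \<lambda>t\<in>{0..c}. B (t / 2) \<omega>)"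
    proof (rule fluctuation_limit[OF T(1) assms(2,3)])
      show "(\<lambda>\<omega>. \<lambda>t\<in>{0..c}. sqrt (real n) * ((1 / real n) * real (K_ER n (ER n) (t / real n) \<omega>) - (1 - t / 2)))
          \<in> M n \<rightarrow>\<^sub>M borel_algebra (skorokhod_topology c)" for n
      proof (rule meas)
        show "sqrt (real n) * ((1 / real n) * k - (1 - t / 2)) =
            sqrt (real n) * (1 / real n) * k + - (sqrt (real n) * (1 - t / 2))" for t k
          by (simp add: right_diff_distrib)
      qed (intro continuous_intros, auto)
    qed (simp add: edge_clocks.scaled_def[OF T(1)] T(2))
  qed
qed

end
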